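(* Let $T>0$, $H\in(0,1)$, and let $B^{(1)},B^{(2)}$ be two independent fractional Brownian motions with Hurst index $H$. For $\varepsilon>0$ set \[ \widehat G_\varepsilon=\int_0^T\frac{B^{(1)}_{u+\varepsilon}-B^{(1)}_u}{\varepsilon}\times\frac{B^{(2)}_{u+\varepsilon}-B^{(2)}_u}{\varepsilon}\,\mathrm du . \] (a) If $H<\tfrac34$, then as $\varepsilon\to0$, \[ \Big(\big(B^{(1)}_t,B^{(2)}_t\big)_{t\in[0,T]},\ \varepsilon^{3/2-2H}\widehat G_\varepsilon\Big)\xrightarrow{\ \mathrm{Law}\ }\Big(\big(B^{(1)}_t,B^{(2)}_t\big)_{t\in[0,T]},\ N\Big), \] where $N\sim\mathscr N(0,T\widehat\sigma_H^2)$ is independent of $(B^{(1)},B^{(2)})$ and $\widehat\sigma_H^2=\frac14\int_{\mathbb R}\big(|x+1|^{2H}+|x-1|^{2H}-2|x|^{2H}\big)^2\,\mathrm dx$. (b) If $H=\tfrac34$, then as $\varepsilon\to0$, \[ \Big(\big(B^{(1)}_t,B^{(2)}_t\big)_{t\in[0,T]},\ \frac{\widehat G_\varepsilon}{\sqrt{\log(1/\varepsilon)}}\Big)\xrightarrow{\ \mathrm{Law}\ }\Big(\big(B^{(1)}_t,B^{(2)}_t\big)_{t\in[0,T]},\ N\Big), \] where $N\sim\mathscr N(0,9T/32)$ is independent of $(B^{(1)},B^{(2)})$.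
   Context: A fractional Brownian motion with Hurst index $H\in(0,1)$ is a centered Gaussian process $(B_t)_{t\ge0}$ with covariance $E(B_tB_s)=\tfrac12(t^{2H}+s^{2H}-|t-s|^{2H})$ (taken with continuous paths). Convergence in law is of random elements of $C([0,T];\mathbb R^2)\times\mathbb R$. *)

theory Defs
  imports "HOL-Probability.Probability"
begin

definition fbm_cov :: "real \<Rightarrow> real \<Rightarrow> real \<Rightarrow> real" where
  "fbm_cov H t s = (t powr (2*H) + s powr (2*H) - \<bar>t - s\<bar> powr (2*H)) / 2"

definition centered_gaussian :: "'a measure \<Rightarrow> ('a \<Rightarrow> real) \<Rightarrow> real \<Rightarrow> bool" where
  "centered_gaussian M X v \<longleftrightarrow>
     (v = 0 \<and> X \<in> borel_measurable M \<and> (AE \<omega> in M. X \<omega> = 0)) \<or>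
     (v > 0 \<and> distributed M lborel X (normal_density 0 (sqrt v)))"

definition is_fbm :: "'a measure \<Rightarrow> real \<Rightarrow> (real \<Rightarrow> 'a \<Rightarrow> real) \<Rightarrow> bool" where
  "is_fbm M H B \<longleftrightarrow>
     (\<forall>t\<ge>0. B t \<in> borel_measurable M) \<and>
     (\<forall>\<omega>\<in>space M. continuous_on {0..} (\<lambda>t. B t \<omega>)) \<and>
     (\<forall>(F::real set) (c::real \<Rightarrow> real). finite F \<and> F \<subseteq> {0..} \<longrightarrow>
        centered_gaussian M (\<lambda>\<omega>. \<Sum>t\<in>F. c t * B t \<omega>)
          (\<Sum>s\<in>F. \<Sum>t\<in>F. c s * c t * fbm_cov H s t))"

text \<open>Bounded continuous test functions on C([0,T];R^2) \<times> R (uniform metric on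
  the path component). A function on all paths is used, but it must depend only on
  the restriction of the path to [0,T], and continuity is only required on the
  continuous paths.\<close>
definition test_fun :: "real \<Rightarrow> ((real \<Rightarrow> real \<times> real) \<Rightarrow> real \<Rightarrow> real) \<Rightarrow> bool" where
  "test_fun T f \<longleftrightarrow>
     (\<exists>K. \<forall>w x. \<bar>f w x\<bar> \<le> K) \<and>
     (\<forall>w w' x. (\<forall>t\<in>{0..T}. w t = w' t) \<longrightarrow> f w x = f w' x) \<and>
     (\<forall>w x e. continuous_on {0..T} w \<and> e > 0 \<longrightarrow>
        (\<exists>d>0. \<forall>w' y. continuous_on {0..T} w' \<and>
            (\<forall>t\<in>{0..T}. dist (w t) (w' t) < d) \<and> \<bar>x - y\<bar> < d \<longrightarrow>
            \<bar>f w x - f w' y\<bar> < e))"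

text \<open>Convergence in law, as \<epsilon> \<rightarrow> 0+, of the random elements
  ((X_t)_{t\<in>[0,T]}, Y \<epsilon>) of C([0,T];R^2) \<times> R towards ((X_t)_{t\<in>[0,T]}, N)
  where N has law \<nu> and is independent of X.\<close>
definition conv_law_indep :: "'a measure \<Rightarrow> real \<Rightarrow> (real \<Rightarrow> 'a \<Rightarrow> real \<times> real)
    \<Rightarrow> (real \<Rightarrow> 'a \<Rightarrow> real) \<Rightarrow> real measure \<Rightarrow> bool" where
  "conv_law_indep M T X Y \<nu> \<longleftrightarrow>
     (\<forall>f. test_fun T f \<longrightarrow>
        ((\<lambda>\<epsilon>. \<integral>\<omega>. f (\<lambda>t. X t \<omega>) (Y \<epsilon> \<omega>) \<partial>M) \<longlongrightarrow>
          (\<integral>\<omega>. (\<integral>x. f (\<lambda>t. X t \<omega>) x \<partial>\<nu>) \<partial>M)) (at_right 0))"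

definition normal_law :: "real \<Rightarrow> real measure" where
  "normal_law v = density lborel (normal_density 0 (sqrt v))"

definition G_hat :: "real \<Rightarrow> (real \<Rightarrow> 'a \<Rightarrow> real) \<Rightarrow> (real \<Rightarrow> 'a \<Rightarrow> real) \<Rightarrow> real \<Rightarrow> 'a \<Rightarrow> real" where
  "G_hat T B1 B2 \<epsilon> \<omega> = (LBINT u=0..T. ((B1 (u + \<epsilon>) \<omega> - B1 u \<omega>) / \<epsilon>) *
                                      ((B2 (u + \<epsilon>) \<omega> - B2 u \<omega>) / \<epsilon>))"

definition sigma_hat_sq :: "real \<Rightarrow> real" where
  "sigma_hat_sq H = (1/4) * (LBINT x. (\<bar>x + 1\<bar> powr (2*H) + \<bar>x - 1\<bar> powr (2*H)
                                        - 2 * \<bar>x\<bar> powr (2*H))\<^sup>2)"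

end

theory Submission
  imports Defs "HOL-Real_Asymp.Real_Asymp"
begin

text \<open>
  Given \<open>B1\<close>, a linear functional of \<open>B2\<close> plus a multiple of the rescaled integral is a centred
  Gaussian variable, so the joint characteristic function of linear functionals of \<open>(B1, B2)\<close> and the
  rescaled integral is the expectation of \<open>iexp U * exp (- Q / 2)\<close>, where the conditional variance \<open>Q\<close>
  is a quadratic functional of the increments of \<open>B1\<close>. By the Isserlis formula \<open>Q\<close> concentrates in
  \<open>L\<^sup>1\<close> around a constant: its fluctuation is controlled by the \<open>L\<^sup>1\<close> norm of the increment covariance,
  and its mean converges to the limiting variance after rescaling space by \<open>\<epsilon>\<close>. These estimates are
  made for Riemann sums and passed to the integral.

  Convergence of these characteristic functions says that \<open>iexp (c * Y)\<close> minus its limit becomes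
  orthogonal to every \<open>iexp\<close> of a linear functional of \<open>(B1, B2)\<close>. The continuity theorem of Levy,
  applied to one coordinate at a time, and a monotone class argument extend the orthogonality to all
  events generated by \<open>(B1, B2)\<close>; this is stable convergence, which gives joint convergence against
  continuous functionals of the paths.
\<close>

section \<open>Stable convergence from characteristic functions\<close>

text \<open>Three limits carry the analysis. Let r be the lag covariance of increments of length
  \<open>\<epsilon>\<close> and k the normalisation. (1) k^2 times the double integral of r^2 tends
  to the limiting variance. (2) k times the integral of |r| tends to 0: by Isserlis the variance of
  the quadratic form is twice a four-cycle sum of covariances, and row sums bound that sum. (3) A
  fixed functional of \<open>B2\<close> is almost uncorrelated with a short increment, so the cross
  term in Q vanishes. By self-similarity everything is read off from the unit lag covariance, which
  behaves like H(2H-1) x^(2H-2). Its square is integrable for H < 3/4. At H = 3/4 it decays like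
  (9/64)/x, so a logarithm appears, and the two signs of the lag give 9/32. Independence is stated
  for the product sigma-algebra on paths, whose measurable functions see countably many coordinates
  only. The time integral of an arbitrary path is not of that kind, hence decoupling is done on
  Riemann sums. The path component is the same for every \<open>\<epsilon>\<close>, so weak limits
  are only ever taken of a real variable.\<close>

lemma norm_integral_le_integral:
  fixes f :: "'a \<Rightarrow> 'b::{banach, second_countable_topology}"
  assumes g: "integrable M g" and fg: "\<And>x. x \<in> space M \<Longrightarrow> norm (f x) \<le> g x"
  shows "norm (\<integral>x. f x \<partial>M) \<le> (\<integral>x. g x \<partial>M)"
proof (cases "integrable M f")
  case True
  have "norm (\<integral>x. f x \<partial>M) \<le> (\<integral>x. norm (f x) \<partial>M)" by (rule integral_norm_bound)
  also have "\<dots> \<le> (\<integral>x. g x \<partial>M)" using True g fg by (intro integral_mono) auto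
  finally show ?thesis .
next
  case False
  have "0 \<le> (\<integral>x. g x \<partial>M)"
    using order_trans[OF norm_ge_zero fg] by (intro Bochner_Integration.integral_nonneg) auto
  then show ?thesis using False by (simp add: not_integrable_integral_eq)
qed

text \<open>Normalised, the weights \<open>w n\<close> become probability densities, and the
  hypothesis is convergence of the characteristic functions of \<open>Y n\<close> under these tilted
  measures. The weight may vary with n because the lemma serves twice: with a fixed weight, and with
  a varying weight and a fixed variable.\<close>

lemma (in prob_space) weighted_levy_continuity:
  fixes w Y :: "nat \<Rightarrow> 'a \<Rightarrow> real" and h :: "real \<Rightarrow> real"
  assumes w[measurable]: "\<And>n. w n \<in> borel_measurable M"
    and Y[measurable]: "\<And>n. Y n \<in> borel_measurable M"
    and w0: "\<And>n x. 0 \<le> w n x" and wK: "\<And>n x. w n x \<le> K"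
    and nu: "real_distribution \<nu>"
    and lim: "\<And>c. (\<lambda>n. \<integral>x. w n x *\<^sub>R iexp (c * Y n x) \<partial>M) \<longlonglongrightarrow> m *\<^sub>R char \<nu> c"
    and h: "\<And>x. isCont h x" and hB: "\<And>x. \<bar>h x\<bar> \<le> B"
  shows "(\<lambda>n. \<integral>x. w n x * h (Y n x) \<partial>M) \<longlonglongrightarrow> m * (\<integral>x. h x \<partial>\<nu>)"
proof -
  interpret nu: real_distribution \<nu> by fact
  have [measurable]: "h \<in> borel_measurable borel"
    using h by (intro borel_measurable_continuous_onI) (auto intro: continuous_at_imp_continuous_on)
  have iw: "integrable M (w n)" for n
    by (rule integrable_const_bound[where B=K]) (auto simp: w0 wK)
  define mn where "mn n = (\<integral>x. w n x \<partial>M)" for n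
  have mn: "mn \<longlonglongrightarrow> m"
  proof -
    \<comment> \<open>The frequency 0 shows that the total masses converge to
      \<open>m\<close>.\<close>
    have "(\<lambda>n. \<integral>x. w n x *\<^sub>R (1::complex) \<partial>M) \<longlonglongrightarrow> m *\<^sub>R 1"
      using lim[of 0] by (simp add: nu.char_zero)
    moreover have "(\<integral>x. w n x *\<^sub>R (1::complex) \<partial>M) = complex_of_real (mn n)" for n
      by (subst integral_scaleR_left) (auto simp: mn_def iw scaleR_conv_of_real)
    ultimately have "(\<lambda>n. complex_of_real (mn n)) \<longlonglongrightarrow> complex_of_real m"
      by (simp add: scaleR_conv_of_real)
    then show ?thesis by (simp add: tendsto_of_real_iff)
  qed
  have mn0: "mn n \<ge> 0" for n
    unfolding mn_def by (intro integral_nonneg_AE) (simp add: w0)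
  then have m0: "m \<ge> 0" using mn by (intro LIMSEQ_le_const) auto
  have B0: "B \<ge> 0" using hB[of 0] by linarith
  show ?thesis
  \<comment> \<open>Without limiting mass there is nothing to normalise by, but then the bound by
    \<open>B\<close> times the mass already gives limit 0.\<close>
  proof (cases "m = 0")
    case True
    have "norm (\<integral>x. w n x * h (Y n x) \<partial>M) \<le> B * mn n" for n
    proof -
      have "norm (\<integral>x. w n x * h (Y n x) \<partial>M) \<le> (\<integral>x. B * w n x \<partial>M)"
      proof (rule norm_integral_le_integral)
        show "norm (w n x * h (Y n x)) \<le> B * w n x" for x
          using mult_left_mono[OF hB[of "Y n x"] w0[of n x]] by (simp add: abs_mult w0 mult.commute)
      qed (simp add: iw)
      then show ?thesis by (simp add: mn_def)
    qed
    moreover have "(\<lambda>n. B * mn n) \<longlonglongrightarrow> 0" using tendsto_mult_right_zero[of mn sequentially B] mn True by simp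
    ultimately have "(\<lambda>n. \<integral>x. w n x * h (Y n x) \<partial>M) \<longlonglongrightarrow> 0"
      by (intro Lim_null_comparison[OF _ \<open>(\<lambda>n. B * mn n) \<longlonglongrightarrow> 0\<close>]) auto
    then show ?thesis using True by simp
  next
    case False
    then have mpos: "m > 0" using m0 by simp
    \<comment> \<open>The law \<open>\<nu>\<close> is only a filler for indices with zero mass, so
      that every \<open>\<mu> n\<close> is a distribution; since \<open>m > 0\<close> it occurs
      finitely often.\<close>
    define \<mu> where "\<mu> n = (if mn n > 0 then distr (density M (\<lambda>x. w n x / mn n)) borel (Y n) else \<nu>)" for n
    have rd: "real_distribution (\<mu> n)" for n
    proof (cases "mn n > 0")
      case True
      have "prob_space (density M (\<lambda>x. ennreal (w n x / mn n)))"
      proof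
        have "emeasure (density M (\<lambda>x. ennreal (w n x / mn n))) (space M) = (\<integral>\<^sup>+x. ennreal (w n x / mn n) \<partial>M)"
          by (subst emeasure_density) (auto intro!: nn_integral_cong)
        also have "\<dots> = ennreal (\<integral>x. w n x / mn n \<partial>M)"
          by (intro nn_integral_eq_integral) (use True in \<open>auto simp: iw w0\<close>)
        also have "(\<integral>x. w n x / mn n \<partial>M) = 1" using True by (simp add: mn_def)
        finally show "emeasure (density M (\<lambda>x. ennreal (w n x / mn n))) (space (density M (\<lambda>x. ennreal (w n x / mn n)))) = 1" by simp
      qed
      then show ?thesis using True
        by (auto simp: \<mu>_def real_distribution_def real_distribution_axioms_def intro!: prob_space.prob_space_distr)
    next
      case False then show ?thesis using nu by (simp add: \<mu>_def)
    qed
    have int: "(\<integral>y. g y \<partial>\<mu> n) = (1 / mn n) *\<^sub>R (\<integral>x. w n x *\<^sub>R g (Y n x) \<partial>M)"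
      if "mn n > 0" and [measurable]: "g \<in> borel_measurable borel" for n and g :: "real \<Rightarrow> 'b::{banach, second_countable_topology}"
    proof -
      have "(\<integral>y. g y \<partial>\<mu> n) = (\<integral>x. g (Y n x) \<partial>density M (\<lambda>x. w n x / mn n))"
        using that by (simp add: \<mu>_def integral_distr)
      also have "\<dots> = (\<integral>x. (w n x / mn n) *\<^sub>R g (Y n x) \<partial>M)"
        using that(1) by (intro integral_density) (auto simp: w0)
      also have "\<dots> = (\<integral>x. (1 / mn n) *\<^sub>R (w n x *\<^sub>R g (Y n x)) \<partial>M)" by simp
      finally show ?thesis by (simp only: integral_scaleR_right)
    qed
    have ev: "eventually (\<lambda>n. mn n > 0) sequentially"
      using order_tendstoD(1)[OF mn mpos] .
    have inv: "(\<lambda>n. 1 / mn n) \<longlonglongrightarrow> 1 / m" using mn mpos by (intro tendsto_intros) auto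
    have "(\<lambda>n. char (\<mu> n) c) \<longlonglongrightarrow> char \<nu> c" for c
    proof -
      have "(\<lambda>n. (1 / mn n) *\<^sub>R (\<integral>x. w n x *\<^sub>R iexp (c * Y n x) \<partial>M)) \<longlonglongrightarrow> (1/m) *\<^sub>R (m *\<^sub>R char \<nu> c)"
        by (intro tendsto_intros inv lim)
      moreover have "eventually (\<lambda>n. (1 / mn n) *\<^sub>R (\<integral>x. w n x *\<^sub>R iexp (c * Y n x) \<partial>M) = char (\<mu> n) c) sequentially"
        using ev by eventually_elim (simp add: char_def int)
      ultimately show ?thesis using mpos by (auto dest: Lim_transform_eventually)
    qed
    then have "weak_conv_m \<mu> \<nu>" by (intro levy_continuity rd nu)
    then have "(\<lambda>n. integral\<^sup>L (\<mu> n) h) \<longlonglongrightarrow> integral\<^sup>L \<nu> h"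
      by (rule weak_conv_imp_integral_bdd_continuous_conv[OF rd nu]) (use h hB in auto)
    with mn have "(\<lambda>n. mn n * integral\<^sup>L (\<mu> n) h) \<longlonglongrightarrow> m * integral\<^sup>L \<nu> h" by (rule tendsto_mult)
    moreover have "eventually (\<lambda>n. mn n * integral\<^sup>L (\<mu> n) h = (\<integral>x. w n x * h (Y n x) \<partial>M)) sequentially"
      using ev by eventually_elim (simp add: int)
    ultimately show ?thesis by (auto dest: Lim_transform_eventually)
  qed
qed

section \<open>Asymptotic orthogonality of a bounded sequence to a fixed variable, and its extension
  to a generated sigma-algebra\<close>

definition asymp_orth :: "'a measure \<Rightarrow> (nat \<Rightarrow> 'a \<Rightarrow> complex) \<Rightarrow> ('a \<Rightarrow> real) \<Rightarrow> bool" where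
  "asymp_orth M V Z \<longleftrightarrow> (\<lambda>n. \<integral>x. Z x *\<^sub>R V n x \<partial>M) \<longlonglongrightarrow> 0"

text \<open>Since the \<open>V n\<close> are uniformly bounded, the functionals \<open>Z\<close> to
  integral of \<open>Z\<close> times \<open>V n\<close> are equicontinuous in L1, so the orthogonal
  variables form an L1-closed set.\<close>

lemma (in prob_space) asymp_orth_approx:
  fixes V :: "nat \<Rightarrow> 'a \<Rightarrow> complex" and Z :: "'a \<Rightarrow> real"
  assumes [measurable]: "\<And>n. V n \<in> borel_measurable M" and VK: "\<And>n x. norm (V n x) \<le> K"
    and [measurable]: "Z \<in> borel_measurable M" and ZB: "\<And>x. \<bar>Z x\<bar> \<le> B"
    and approx: "\<And>e. e > 0 \<Longrightarrow> \<exists>Z' B'. Z' \<in> borel_measurable M \<and> (\<forall>x. \<bar>Z' x\<bar> \<le> B') \<and>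
      (\<integral>x. \<bar>Z x - Z' x\<bar> \<partial>M) < e \<and> asymp_orth M V Z'"
  shows "asymp_orth M V Z"
  unfolding asymp_orth_def
proof (rule LIMSEQ_I)
  fix r :: real assume r: "r > 0"
  have K0: "K \<ge> 0" using order_trans[OF norm_ge_zero VK[of 0 undefined]] .
  \<comment> \<open>The \<open>+ 1\<close> keeps the quotient meaningful when the bound
    \<open>K\<close> is 0.\<close>
  obtain Z' B' where [measurable]: "Z' \<in> borel_measurable M" and B': "\<And>x. \<bar>Z' x\<bar> \<le> B'"
    and d: "(\<integral>x. \<bar>Z x - Z' x\<bar> \<partial>M) < r / (2 * (K + 1))" and o: "asymp_orth M V Z'"
    using approx[of "r / (2 * (K+1))"] r K0 by auto
  from o obtain N where N: "\<And>n. n \<ge> N \<Longrightarrow> norm (\<integral>x. Z' x *\<^sub>R V n x \<partial>M) < r / 2"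
    unfolding asymp_orth_def using r LIMSEQ_D[of _ 0 "r/2"] by fastforce
  have iZ: "integrable M (\<lambda>x. Z x *\<^sub>R V n x)" for n
    by (rule integrable_const_bound[where B="B * K"]) (auto intro!: mult_mono VK ZB order_trans[OF abs_ge_zero ZB])
  have iZ': "integrable M (\<lambda>x. Z' x *\<^sub>R V n x)" for n
    by (rule integrable_const_bound[where B="B' * K"]) (auto intro!: mult_mono VK B' order_trans[OF abs_ge_zero B'])
  have iD: "integrable M (\<lambda>x. \<bar>Z x - Z' x\<bar>)"
    by (rule integrable_const_bound[where B="B + B'"]) (auto intro!: order_trans[OF abs_triangle_ineq4] add_mono ZB B')
  have "norm (\<integral>x. Z x *\<^sub>R V n x \<partial>M) < r" if "n \<ge> N" for n
  proof -
    have "(\<integral>x. Z x *\<^sub>R V n x \<partial>M) - (\<integral>x. Z' x *\<^sub>R V n x \<partial>M) = (\<integral>x. (Z x - Z' x) *\<^sub>R V n x \<partial>M)"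
      by (simp add: scaleR_diff_left iZ iZ')
    also have "norm \<dots> \<le> (\<integral>x. K * \<bar>Z x - Z' x\<bar> \<partial>M)"
    proof (rule norm_integral_le_integral)
      show "norm ((Z x - Z' x) *\<^sub>R V n x) \<le> K * \<bar>Z x - Z' x\<bar>" for x
        using mult_left_mono[OF VK[of n x], of "\<bar>Z x - Z' x\<bar>"] by (simp add: mult.commute)
    qed (use iD in auto)
    also have "\<dots> \<le> K * (r / (2 * (K + 1)))" unfolding integral_mult_right_zero
      using d K0 by (intro mult_left_mono) auto
    also have "\<dots> \<le> r / 2" using K0 r by (simp add: field_simps)
    finally have "norm ((\<integral>x. Z x *\<^sub>R V n x \<partial>M) - (\<integral>x. Z' x *\<^sub>R V n x \<partial>M)) \<le> r / 2" .
    with N[OF that] norm_triangle_sub[of "\<integral>x. Z x *\<^sub>R V n x \<partial>M" "\<integral>x. Z' x *\<^sub>R V n x \<partial>M"] show ?thesis by linarith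
  qed
  then show "\<exists>no. \<forall>n\<ge>no. norm ((\<integral>x. Z x *\<^sub>R V n x \<partial>M) - 0) < r" by auto
qed

text \<open>The weighted Levy theorem with roles exchanged: the sequence \<open>V n\<close> supplies
  the weights and \<open>U\<close> is the fixed variable. The limit law is that of \<open>U\<close>
  itself with mass \<open>K\<close>, the contribution of the added constant, which is subtracted
  again at the end.\<close>

lemma (in prob_space) asymp_orth_continuous:
  fixes V :: "nat \<Rightarrow> 'a \<Rightarrow> real" and h :: "real \<Rightarrow> real"
  assumes [measurable]: "\<And>n. V n \<in> borel_measurable M" and VK: "\<And>n x. \<bar>V n x\<bar> \<le> K"
    and U[measurable]: "U \<in> borel_measurable M"
    and lim: "\<And>c. (\<lambda>n. \<integral>x. V n x *\<^sub>R iexp (c * U x) \<partial>M) \<longlonglongrightarrow> 0"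
    and h: "\<And>x. isCont h x" and hB: "\<And>x. \<bar>h x\<bar> \<le> B"
  shows "(\<lambda>n. \<integral>x. V n x * h (U x) \<partial>M) \<longlonglongrightarrow> 0"
proof -
  have [measurable]: "h \<in> borel_measurable borel"
    using h by (intro borel_measurable_continuous_onI) (auto intro: continuous_at_imp_continuous_on)
  have K0: "K \<ge> 0" using VK[of 0 undefined] by linarith
  have iV: "integrable M (\<lambda>x. V n x *\<^sub>R iexp (c * U x))" for n c
    by (rule integrable_const_bound[where B=K]) (auto simp: VK)
  have iE: "integrable M (\<lambda>x. iexp (c * U x))" for c
    by (rule integrable_const_bound[where B=1]) auto
  have iVh: "integrable M (\<lambda>x. V n x * h (U x))" for n
    by (rule integrable_const_bound[where B="K * B"]) (auto simp: abs_mult intro!: mult_mono VK hB K0)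
  have ih: "integrable M (\<lambda>x. h (U x))"
    by (rule integrable_const_bound[where B=B]) (auto intro!: hB)
  have nu: "real_distribution (distr M borel U)" by simp
  have chr: "char (distr M borel U) c = (\<integral>x. iexp (c * U x) \<partial>M)" for c
    unfolding char_def by (subst integral_distr) auto
  \<comment> \<open>Adding \<open>K\<close> makes the weights nonnegative, so that the weighted Levy theorem applies.\<close>
  have "(\<lambda>n. \<integral>x. (K + V n x) * h (U x) \<partial>M) \<longlonglongrightarrow> K * (\<integral>x. h x \<partial>distr M borel U)"
  proof (rule weighted_levy_continuity[where K="2*K" and B=B])
    show "0 \<le> K + V n x" for n x using VK[of n x] by linarith
    show "K + V n x \<le> 2*K" for n x using VK[of n x] by linarith
    fix c
    have "(\<lambda>n. (\<integral>x. K *\<^sub>R iexp (c * U x) \<partial>M) + (\<integral>x. V n x *\<^sub>R iexp (c * U x) \<partial>M)) \<longlonglongrightarrow> K *\<^sub>R char (distr M borel U) c + 0"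
      by (intro tendsto_add lim) (simp add: chr)
    then show "(\<lambda>n. \<integral>x. (K + V n x) *\<^sub>R iexp (c * U x) \<partial>M) \<longlonglongrightarrow> K *\<^sub>R char (distr M borel U) c"
      by (simp only: scaleR_add_left Bochner_Integration.integral_add[OF integrable_scaleR_right[OF iE] iV] add_0_right)
  qed (use h hB nu in auto)
  then have "(\<lambda>n. (\<integral>x. (K + V n x) * h (U x) \<partial>M) - K * (\<integral>x. h (U x) \<partial>M)) \<longlonglongrightarrow> K * (\<integral>x. h (U x) \<partial>M) - K * (\<integral>x. h (U x) \<partial>M)"
    by (intro tendsto_diff tendsto_const) (simp add: integral_distr)
  then show ?thesis by (simp add: distrib_right ih iVh)
qed

lemma (in prob_space) asymp_orth_dominated:
  fixes V :: "nat \<Rightarrow> 'a \<Rightarrow> complex" and Z :: "'a \<Rightarrow> real"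
  assumes V: "\<And>n. V n \<in> borel_measurable M" and VK: "\<And>n x. norm (V n x) \<le> K"
    and Zm[measurable]: "\<And>m. Zm m \<in> borel_measurable M" and Z[measurable]: "Z \<in> borel_measurable M"
    and ZB: "\<And>m x. \<bar>Zm m x\<bar> \<le> B" and ZB': "\<And>x. \<bar>Z x\<bar> \<le> B"
    and lim: "\<And>x. x \<in> space M \<Longrightarrow> (\<lambda>m. Zm m x) \<longlonglongrightarrow> Z x" and o: "\<And>m. asymp_orth M V (Zm m)"
  shows "asymp_orth M V Z"
proof (rule asymp_orth_approx[OF V VK Z ZB'])
  fix e :: real assume e: "e > 0"
  have "(\<lambda>m. \<integral>x. \<bar>Z x - Zm m x\<bar> \<partial>M) \<longlonglongrightarrow> (\<integral>x. \<bar>Z x - Z x\<bar> \<partial>M)"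
  proof (rule integral_dominated_convergence[where w="\<lambda>_. 2 * B"])
    show "AE x in M. norm \<bar>Z x - Zm m x\<bar> \<le> 2 * B" for m
      using ZB ZB' by (intro AE_I2) (smt (verit) real_norm_def)
    show "AE x in M. (\<lambda>m. \<bar>Z x - Zm m x\<bar>) \<longlonglongrightarrow> \<bar>Z x - Z x\<bar>"
      using lim by (intro AE_I2 tendsto_intros) auto
  qed auto
  then have "eventually (\<lambda>m. (\<integral>x. \<bar>Z x - Zm m x\<bar> \<partial>M) < e) sequentially"
    using e by (intro order_tendstoD) auto
  then obtain m where "(\<integral>x. \<bar>Z x - Zm m x\<bar> \<partial>M) < e" by (auto simp: eventually_sequentially)
  then show "\<exists>Z' B'. Z' \<in> borel_measurable M \<and> (\<forall>x. \<bar>Z' x\<bar> \<le> B') \<and>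
      (\<integral>x. \<bar>Z x - Z' x\<bar> \<partial>M) < e \<and> asymp_orth M V Z'"
    using o Zm ZB by blast
qed

lemma (in prob_space) asymp_orth_sum:
  fixes V :: "nat \<Rightarrow> 'a \<Rightarrow> complex" and Z :: "'i \<Rightarrow> 'a \<Rightarrow> real"
  assumes [measurable]: "\<And>n. V n \<in> borel_measurable M" and VK: "\<And>n x. norm (V n x) \<le> K"
    and [measurable]: "\<And>i. i \<in> I \<Longrightarrow> Z i \<in> borel_measurable M" and ZB: "\<And>i x. i \<in> I \<Longrightarrow> \<bar>Z i x\<bar> \<le> B"
    and o: "\<And>i. i \<in> I \<Longrightarrow> asymp_orth M V (Z i)"
  shows "asymp_orth M V (\<lambda>x. \<Sum>i\<in>I. c i * Z i x)"
proof -
  have int: "integrable M (\<lambda>x. Z i x *\<^sub>R V n x)" if "i \<in> I" for n i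
    using that by (intro integrable_const_bound[where B="B * K"])
      (auto intro!: mult_mono VK ZB order_trans[OF abs_ge_zero ZB])
  have "(\<lambda>n. \<Sum>i\<in>I. c i *\<^sub>R (\<integral>x. Z i x *\<^sub>R V n x \<partial>M)) \<longlonglongrightarrow> (\<Sum>i\<in>I. c i *\<^sub>R 0)"
    using o unfolding asymp_orth_def by (intro tendsto_sum tendsto_scaleR tendsto_const)
  moreover have "(\<integral>x. (\<Sum>i\<in>I. c i * Z i x) *\<^sub>R V n x \<partial>M) = (\<Sum>i\<in>I. c i *\<^sub>R (\<integral>x. Z i x *\<^sub>R V n x \<partial>M))" for n
  proof -
    have "(\<integral>x. (\<Sum>i\<in>I. c i * Z i x) *\<^sub>R V n x \<partial>M) = (\<integral>x. (\<Sum>i\<in>I. c i *\<^sub>R (Z i x *\<^sub>R V n x)) \<partial>M)"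
      by (simp add: scaleR_sum_left)
    also have "\<dots> = (\<Sum>i\<in>I. c i *\<^sub>R (\<integral>x. Z i x *\<^sub>R V n x \<partial>M))"
      by (subst Bochner_Integration.integral_sum)
        (use int in \<open>auto intro!: integrable_scaleR_right simp del: scaleR_scaleR simp flip: integral_scaleR_right\<close>)
    finally show ?thesis .
  qed
  ultimately show ?thesis unfolding asymp_orth_def by simp
qed

text \<open>The continuous case handles real sequences only, so \<open>V n\<close> is split into
  real and imaginary part. Half-line indicators are then bounded pointwise limits of continuous
  functions of \<open>U\<close>.\<close>

lemma (in prob_space) asymp_orth_atMost:
  fixes V :: "nat \<Rightarrow> 'a \<Rightarrow> complex"
  assumes V[measurable]: "\<And>n. V n \<in> borel_measurable M" and VK: "\<And>n x. norm (V n x) \<le> K"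
    and U[measurable]: "U \<in> borel_measurable M"
    and lim: "\<And>c. (\<lambda>n. \<integral>x. iexp (c * U x) * V n x \<partial>M) \<longlonglongrightarrow> 0"
  shows "asymp_orth M V (\<lambda>x. indicator {..a} (U x))"
proof -
  have int: "integrable M (\<lambda>x. iexp (c * U x) * V n x)" for n c
    by (rule integrable_const_bound[where B=K]) (auto simp: norm_mult VK)
  have int': "integrable M (\<lambda>x. cnj (iexp (c * U x) * V n x))" for n c
    using int by (rule integrable_cnj)
  \<comment> \<open>Conjugating the hypothesis at frequency \<open>-c\<close> gives orthogonality of
    \<open>iexp (c * U x)\<close> to the conjugate of \<open>V n\<close>; together with the
    hypothesis at \<open>c\<close> this isolates real and imaginary parts.\<close>
  have limc: "(\<lambda>n. \<integral>x. cnj (iexp (- c * U x) * V n x) \<partial>M) \<longlonglongrightarrow> 0" for c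
    using tendsto_cnj[OF lim[of "-c"]] by (simp only: Bochner_Integration.integral_cnj complex_cnj_zero)
  have cnj_e: "cnj (iexp (- c * u)) = iexp (c * u)" for c u by (simp add: exp_cnj)
  have e: "Re z *\<^sub>R iexp (c * u) = (1/2) * (iexp (c * u) * z + cnj (iexp (- c * u) * z))"
    "Im z *\<^sub>R iexp (c * u) = (1/(2*\<i>)) * (iexp (c * u) * z - cnj (iexp (- c * u) * z))" for c u z
  proof -
    have z: "z + cnj z = 2 * complex_of_real (Re z)" "z - cnj z = 2 * \<i> * complex_of_real (Im z)"
      by (simp_all add: complex_eq_iff)
    show "Re z *\<^sub>R iexp (c * u) = (1/2) * (iexp (c * u) * z + cnj (iexp (- c * u) * z))"
      unfolding complex_cnj_mult cnj_e distrib_left[symmetric] z by (simp add: scaleR_conv_of_real)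
    show "Im z *\<^sub>R iexp (c * u) = (1/(2*\<i>)) * (iexp (c * u) * z - cnj (iexp (- c * u) * z))"
      unfolding complex_cnj_mult cnj_e right_diff_distrib[symmetric] z by (simp add: scaleR_conv_of_real mult.left_commute[of \<i>] mult.commute)
  qed
  have re: "(\<lambda>n. \<integral>x. Re (V n x) *\<^sub>R iexp (c * U x) \<partial>M) \<longlonglongrightarrow> 0" for c
    unfolding e integral_mult_right_zero Bochner_Integration.integral_add[OF int int']
    using tendsto_mult[OF tendsto_const tendsto_add[OF lim[of c] limc[of c]], of "1/2"] by simp
  have im: "(\<lambda>n. \<integral>x. Im (V n x) *\<^sub>R iexp (c * U x) \<partial>M) \<longlonglongrightarrow> 0" for c
    unfolding e integral_mult_right_zero Bochner_Integration.integral_diff[OF int int']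
    using tendsto_mult[OF tendsto_const tendsto_diff[OF lim[of c] limc[of c]], of "1/(2*\<i>)"] by simp
  \<comment> \<open>Equal to 1 up to \<open>a\<close>, then falling linearly to 0 at
    \<open>a + 1 / (m + 1)\<close>: the ramp lies to the right of \<open>a\<close>, so the limit
    includes the endpoint.\<close>
  define h where "h m = cts_step a (a + inverse (real (Suc m)))" for m
  have hB: "\<bar>h m x\<bar> \<le> 1" for m x
  proof -
    have "\<bar>(a + d - x) / d\<bar> \<le> 1" if "d > 0" "\<not> x \<le> a" "\<not> a + d \<le> x" for d
      using that by (simp add: abs_le_iff field_simps)
    then show ?thesis by (auto simp: h_def cts_step_def)
  qed
  have hc: "isCont (h m) x" for m x
  proof -
    have "uniformly_continuous_on UNIV (h m)" unfolding h_def by (rule cts_step_uniformly_continuous) simp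
    then have "continuous_on UNIV (h m)" by (rule uniformly_continuous_imp_continuous)
    then show ?thesis by (simp add: continuous_on_eq_continuous_at)
  qed
  have hm[measurable]: "h m \<in> borel_measurable borel" for m
    using hc by (intro borel_measurable_continuous_onI) (auto intro: continuous_at_imp_continuous_on)
  show ?thesis
  proof (rule asymp_orth_dominated[where Zm="\<lambda>m x. h m (U x)" and B=1, OF V VK])
    fix x
    have "eventually (\<lambda>m. h m (U x) = indicator {..a} (U x)) sequentially"
    proof (cases "U x \<le> a")
      case True then show ?thesis by (simp add: h_def cts_step_def)
    next
      case False
      then have "eventually (\<lambda>m. inverse (real (Suc m)) < U x - a) sequentially"
        by (intro order_tendstoD[OF LIMSEQ_inverse_real_of_nat]) simp
      then show ?thesis by eventually_elim (use False in \<open>auto simp: h_def cts_step_def\<close>)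
    qed
    then show "(\<lambda>m. h m (U x)) \<longlonglongrightarrow> indicator {..a} (U x)" by (rule tendsto_eventually)
  next
    fix m
    have VR: "\<bar>Re (V n x)\<bar> \<le> K" "\<bar>Im (V n x)\<bar> \<le> K" for n x
      using VK abs_Re_le_cmod abs_Im_le_cmod order_trans by metis+
    have i: "integrable M (\<lambda>x. h m (U x) *\<^sub>R V n x)" for n
      by (rule integrable_const_bound[where B="1 * K"])
        (simp only: norm_scaleR real_norm_def, intro AE_I2 mult_mono VK hB, auto)
    have "(\<lambda>n. Complex (\<integral>x. Re (V n x) * h m (U x) \<partial>M) (\<integral>x. Im (V n x) * h m (U x) \<partial>M)) \<longlonglongrightarrow> Complex 0 0"
      by (intro tendsto_Complex asymp_orth_continuous[where K=K and B=1]) (use VR re im hc hB in auto)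
    moreover have "Complex (\<integral>x. Re (V n x) * h m (U x) \<partial>M) (\<integral>x. Im (V n x) * h m (U x) \<partial>M) = (\<integral>x. h m (U x) *\<^sub>R V n x \<partial>M)" for n
      using integral_Re[OF i[of n]] integral_Im[OF i[of n]] by (simp add: complex_eq_iff mult.commute)
    ultimately show "asymp_orth M V (\<lambda>x. h m (U x))" unfolding asymp_orth_def by (simp add: zero_complex.code)
  qed (auto simp: hB split: split_indicator)
qed

text \<open>The sigma-algebra generated by the family \<open>L\<close>, built from half-line events
  because these are the events that characteristic functions reach first.\<close>

definition generated_algebra :: "'a measure \<Rightarrow> ('a \<Rightarrow> real) set \<Rightarrow> 'a measure" where
  "generated_algebra M L = sigma (space M) {{x \<in> space M. u x \<le> a} | u a. u \<in> L}"

lemma space_generated_algebra[simp]: "space (generated_algebra M L) = space M"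
  by (simp add: generated_algebra_def space_measure_of_conv)

lemma sets_generated_algebra:
  "sets (generated_algebra M L) = sigma_sets (space M) {{x \<in> space M. u x \<le> a} | u a. u \<in> L}"
  unfolding generated_algebra_def by (rule sets_measure_of) auto

lemma measurable_generated_algebra:
  assumes "u \<in> L"
  shows "u \<in> borel_measurable (generated_algebra M L)"
  unfolding borel_measurable_iff_le sets_generated_algebra
  using assms by (auto intro!: sigma_sets.Basic)

lemma sets_generated_algebra_subset:
  assumes "L \<subseteq> borel_measurable M"
  shows "sets (generated_algebra M L) \<subseteq> sets M"
  unfolding sets_generated_algebra
proof (rule sets.sigma_sets_subset)
  show "{{x \<in> space M. u x \<le> a} |u a. u \<in> L} \<subseteq> sets M"
    using assms by (auto intro!: borel_measurable_le)
qed

lemma borel_measurable_generated_algebra_subset: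
  assumes "L \<subseteq> borel_measurable M"
  shows "borel_measurable (generated_algebra M L) \<subseteq> borel_measurable M"
  by (rule measurable_mono) (use sets_generated_algebra_subset[OF assms] in auto)

text \<open>Finite intersections of half-line events form an intersection-stable generator. They are
  reached by adding one constraint at a time, and Dynkin's theorem does the rest.\<close>

lemma (in prob_space) asymp_orth_generated_set:
  fixes V :: "nat \<Rightarrow> 'a \<Rightarrow> complex"
  assumes V[measurable]: "\<And>n. V n \<in> borel_measurable M" and VK: "\<And>n x. norm (V n x) \<le> K"
    and L: "L \<subseteq> borel_measurable M" and L0: "(\<lambda>_. 0) \<in> L"
    and Ladd: "\<And>l u c. l \<in> L \<Longrightarrow> u \<in> L \<Longrightarrow> (\<lambda>x. l x + c * u x) \<in> L"
    and lim: "\<And>l. l \<in> L \<Longrightarrow> (\<lambda>n. \<integral>x. iexp (l x) * V n x \<partial>M) \<longlonglongrightarrow> 0"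
    and A: "A \<in> sets (generated_algebra M L)"
  shows "asymp_orth M V (indicator A)"
proof -
  have Lm[measurable]: "u \<in> borel_measurable M" if "u \<in> L" for u using L that by auto
  have iexp_norm: "norm (iexp r) = 1" for r by simp
  \<comment> \<open>The factor \<open>iexp (l x)\<close> is kept for arbitrary \<open>l\<close> in
    \<open>L\<close>: the next constraint on \<open>j\<close> introduces
    \<open>iexp (c * j x)\<close>, which closure of \<open>L\<close> under linear combinations
    absorbs into \<open>l\<close>.\<close>
  have rect: "(\<lambda>n. \<integral>x. iexp (l x) * (indicator {x \<in> space M. \<forall>u\<in>J. u x \<le> b u} x *\<^sub>R V n x) \<partial>M) \<longlonglongrightarrow> 0"
    if "finite J" "J \<subseteq> L" "l \<in> L" for J l b
    using that
  proof (induction J arbitrary: l rule: finite_induct)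
    case empty
    have "(\<integral>x. iexp (l x) * (indicator {x \<in> space M. \<forall>u\<in>{}. u x \<le> b u} x *\<^sub>R V n x) \<partial>M) = (\<integral>x. iexp (l x) * V n x \<partial>M)" for n
      by (rule Bochner_Integration.integral_cong) auto
    then show ?case using lim[OF empty(2)] by simp
  next
    case (insert j J)
    define W where "W n x = iexp (l x) * (indicator {x \<in> space M. \<forall>u\<in>J. u x \<le> b u} x *\<^sub>R V n x)" for n x
    have j: "j \<in> L" and Jfin: "finite J" and JL: "J \<subseteq> L" and l: "l \<in> L" using insert by auto
    have jm[measurable]: "j \<in> borel_measurable M" and lm[measurable]: "l \<in> borel_measurable M" using j l by auto
    have [measurable]: "{x \<in> space M. \<forall>u\<in>J. u x \<le> b u} \<in> sets M"
      using Jfin JL by (intro sets.sets_Collect_finite_All borel_measurable_le) auto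
    have Wm: "W n \<in> borel_measurable M" for n unfolding W_def by measurable
    have WK: "norm (W n x) \<le> K" for n x
      using VK[of n x] order_trans[OF norm_ge_zero VK] by (simp add: W_def norm_mult indicator_def)
    \<comment> \<open>The constraints already treated and the factor \<open>iexp (l x)\<close> are
      moved into the sequence, so only the single variable \<open>j\<close> is left to
      handle.\<close>
    have "asymp_orth M W (\<lambda>x. indicator {..b j} (j x))"
    proof (rule asymp_orth_atMost[OF Wm WK])
      fix c
      have "(\<lambda>n. \<integral>x. iexp (l x + c * j x) * (indicator {x \<in> space M. \<forall>u\<in>J. u x \<le> b u} x *\<^sub>R V n x) \<partial>M) \<longlonglongrightarrow> 0"
        by (rule insert.IH) (use insert.prems Ladd in auto)
      moreover have "iexp (l x + c * j x) * z = iexp (c * j x) * (iexp (l x) * z)" for x z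
        by (simp add: ring_distribs exp_add mult_ac)
      ultimately show "(\<lambda>n. \<integral>x. iexp (c * j x) * W n x \<partial>M) \<longlonglongrightarrow> 0"
        unfolding W_def by (simp only:)
    qed measurable
    moreover have "(\<integral>x. indicator {..b j} (j x) *\<^sub>R W n x \<partial>M) =
      (\<integral>x. iexp (l x) * (indicator {x \<in> space M. \<forall>u\<in>insert j J. u x \<le> b u} x *\<^sub>R V n x) \<partial>M)" for n
      by (rule Bochner_Integration.integral_cong) (auto simp: W_def indicator_def)
    ultimately show ?case unfolding asymp_orth_def by simp
  qed
  let ?G = "{{x \<in> space M. \<forall>u\<in>J. u x \<le> b u} | J b. finite J \<and> J \<subseteq> L}"
  have stable: "Int_stable ?G"
  proof (rule Int_stableI)
    fix A B assume "A \<in> ?G" "B \<in> ?G"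
    then obtain J b J' b' where A: "A = {x \<in> space M. \<forall>u\<in>J. u x \<le> b u}" "finite J" "J \<subseteq> L"
      and B: "B = {x \<in> space M. \<forall>u\<in>J'. u x \<le> b' u}" "finite J'" "J' \<subseteq> L" by auto
    \<comment> \<open>A variable constrained in both sets gets the smaller threshold.\<close>
    define c where "c u = (if u \<in> J then if u \<in> J' then min (b u) (b' u) else b u else b' u)" for u
    have "A \<inter> B = {x \<in> space M. \<forall>u\<in>J \<union> J'. u x \<le> c u}"
      unfolding A(1) B(1) c_def by (auto split: if_splits)
    then show "A \<inter> B \<in> ?G" using A B by blast
  qed
  have "{{x \<in> space M. u x \<le> a} | u a. u \<in> L} \<subseteq> ?G"
  proof safe
    fix u a assume "u \<in> L"
    then show "\<exists>J b. {x \<in> space M. u x \<le> a} = {x \<in> space M. \<forall>u\<in>J. u x \<le> b u} \<and> finite J \<and> J \<subseteq> L"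
      by (intro exI[of _ "{u}"] exI[of _ "\<lambda>_. a"]) auto
  qed
  then have A': "A \<in> sigma_sets (space M) ?G"
    using A sigma_sets_mono' unfolding sets_generated_algebra by blast
  have GM: "sigma_sets (space M) ?G \<subseteq> sets M"
    by (rule sets.sigma_sets_subset) (use L in \<open>auto intro!: sets.sets_Collect_finite_All borel_measurable_le\<close>)
  have intV: "integrable M (V n)" for n
    by (rule integrable_const_bound[where B=K]) (auto simp: VK)
  have ind1: "\<bar>indicator S x :: real\<bar> \<le> 1" for S and x :: 'a by (simp add: indicator_def)
  have "?G \<subseteq> Pow (space M)" by auto
  from stable this A' show ?thesis
  proof (induction A rule: sigma_sets_induct_disjoint)
    case (basic A)
    then obtain J b where A: "A = {x \<in> space M. \<forall>u\<in>J. u x \<le> b u}" "finite J" "J \<subseteq> L" by auto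
    show ?case using rect[OF A(2,3) L0, of b] unfolding asymp_orth_def A(1) by simp
  next
    case (compl A)
    have [measurable]: "A \<in> sets M" using compl GM by blast
    have "(\<lambda>n. (\<integral>x. V n x \<partial>M) - (\<integral>x. indicator A x *\<^sub>R V n x \<partial>M)) \<longlonglongrightarrow> 0 - 0"
      using lim[OF L0] compl(2) unfolding asymp_orth_def by (intro tendsto_diff) auto
    moreover have "(\<integral>x. V n x \<partial>M) - (\<integral>x. indicator A x *\<^sub>R V n x \<partial>M) = (\<integral>x. indicator (space M - A) x *\<^sub>R V n x \<partial>M)" for n
    proof -
      have "(\<integral>x. V n x \<partial>M) - (\<integral>x. indicator A x *\<^sub>R V n x \<partial>M) = (\<integral>x. V n x - indicator A x *\<^sub>R V n x \<partial>M)"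
        by (rule Bochner_Integration.integral_diff[symmetric]) (auto intro: intV integrable_mult_indicator)
      also have "\<dots> = (\<integral>x. indicator (space M - A) x *\<^sub>R V n x \<partial>M)"
        by (rule Bochner_Integration.integral_cong) (auto simp: indicator_def)
      finally show ?thesis .
    qed
    ultimately show ?case unfolding asymp_orth_def by simp
  next
    case (union A)
    have Am[measurable]: "A i \<in> sets M" for i using union GM by blast
    show ?case
    proof (rule asymp_orth_dominated[where Zm="\<lambda>m x. \<Sum>i<m. 1 * indicator (A i) x" and B=1, OF V VK])
      \<comment> \<open>By disjointness the partial sums are indicators of partial unions, hence
        bounded by 1. The coefficient \<open>1 *\<close> keeps the shape required by
        \<open>asymp_orth_sum\<close>.\<close>
      have e: "(\<Sum>i<m. 1 * indicator (A i) x) = (indicator (\<Union>i<m. A i) x :: real)" for m x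
        using union(1) by (subst indicator_UN_disjoint) (auto intro: disjoint_family_on_mono)
      show "\<bar>\<Sum>i<m. 1 * indicator (A i) x\<bar> \<le> (1::real)" for m x unfolding e by (rule ind1)
      show "asymp_orth M V (\<lambda>x. \<Sum>i<m. 1 * indicator (A i) x)" for m
        by (rule asymp_orth_sum[OF V VK _ ind1]) (use union in auto)
      show "(\<lambda>m. \<Sum>i<m. 1 * indicator (A i) x) \<longlonglongrightarrow> (indicator (\<Union>i. A i) x :: real)" for x
        unfolding e by (rule LIMSEQ_indicator_UN)
    qed (auto simp: ind1)
  qed (auto simp: asymp_orth_def)
qed

lemma floor_quotient_approx:
  fixes y :: real
  shows "\<bar>of_int \<lfloor>real (Suc j) * y\<rfloor> / real (Suc j) - y\<bar> \<le> inverse (real (Suc j))"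
proof -
  have "\<bar>of_int \<lfloor>real (Suc j) * y\<rfloor> - real (Suc j) * y\<bar> \<le> 1" by linarith
  then have "\<bar>of_int \<lfloor>real (Suc j) * y\<rfloor> - real (Suc j) * y\<bar> / real (Suc j) \<le> 1 / real (Suc j)"
    by (rule divide_right_mono) simp
  moreover have "\<bar>of_int \<lfloor>real (Suc j) * y\<rfloor> - real (Suc j) * y\<bar> / real (Suc j) =
      \<bar>of_int \<lfloor>real (Suc j) * y\<rfloor> / real (Suc j) - y\<bar>"
    by (subst abs_div_pos) (simp_all add: diff_divide_distrib del: of_nat_Suc)
  ultimately show ?thesis by (simp add: inverse_eq_divide)
qed

text \<open>Rounding \<open>Z\<close> down to multiples of \<open>1 / (m + 1)\<close> gives
  uniformly close simple functions whose level sets lie in the generated sigma-algebra; boundedness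
  of \<open>Z\<close> leaves finitely many levels.\<close>

lemma (in prob_space) asymp_orth_generated:
  fixes V :: "nat \<Rightarrow> 'a \<Rightarrow> complex"
  assumes V[measurable]: "\<And>n. V n \<in> borel_measurable M" and VK: "\<And>n x. norm (V n x) \<le> K"
    and L: "L \<subseteq> borel_measurable M" and L0: "(\<lambda>_. 0) \<in> L"
    and Ladd: "\<And>l u c. l \<in> L \<Longrightarrow> u \<in> L \<Longrightarrow> (\<lambda>x. l x + c * u x) \<in> L"
    and lim: "\<And>l. l \<in> L \<Longrightarrow> (\<lambda>n. \<integral>x. iexp (l x) * V n x \<partial>M) \<longlonglongrightarrow> 0"
    and Z: "Z \<in> borel_measurable (generated_algebra M L)" and ZB: "\<And>x. \<bar>Z x\<bar> \<le> B"
  shows "asymp_orth M V Z"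
proof -
  have Zm[measurable]: "Z \<in> borel_measurable M"
    using Z borel_measurable_generated_algebra_subset[OF L] by auto
  define k where "k m x = \<lfloor>real (Suc m) * Z x\<rfloor>" for m x
  \<comment> \<open>Chosen so that every value of \<open>k m\<close> lies between
    \<open>- N m\<close> and \<open>N m\<close>, which makes the sum over levels finite and
    exact.\<close>
  define N where "N m = \<lceil>real (Suc m) * B\<rceil> + 1" for m :: nat
  define Zm where "Zm m x = (\<Sum>i\<in>{-N m..N m}. (of_int i / real (Suc m)) * indicator {x \<in> space M. k m x = i} x)" for m x
  have ind1: "\<bar>indicator S x :: real\<bar> \<le> 1" for S and x :: 'a by (simp add: indicator_def)
  have km: "k m x \<in> {-N m..N m}" for m x
  proof -
    have "\<bar>real (Suc m) * Z x\<bar> \<le> real (Suc m) * B" using ZB[of x] by (simp add: abs_mult mult_left_mono del: of_nat_Suc)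
    then show ?thesis unfolding k_def N_def by simp linarith
  qed
  have Zmv: "Zm m x = (if x \<in> space M then of_int (k m x) / real (Suc m) else 0)" for m x
  proof (cases "x \<in> space M")
    case True
    have "Zm m x = (\<Sum>i\<in>{-N m..N m}. if k m x = i then of_int i / real (Suc m) else 0)"
      unfolding Zm_def by (rule sum.cong) (use True in auto)
    also have "\<dots> = of_int (k m x) / real (Suc m)" using km[of m x] by (simp add: sum.delta)
    finally show ?thesis using True by simp
  qed (simp add: Zm_def)
  have close: "\<bar>Zm m x - Z x\<bar> \<le> inverse (real (Suc m))" if "x \<in> space M" for m x
    using floor_quotient_approx[of m "Z x"] that by (simp add: Zmv k_def del: of_nat_Suc)
  have B0: "0 \<le> B" using order_trans[OF abs_ge_zero ZB] .
  show ?thesis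
  proof (rule asymp_orth_dominated[where Zm=Zm and B="B + 1", OF V VK])
    have ks: "{x \<in> space M. k m x = i} \<in> sets (generated_algebra M L)" for m i
    proof -
      have "{x \<in> space (generated_algebra M L). k m x = i} \<in> sets (generated_algebra M L)"
        unfolding k_def using Z by measurable
      then show ?thesis by simp
    qed
    then have ksM[measurable]: "{x \<in> space M. k m x = i} \<in> sets M" for m i
      using sets_generated_algebra_subset[OF L] by blast
    show "Zm m \<in> borel_measurable M" for m unfolding Zm_def by measurable
    show "\<bar>Zm m x\<bar> \<le> B + 1" for m x
    proof (cases "x \<in> space M")
      case True
      have "inverse (real (Suc m)) \<le> 1" by (simp add: inverse_le_1_iff)
      with close[OF True, of m] ZB[of x] show ?thesis by linarith
    qed (use B0 in \<open>simp add: Zmv\<close>)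
    show "\<bar>Z x\<bar> \<le> B + 1" for x using ZB[of x] by simp
    have ko: "asymp_orth M V (indicator {x \<in> space M. k m x = i})" for m i
      by (rule asymp_orth_generated_set[OF V VK L L0 Ladd lim ks])
    show "asymp_orth M V (Zm m)" for m unfolding Zm_def
      by (rule asymp_orth_sum[OF V VK _ ind1 ko]) measurable
    show "(\<lambda>m. Zm m x) \<longlonglongrightarrow> Z x" if "x \<in> space M" for x
    proof (rule Lim_transform[OF tendsto_const])
      show "(\<lambda>m. Zm m x - Z x) \<longlonglongrightarrow> 0"
        by (rule Lim_null_comparison[OF _ LIMSEQ_inverse_real_of_nat])
          (use close[OF that] in \<open>simp del: of_nat_Suc\<close>)
    qed
  qed measurable
qed

section \<open>Stable convergence for random test functions that are continuous in the real
  variable\<close>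

lemma borel_measurable_Caratheodory:
  fixes F :: "'a \<Rightarrow> real \<Rightarrow> real"
  assumes F: "\<And>y. (\<lambda>x. F x y) \<in> borel_measurable N" and Y[measurable]: "Y \<in> borel_measurable N"
    and cont: "\<And>x y. x \<in> space N \<Longrightarrow> isCont (F x) y"
  shows "(\<lambda>x. F x (Y x)) \<in> borel_measurable N"
proof (rule borel_measurable_LIMSEQ_real)
  \<comment> \<open>Rounding \<open>Y\<close> leaves countably many sections of \<open>F\<close>,
    each measurable by hypothesis; continuity in the second argument recovers
    \<open>F x (Y x)\<close>.\<close>
  define q where "q j x = \<lfloor>real (Suc j) * Y x\<rfloor>" for j x
  show "(\<lambda>x. F x (of_int (q j x) / real (Suc j))) \<in> borel_measurable N" for j
  proof (rule measurable_compose_countable[where f="\<lambda>i x. F x (of_int i / real (Suc j))"])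
    show "q j \<in> measurable N (count_space UNIV)" unfolding q_def by measurable
  qed (rule F)
  fix x assume x: "x \<in> space N"
  have "\<bar>of_int (q j x) / real (Suc j) - Y x\<bar> \<le> inverse (real (Suc j))" for j
    unfolding q_def by (rule floor_quotient_approx)
  then have "(\<lambda>j. of_int (q j x) / real (Suc j) - Y x) \<longlonglongrightarrow> 0"
    by (intro Lim_null_comparison[OF _ LIMSEQ_inverse_real_of_nat]) auto
  then have "(\<lambda>j. of_int (q j x) / real (Suc j)) \<longlonglongrightarrow> Y x" by (simp add: LIM_zero_iff)
  then show "(\<lambda>j. F x (of_int (q j x) / real (Suc j))) \<longlonglongrightarrow> F x (Y x)"
    by (rule isCont_tendsto_compose[OF cont[OF x]])
qed

text \<open>A continuous majorant of the indicator of \<open>R \<le> \<bar>y\<bar>\<close>,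
  vanishing for \<open>\<bar>y\<bar> \<le> R - 1\<close>. Continuity lets tail masses of
  \<open>Y n\<close> be compared with those of the limit law.\<close>

definition tail_fun :: "real \<Rightarrow> real \<Rightarrow> real" where
  "tail_fun R y = max 0 (min 1 (\<bar>y\<bar> - R + 1))"

lemma tail_fun_bounds: "0 \<le> tail_fun R y" "tail_fun R y \<le> 1" "\<bar>tail_fun R y\<bar> \<le> 1"
  by (auto simp: tail_fun_def)

lemma tail_fun_eq_1: "R \<le> \<bar>y\<bar> \<Longrightarrow> tail_fun R y = 1"
  by (auto simp: tail_fun_def)

lemma isCont_tail_fun: "isCont (tail_fun R) y"
  unfolding tail_fun_def by (intro continuous_intros)

lemma borel_measurable_isCont:
  fixes f :: "real \<Rightarrow> real"
  assumes "\<And>x. isCont f x"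
  shows "f \<in> borel_measurable borel"
  using assms by (intro borel_measurable_continuous_onI) (auto intro: continuous_at_imp_continuous_on)

lemma isCont_Bernstein: "isCont (Bernstein n k) x"
  unfolding Bernstein_def by (intro continuous_intros)

lemma (in real_distribution) tail_fun_integral_small:
  assumes "d > 0"
  obtains R where "R > 0" "(\<integral>y. tail_fun R y \<partial>M) < d"
proof -
  have [measurable]: "tail_fun R \<in> borel_measurable borel" for R
    by (rule borel_measurable_isCont[OF isCont_tail_fun])
  have "(\<lambda>n. \<integral>y. tail_fun (real (Suc n)) y \<partial>M) \<longlonglongrightarrow> (\<integral>y. 0 \<partial>M)"
  proof (rule integral_dominated_convergence[where w="\<lambda>_. 1"])
    show "AE y in M. (\<lambda>n. tail_fun (real (Suc n)) y) \<longlonglongrightarrow> 0"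
    proof (rule AE_I2)
      fix y
      have "eventually (\<lambda>n. tail_fun (real (Suc n)) y = 0) sequentially"
        using eventually_ge_at_top[of "nat \<lceil>\<bar>y\<bar>\<rceil>"]
      proof eventually_elim
        case (elim n)
        then have "\<bar>y\<bar> \<le> real n" by linarith
        then show ?case by (simp add: tail_fun_def)
      qed
      then show "(\<lambda>n. tail_fun (real (Suc n)) y) \<longlonglongrightarrow> 0" by (rule tendsto_eventually)
    qed
  qed (auto simp: tail_fun_bounds simp del: of_nat_Suc)
  then have "eventually (\<lambda>n. (\<integral>y. tail_fun (real (Suc n)) y \<partial>M) < d) sequentially"
    using assms by (intro order_tendstoD) auto
  then obtain n where "(\<integral>y. tail_fun (real (Suc n)) y \<partial>M) < d" by (auto simp: eventually_sequentially)
  then show thesis by (intro that[of "real (Suc n)"]) auto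
qed

text \<open>Orthogonality of \<open>iexp (c * Y n x) - char \<nu> c\<close> to \<open>g\<close> is
  exactly the hypothesis of the weighted Levy theorem with constant weight \<open>g\<close>.\<close>

lemma (in prob_space) stable_convergence_product:
  fixes Y :: "nat \<Rightarrow> 'a \<Rightarrow> real" and g :: "'a \<Rightarrow> real" and h :: "real \<Rightarrow> real" and K B :: real
  assumes Y[measurable]: "\<And>n. Y n \<in> borel_measurable M" and nu: "real_distribution \<nu>"
    and L: "L \<subseteq> borel_measurable M" and L0: "(\<lambda>_. 0) \<in> L"
    and Ladd: "\<And>l u c. l \<in> L \<Longrightarrow> u \<in> L \<Longrightarrow> (\<lambda>x. l x + c * u x) \<in> L"
    and lim: "\<And>l c. l \<in> L \<Longrightarrow> (\<lambda>n. \<integral>x. iexp (l x) * (iexp (c * Y n x) - char \<nu> c) \<partial>M) \<longlonglongrightarrow> 0"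
    and g: "g \<in> borel_measurable (generated_algebra M L)" and g0: "\<And>x. 0 \<le> g x" and gK: "\<And>x. g x \<le> K"
    and h: "\<And>x. isCont h x" and hB: "\<And>x. \<bar>h x\<bar> \<le> B"
  shows "(\<lambda>n. \<integral>x. g x * h (Y n x) \<partial>M) \<longlonglongrightarrow> (\<integral>x. g x \<partial>M) * (\<integral>x. h x \<partial>\<nu>)"
proof -
  interpret nu: real_distribution \<nu> by fact
  have gm[measurable]: "g \<in> borel_measurable M"
    using g borel_measurable_generated_algebra_subset[OF L] by auto
  have gK': "\<bar>g x\<bar> \<le> K" for x using g0 gK by simp
  show ?thesis
  proof (rule weighted_levy_continuity[where K=K and B=B and \<nu>=\<nu>])
    fix c
    define V where "V n x = iexp (c * Y n x) - char \<nu> c" for n x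
    have VK: "norm (V n x) \<le> 2" for n x
      using norm_triangle_ineq4[of "iexp (c * Y n x)" "char \<nu> c"] nu.cmod_char_le_1[of c] by (simp add: V_def)
    have "asymp_orth M V g"
      by (rule asymp_orth_generated[OF _ VK L L0 Ladd _ g gK']) (use lim in \<open>auto simp: V_def\<close>)
    then have "(\<lambda>n. (\<integral>x. g x *\<^sub>R V n x \<partial>M) + (\<integral>x. g x \<partial>M) *\<^sub>R char \<nu> c) \<longlonglongrightarrow> 0 + (\<integral>x. g x \<partial>M) *\<^sub>R char \<nu> c"
      unfolding asymp_orth_def by (intro tendsto_add tendsto_const)
    moreover have "(\<integral>x. g x *\<^sub>R V n x \<partial>M) + (\<integral>x. g x \<partial>M) *\<^sub>R char \<nu> c = (\<integral>x. g x *\<^sub>R iexp (c * Y n x) \<partial>M)" for n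
    proof -
      have i1: "integrable M (\<lambda>x. g x *\<^sub>R iexp (c * Y n x))"
        by (rule integrable_const_bound[where B=K]) (auto simp: gK')
      have i2: "integrable M g" by (rule integrable_const_bound[where B=K]) (auto simp: gK')
      show ?thesis unfolding V_def scaleR_diff_right
        using i1 integrable_scaleR_left[OF i2, of "char \<nu> c"] i2 by (subst Bochner_Integration.integral_diff) auto
    qed
    ultimately show "(\<lambda>n. \<integral>x. g x *\<^sub>R iexp (c * Y n x) \<partial>M) \<longlonglongrightarrow> (\<integral>x. g x \<partial>M) *\<^sub>R char \<nu> c" by simp
  qed (use g0 gK nu h hB in auto)
qed

text \<open>For fixed \<open>x\<close> the function \<open>F x\<close> is replaced on a large
  interval by its Bernstein polynomial, which turns the test function into a finite sum of products.
  The degree that suffices depends on \<open>x\<close>; the uniform error is therefore controlled in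
  the mean by dominated convergence, and the outside of the interval by tightness.\<close>

lemma (in prob_space) stable_convergence_Caratheodory_nonneg:
  fixes Y :: "nat \<Rightarrow> 'a \<Rightarrow> real" and F :: "'a \<Rightarrow> real \<Rightarrow> real" and K :: real
  assumes Y[measurable]: "\<And>n. Y n \<in> borel_measurable M" and nu: "real_distribution \<nu>"
    and L: "L \<subseteq> borel_measurable M" and L0: "(\<lambda>_. 0) \<in> L"
    and Ladd: "\<And>l u c. l \<in> L \<Longrightarrow> u \<in> L \<Longrightarrow> (\<lambda>x. l x + c * u x) \<in> L"
    and lim: "\<And>l c. l \<in> L \<Longrightarrow> (\<lambda>n. \<integral>x. iexp (l x) * (iexp (c * Y n x) - char \<nu> c) \<partial>M) \<longlonglongrightarrow> 0"
    and F: "\<And>y. (\<lambda>x. F x y) \<in> borel_measurable (generated_algebra M L)"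
    and F0: "\<And>x y. 0 \<le> F x y" and FK: "\<And>x y. F x y \<le> K"
    and cont: "\<And>x y. x \<in> space M \<Longrightarrow> isCont (F x) y"
  shows "(\<lambda>n. \<integral>x. F x (Y n x) \<partial>M) \<longlonglongrightarrow> (\<integral>x. (\<integral>y. F x y \<partial>\<nu>) \<partial>M)"
proof (rule LIMSEQ_I)
  fix r :: real assume r: "r > 0"
  interpret nu: real_distribution \<nu> by fact
  have nuU: "measure \<nu> UNIV = 1" using nu.prob_space by simp
  have K0: "K \<ge> 0" using order_trans[OF F0 FK] .
  have Fm[measurable]: "(\<lambda>x. F x y) \<in> borel_measurable M" for y
    using F borel_measurable_generated_algebra_subset[OF L] by auto
  have FYm[measurable]: "(\<lambda>x. F x (Y n x)) \<in> borel_measurable M" for n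
    by (rule borel_measurable_Caratheodory) (use cont in auto)
  have Fjoint: "(\<lambda>(x, y). F x y) \<in> borel_measurable (M \<Otimes>\<^sub>M \<nu>)"
  proof -
    have "(\<lambda>z. F (fst z) (snd z)) \<in> borel_measurable (M \<Otimes>\<^sub>M \<nu>)"
      by (rule borel_measurable_Caratheodory) (use cont in \<open>auto simp: space_pair_measure\<close>)
    then show ?thesis by (simp add: case_prod_beta')
  qed
  have Fnu[measurable]: "(\<lambda>x. \<integral>y. F x y \<partial>\<nu>) \<in> borel_measurable M"
    using Fjoint by (rule nu.borel_measurable_lebesgue_integral)
  \<comment> \<open>The error budget: replacing \<open>F\<close> by its approximant costs
    \<open>d + K * d\<close> once under \<open>Y n\<close> and once under \<open>\<nu>\<close>, and
    the limit for the approximant costs another \<open>d\<close>.\<close>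
  define d where "d = r / (5 + 5 * K)"
  have d: "d > 0" and dr: "2 * d + 2 * K * d + d < r"
    using r K0 by (auto simp: d_def field_simps add_pos_nonneg)
  obtain R where R: "R > 0" and Rd: "(\<integral>y. tail_fun R y \<partial>\<nu>) < d"
    using nu.tail_fun_integral_small[OF d] by auto
  \<comment> \<open>Transports the interval from \<open>- R\<close> to \<open>R\<close> to the unit
    interval, where Bernstein polynomials live.\<close>
  define \<phi> where "\<phi> x q = F x (2 * R * q - R)" for x q
  define S where "S = {0..1::real} \<inter> \<rat>"
  have Sc: "countable S" unfolding S_def using countable_rat by blast
  have S0: "0 \<in> S" by (auto simp: S_def)
  define err where "err m x q = \<bar>\<phi> x q - (\<Sum>k\<le>m. \<phi> x (real k / real m) * Bernstein m k q)\<bar>" for m x q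
  \<comment> \<open>The supremum runs over rationals to keep the uniform error measurable in \<open>x\<close>.\<close>
  define e where "e m x = (SUP q\<in>S. err m x q)" for m x
  have Bsum: "0 \<le> (\<Sum>k\<le>m. \<phi> x (real k / real m) * Bernstein m k q)"
    "(\<Sum>k\<le>m. \<phi> x (real k / real m) * Bernstein m k q) \<le> K" if "q \<in> {0..1}" for m x q
  proof -
    show "0 \<le> (\<Sum>k\<le>m. \<phi> x (real k / real m) * Bernstein m k q)"
      using that by (intro sum_nonneg mult_nonneg_nonneg) (auto simp: \<phi>_def F0 Bernstein_nonneg)
    have "(\<Sum>k\<le>m. \<phi> x (real k / real m) * Bernstein m k q) \<le> (\<Sum>k\<le>m. K * Bernstein m k q)"
      using that by (intro sum_mono mult_right_mono) (auto simp: \<phi>_def FK Bernstein_nonneg)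
    also have "\<dots> = K" by (simp add: sum_distrib_left[symmetric])
    finally show "(\<Sum>k\<le>m. \<phi> x (real k / real m) * Bernstein m k q) \<le> K" .
  qed
  have errK: "err m x q \<le> K" if "q \<in> {0..1}" for m x q
    using Bsum[OF that, of x m] F0[of x "2*R*q-R"] FK[of x "2*R*q-R"] unfolding err_def \<phi>_def[of x q] by linarith
  have SI: "S \<subseteq> {0..1}" by (auto simp: S_def)
  have bdd: "bdd_above ((\<lambda>q. err m x q) ` S)" for m x
    by (rule bdd_aboveI[of _ K]) (use errK SI in auto)
  have eK: "0 \<le> e m x" "e m x \<le> K" for m x
  proof -
    have "err m x 0 \<le> e m x" unfolding e_def by (rule cSUP_upper[OF S0 bdd])
    then show "0 \<le> e m x" by (rule order_trans[rotated]) (simp add: err_def)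
    show "e m x \<le> K" unfolding e_def by (rule cSUP_least) (use S0 errK SI in auto)
  qed
  have em[measurable]: "e m \<in> borel_measurable M" for m
    unfolding e_def by (rule borel_measurable_cSUP[OF Sc _ bdd]) (simp add: err_def \<phi>_def)
  have phic: "isCont (\<phi> x) q" if "x \<in> space M" for x q
    unfolding \<phi>_def by (rule isCont_o2[where g="F x"]) (auto intro!: continuous_intros cont that)
  \<comment> \<open>Interior points are limits of rationals in \<open>S\<close> and the error is
    continuous; the endpoints 0 and 1 are rational themselves.\<close>
  have e_ge: "err m x q \<le> e m x" if "x \<in> space M" "q \<in> {0..1}" for m x q
  proof (cases "0 < q \<and> q < 1")
    case True
    obtain s where s: "\<And>n. s n \<in> S" "s \<longlonglongrightarrow> q"
    proof -
      have "q \<in> closure S"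
      proof -
        have "q \<in> closure ({0<..<1} \<inter> \<rat>)"
          using True open_Int_closure_subset[of "{0<..<1::real}" "\<rat>"] Rats_closure_real by auto
        moreover have "{0<..<1} \<inter> \<rat> \<subseteq> S" by (auto simp: S_def)
        ultimately show ?thesis using closure_mono by blast
      qed
      then show thesis using that by (auto simp: closure_sequential)
    qed
    have "isCont (err m x) q" unfolding err_def
      by (intro continuous_intros phic that isCont_Bernstein)
    then have "(\<lambda>n. err m x (s n)) \<longlonglongrightarrow> err m x q" using s(2) by (rule isCont_tendsto_compose)
    then show ?thesis
      by (rule LIMSEQ_le_const2) (auto simp: e_def intro!: cSUP_upper[OF s(1) bdd])
  next
    case False
    then have "q \<in> S" using that by (auto simp: S_def)
    then show ?thesis unfolding e_def by (rule cSUP_upper[OF _ bdd])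
  qed
  have e_lim: "(\<lambda>m. e m x) \<longlonglongrightarrow> 0" if x: "x \<in> space M" for x
  proof (rule LIMSEQ_I)
    fix t :: real assume t: "t > 0"
    have "continuous_on {0..1} (\<phi> x)" using phic[OF x] by (auto intro: continuous_at_imp_continuous_on)
    from Bernstein_Weierstrass[OF this, of "t/2"] t obtain N where
      "\<And>n q. N \<le> n \<Longrightarrow> q \<in> {0..1} \<Longrightarrow> \<bar>\<phi> x q - (\<Sum>k\<le>n. \<phi> x (k/n) * Bernstein n k q)\<bar> < t/2" by auto
    then have "e n x \<le> t/2" if "n \<ge> N" for n
      unfolding e_def using that SI S0 by (intro cSUP_least) (force simp: err_def)+
    then show "\<exists>no. \<forall>n\<ge>no. norm (e n x - 0) < t" using eK t by (intro exI[of _ N]) fastforce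
  qed
  have "(\<lambda>m. \<integral>x. e m x \<partial>M) \<longlonglongrightarrow> (\<integral>x. 0 \<partial>M)"
    by (rule integral_dominated_convergence[where w="\<lambda>_. K"]) (use e_lim eK in auto)
  then have "eventually (\<lambda>m. (\<integral>x. e m x \<partial>M) < d) sequentially"
    using d by (intro order_tendstoD) auto
  then obtain m where m: "(\<integral>x. e m x \<partial>M) < d" by (auto simp: eventually_sequentially)
  \<comment> \<open>Freezing the argument outside the interval extends the approximant to a function
    on the whole line that is still continuous and stays between 0 and \<open>K\<close>.\<close>
  define clamp where "clamp y = max 0 (min 1 ((y + R) / (2 * R)))" for y
  define b where "b k y = Bernstein m k (clamp y)" for k y
  define Fa where "Fa x y = (\<Sum>k\<le>m. \<phi> x (real k / real m) * b k y)" for x y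
  have cl01: "clamp y \<in> {0..1}" for y by (auto simp: clamp_def)
  have bc: "isCont (b k) y" for k y
    unfolding b_def clamp_def by (rule isCont_o2[where g="Bernstein m k"]) (auto intro!: continuous_intros isCont_Bernstein simp: R less_imp_neq[symmetric])
  have [measurable]: "b k \<in> borel_measurable borel" for k by (rule borel_measurable_isCont[OF bc])
  have [measurable]: "tail_fun R \<in> borel_measurable borel" by (rule borel_measurable_isCont[OF isCont_tail_fun])
  have b1: "\<bar>b k y\<bar> \<le> 1" if "k \<le> m" for k y
  proof -
    have "b k y \<le> (\<Sum>k\<le>m. b k y)" using that cl01[of y]
      by (intro member_le_sum) (auto simp: b_def Bernstein_nonneg)
    moreover have "b k y \<ge> 0" using cl01[of y] by (auto simp: b_def Bernstein_nonneg)
    ultimately show ?thesis by (simp add: b_def)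
  qed
  have Fa_bds: "0 \<le> Fa x y" "Fa x y \<le> K" for x y unfolding Fa_def b_def using Bsum[OF cl01] by auto
  \<comment> \<open>Inside the interval the uniform Bernstein error applies. Outside, both functions
    lie between 0 and \<open>K\<close>, so their difference is at most \<open>K\<close>, and there
    \<open>tail_fun R y = 1\<close>.\<close>
  have key: "\<bar>F x y - Fa x y\<bar> \<le> e m x + K * tail_fun R y" if "x \<in> space M" for x y
  proof (cases "\<bar>y\<bar> \<le> R")
    case True
    then have c: "2 * R * clamp y - R = y" using R by (auto simp: clamp_def max_def min_def field_simps)
    have "\<bar>F x y - Fa x y\<bar> = err m x (clamp y)" unfolding err_def Fa_def b_def \<phi>_def[of x "clamp y"] c ..
    also have "\<dots> \<le> e m x" by (rule e_ge[OF that cl01])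
    finally show ?thesis using K0 tail_fun_bounds[of R y] by (simp add: add_increasing2)
  next
    case False
    then have "tail_fun R y = 1" by (intro tail_fun_eq_1) simp
    then show ?thesis using Fa_bds[of x y] F0[of x y] FK[of x y] eK[of m x] by simp
  qed
  have phim[measurable]: "(\<lambda>x. \<phi> x q) \<in> borel_measurable M" for q unfolding \<phi>_def by measurable
  have Fam[measurable]: "(\<lambda>x. Fa x (Y n x)) \<in> borel_measurable M" for n unfolding Fa_def by measurable
  have ib: "integrable M (\<lambda>x. \<phi> x q * b k (Y n x))" if "k \<le> m" for q k n
    by (rule integrable_const_bound[where B="K * 1"])
      (use that in \<open>auto simp: abs_mult \<phi>_def F0 FK b1 K0 simp del: mult_1_right intro!: mult_mono\<close>)
  have iphi: "integrable M (\<lambda>x. \<phi> x q)" for q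
    by (rule integrable_const_bound[where B="K"]) (auto simp: \<phi>_def F0 FK)
  have inb: "integrable \<nu> (b k)" if "k \<le> m" for k
    by (rule nu.integrable_const_bound[where B=1]) (use that b1 in auto)
  have int_tail: "integrable M (\<lambda>x. tail_fun R (Y n x))" for n
    by (rule integrable_const_bound[where B=1]) (auto simp: tail_fun_bounds)
  have int_tail': "integrable \<nu> (tail_fun R)"
    by (rule nu.integrable_const_bound[where B=1]) (auto simp: tail_fun_bounds)
  have int_e: "integrable M (e m)" by (rule integrable_const_bound[where B=K]) (auto simp: eK)
  have Fa_lim: "(\<lambda>n. \<integral>x. Fa x (Y n x) \<partial>M) \<longlonglongrightarrow> (\<integral>x. (\<integral>y. Fa x y \<partial>\<nu>) \<partial>M)"
  proof -
    have "(\<lambda>n. \<Sum>k\<le>m. \<integral>x. \<phi> x (real k / real m) * b k (Y n x) \<partial>M) \<longlonglongrightarrow>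
       (\<Sum>k\<le>m. (\<integral>x. \<phi> x (real k / real m) \<partial>M) * (\<integral>y. b k y \<partial>\<nu>))"
      by (intro tendsto_sum stable_convergence_product[OF Y nu L L0 Ladd lim, where K=K and B=1])
        (use F F0 FK bc b1 in \<open>auto simp: \<phi>_def\<close>)
    moreover have "(\<integral>x. Fa x (Y n x) \<partial>M) = (\<Sum>k\<le>m. \<integral>x. \<phi> x (real k / real m) * b k (Y n x) \<partial>M)" for n
      unfolding Fa_def by (rule Bochner_Integration.integral_sum) (use ib in auto)
    moreover have "(\<integral>x. (\<integral>y. Fa x y \<partial>\<nu>) \<partial>M) = (\<Sum>k\<le>m. (\<integral>x. \<phi> x (real k / real m) \<partial>M) * (\<integral>y. b k y \<partial>\<nu>))"
    proof -
      have "(\<integral>y. Fa x y \<partial>\<nu>) = (\<Sum>k\<le>m. \<phi> x (real k / real m) * (\<integral>y. b k y \<partial>\<nu>))" for x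
        unfolding Fa_def by (subst Bochner_Integration.integral_sum) (use inb in auto)
      then show ?thesis using iphi by (simp add: Bochner_Integration.integral_sum)
    qed
    ultimately show ?thesis by simp
  qed
  have iF: "integrable M (\<lambda>x. F x (Y n x))" for n
    by (rule integrable_const_bound[where B=K]) (auto simp: F0 FK)
  have iFa: "integrable M (\<lambda>x. Fa x (Y n x))" for n
    by (rule integrable_const_bound[where B=K]) (auto simp: Fa_bds)
  have d1: "\<bar>(\<integral>x. F x (Y n x) \<partial>M) - (\<integral>x. Fa x (Y n x) \<partial>M)\<bar> \<le> d + K * (\<integral>x. tail_fun R (Y n x) \<partial>M)" for n
  proof -
    have "norm (\<integral>x. F x (Y n x) - Fa x (Y n x) \<partial>M) \<le> (\<integral>x. e m x + K * tail_fun R (Y n x) \<partial>M)"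
      by (rule norm_integral_le_integral) (use key int_e int_tail in auto)
    then show ?thesis using m iF iFa int_e int_tail by simp
  qed
  have Fax: "Fa x \<in> borel_measurable borel" for x unfolding Fa_def by measurable
  have Fx: "F x \<in> borel_measurable borel" if "x \<in> space M" for x by (rule borel_measurable_isCont[OF cont[OF that]])
  have iFx: "integrable \<nu> (F x)" if "x \<in> space M" for x
    by (rule nu.integrable_const_bound[where B=K]) (use Fx[OF that] F0 FK in auto)
  have iFax: "integrable \<nu> (Fa x)" for x
    by (rule nu.integrable_const_bound[where B=K]) (use Fax Fa_bds in auto)
  have in01: "\<bar>\<integral>y. f y \<partial>\<nu>\<bar> \<le> K" if "\<And>y. 0 \<le> f y" "\<And>y. f y \<le> K" for f
    using norm_integral_le_integral[of \<nu> "\<lambda>_. K" f] that by (auto simp: nuU)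
  have iIF: "integrable M (\<lambda>x. \<integral>y. F x y \<partial>\<nu>)"
    by (rule integrable_const_bound[where B=K]) (use in01 F0 FK in auto)
  have iIFa: "integrable M (\<lambda>x. \<integral>y. Fa x y \<partial>\<nu>)"
  proof (rule integrable_const_bound[where B=K])
    have "(\<lambda>(x,y). Fa x y) \<in> borel_measurable (M \<Otimes>\<^sub>M \<nu>)" unfolding Fa_def by measurable
    then show "(\<lambda>x. \<integral>y. Fa x y \<partial>\<nu>) \<in> borel_measurable M" by (rule nu.borel_measurable_lebesgue_integral)
  qed (use in01 Fa_bds in auto)
  have d2: "\<bar>(\<integral>x. (\<integral>y. F x y \<partial>\<nu>) \<partial>M) - (\<integral>x. (\<integral>y. Fa x y \<partial>\<nu>) \<partial>M)\<bar> \<le> d + K * d"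
  proof -
    have "norm ((\<integral>y. F x y \<partial>\<nu>) - (\<integral>y. Fa x y \<partial>\<nu>)) \<le> e m x + K * (\<integral>y. tail_fun R y \<partial>\<nu>)" if x: "x \<in> space M" for x
    proof -
      have "norm (\<integral>y. F x y - Fa x y \<partial>\<nu>) \<le> (\<integral>y. e m x + K * tail_fun R y \<partial>\<nu>)"
        by (rule norm_integral_le_integral) (use key[OF x] int_tail' in auto)
      then show ?thesis using iFx[OF x] iFax int_tail' by (simp add: nuU)
    qed
    then have "norm (\<integral>x. (\<integral>y. F x y \<partial>\<nu>) - (\<integral>y. Fa x y \<partial>\<nu>) \<partial>M) \<le> (\<integral>x. e m x + K * (\<integral>y. tail_fun R y \<partial>\<nu>) \<partial>M)"
      by (intro norm_integral_le_integral) (use int_e in auto)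
    also have "\<dots> = (\<integral>x. e m x \<partial>M) + K * (\<integral>y. tail_fun R y \<partial>\<nu>)" using int_e by (simp add: prob_space)
    also have "\<dots> \<le> d + K * d" using m Rd K0 by (intro add_mono mult_left_mono) auto
    finally show ?thesis using iIF iIFa by simp
  qed
  \<comment> \<open>The product case with weight 1 is plain weak convergence of \<open>Y n\<close>,
    and gives its asymptotic tightness.\<close>
  have "(\<lambda>n. \<integral>x. 1 * tail_fun R (Y n x) \<partial>M) \<longlonglongrightarrow> (\<integral>x. 1 \<partial>M) * (\<integral>y. tail_fun R y \<partial>\<nu>)"
    by (rule stable_convergence_product[OF Y nu L L0 Ladd lim, where K=1 and B=1])
      (auto simp: tail_fun_bounds isCont_tail_fun)
  then have ev1: "eventually (\<lambda>n. (\<integral>x. tail_fun R (Y n x) \<partial>M) < d) sequentially"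
    using Rd by (intro order_tendstoD) (auto simp: prob_space)
  have ev2: "eventually (\<lambda>n. \<bar>(\<integral>x. Fa x (Y n x) \<partial>M) - (\<integral>x. (\<integral>y. Fa x y \<partial>\<nu>) \<partial>M)\<bar> < d) sequentially"
    using tendstoD[OF Fa_lim d] by (simp add: dist_real_def)
  have "eventually (\<lambda>n. norm ((\<integral>x. F x (Y n x) \<partial>M) - (\<integral>x. (\<integral>y. F x y \<partial>\<nu>) \<partial>M)) < r) sequentially"
    using ev1 ev2
  proof eventually_elim
    case (elim n)
    have "K * (\<integral>x. tail_fun R (Y n x) \<partial>M) \<le> K * d" using elim(1) K0 by (intro mult_left_mono) auto
    then show ?case using d1[of n] d2 elim(2) dr by (simp add: abs_le_iff abs_less_iff) 
  qed
  then show "\<exists>no. \<forall>n\<ge>no. norm ((\<integral>x. F x (Y n x) \<partial>M) - (\<integral>x. (\<integral>y. F x y \<partial>\<nu>) \<partial>M)) < r"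
    by (simp add: eventually_sequentially)
qed

text \<open>Adding the bound \<open>K\<close> makes the test function nonnegative, as the values
  \<open>F x y\<close> act as weights in the Levy argument.\<close>

lemma (in prob_space) stable_convergence_Caratheodory:
  fixes Y :: "nat \<Rightarrow> 'a \<Rightarrow> real" and F :: "'a \<Rightarrow> real \<Rightarrow> real" and K :: real
  assumes Y[measurable]: "\<And>n. Y n \<in> borel_measurable M" and nu: "real_distribution \<nu>"
    and L: "L \<subseteq> borel_measurable M" and L0: "(\<lambda>_. 0) \<in> L"
    and Ladd: "\<And>l u c. l \<in> L \<Longrightarrow> u \<in> L \<Longrightarrow> (\<lambda>x. l x + c * u x) \<in> L"
    and lim: "\<And>l c. l \<in> L \<Longrightarrow> (\<lambda>n. \<integral>x. iexp (l x) * (iexp (c * Y n x) - char \<nu> c) \<partial>M) \<longlonglongrightarrow> 0"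
    and F: "\<And>y. (\<lambda>x. F x y) \<in> borel_measurable (generated_algebra M L)"
    and FK: "\<And>x y. \<bar>F x y\<bar> \<le> K"
    and cont: "\<And>x y. x \<in> space M \<Longrightarrow> isCont (F x) y"
  shows "(\<lambda>n. \<integral>x. F x (Y n x) \<partial>M) \<longlonglongrightarrow> (\<integral>x. (\<integral>y. F x y \<partial>\<nu>) \<partial>M)"
proof -
  interpret nu: real_distribution \<nu> by fact
  have nuU: "measure \<nu> UNIV = 1" using nu.prob_space by simp
  have Fm[measurable]: "(\<lambda>x. F x y) \<in> borel_measurable M" for y
    using F borel_measurable_generated_algebra_subset[OF L] by auto
  have FYm[measurable]: "(\<lambda>x. F x (Y n x)) \<in> borel_measurable M" for n
    by (rule borel_measurable_Caratheodory) (use cont in auto)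
  have "(\<lambda>z. F (fst z) (snd z)) \<in> borel_measurable (M \<Otimes>\<^sub>M \<nu>)"
    by (rule borel_measurable_Caratheodory) (use cont in \<open>auto simp: space_pair_measure\<close>)
  then have "(\<lambda>(x, y). F x y) \<in> borel_measurable (M \<Otimes>\<^sub>M \<nu>)" by (simp add: case_prod_beta')
  then have [measurable]: "(\<lambda>x. \<integral>y. F x y \<partial>\<nu>) \<in> borel_measurable M"
    by (rule nu.borel_measurable_lebesgue_integral)
  have iY: "integrable M (\<lambda>x. F x (Y n x))" for n
    by (rule integrable_const_bound[where B=K]) (auto simp: FK)
  have iF: "integrable \<nu> (F x)" if "x \<in> space M" for x
    by (rule nu.integrable_const_bound[where B=K])
      (use borel_measurable_isCont[OF cont[OF that]] FK in auto)
  have b: "\<bar>\<integral>y. F x y \<partial>\<nu>\<bar> \<le> K" for x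
    using norm_integral_le_integral[of \<nu> "\<lambda>_. K" "F x"] FK by (auto simp: nuU)
  have iI: "integrable M (\<lambda>x. \<integral>y. F x y \<partial>\<nu>)"
    by (rule integrable_const_bound[where B=K]) (use b in auto)
  have "(\<lambda>n. \<integral>x. F x (Y n x) + K \<partial>M) \<longlonglongrightarrow> (\<integral>x. (\<integral>y. F x y + K \<partial>\<nu>) \<partial>M)"
  proof (rule stable_convergence_Caratheodory_nonneg[OF Y nu L L0 Ladd lim, where K="2*K"])
    show "0 \<le> F x y + K" for x y using FK[of x y] by linarith
    show "F x y + K \<le> 2*K" for x y using FK[of x y] by linarith
  qed (use F cont in \<open>auto intro!: continuous_intros\<close>)
  moreover have "(\<integral>x. F x (Y n x) + K \<partial>M) = (\<integral>x. F x (Y n x) \<partial>M) + K" for n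
    using iY by (simp add: prob_space)
  moreover have "(\<integral>x. (\<integral>y. F x y + K \<partial>\<nu>) \<partial>M) = (\<integral>x. (\<integral>y. F x y \<partial>\<nu>) \<partial>M) + K"
  proof -
    have "(\<integral>x. (\<integral>y. F x y + K \<partial>\<nu>) \<partial>M) = (\<integral>x. (\<integral>y. F x y \<partial>\<nu>) + K \<partial>M)"
      by (rule Bochner_Integration.integral_cong) (auto simp: iF nuU)
    also have "\<dots> = (\<integral>x. (\<integral>y. F x y \<partial>\<nu>) \<partial>M) + K" using iI by (simp add: prob_space)
    finally show ?thesis .
  qed
  ultimately have "(\<lambda>n. (\<integral>x. F x (Y n x) \<partial>M) + K) \<longlonglongrightarrow> (\<integral>x. (\<integral>y. F x y \<partial>\<nu>) \<partial>M) + K" by simp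
  from tendsto_diff[OF this tendsto_const[of K]] show ?thesis by simp
qed

section \<open>Continuous functionals of paths\<close>

text \<open>Polynomial path built from the values \<open>v k\<close> at \<open>m + 1\<close>
  equidistant times. A functional of it depends on finitely many coordinates, which brings path
  functionals into reach of finite-dimensional measurability.\<close>

definition bernstein_path :: "real \<Rightarrow> nat \<Rightarrow> (nat \<Rightarrow> real \<times> real) \<Rightarrow> real \<Rightarrow> real \<times> real" where
  "bernstein_path T m v t = (\<Sum>k\<le>m. Bernstein m k (t / T) *\<^sub>R v k)"

lemma continuous_on_bernstein_path: "continuous_on S (bernstein_path T m v)"
  unfolding bernstein_path_def Bernstein_def by (cases "T = 0") (auto intro!: continuous_intros)

text \<open>At each time the Bernstein weights are nonnegative with sum 1, so passing from node
  values to the path does not increase distances.\<close>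

lemma dist_bernstein_path_le:
  assumes "0 < T" "t \<in> {0..T}" and "\<And>k. k \<le> m \<Longrightarrow> dist (v k) (v' k) \<le> d"
  shows "dist (bernstein_path T m v t) (bernstein_path T m v' t) \<le> d"
proof -
  have q: "0 \<le> t / T" "t / T \<le> 1" using assms by auto
  have "dist (bernstein_path T m v t) (bernstein_path T m v' t) = norm (\<Sum>k\<le>m. Bernstein m k (t / T) *\<^sub>R (v k - v' k))"
    by (simp add: bernstein_path_def dist_norm scaleR_diff_right sum_subtractf)
  also have "\<dots> \<le> (\<Sum>k\<le>m. Bernstein m k (t / T) * d)"
    using q assms(3) by (intro sum_norm_le) (auto simp: dist_norm Bernstein_nonneg intro!: mult_left_mono)
  also have "\<dots> = d" by (simp add: sum_distrib_right[symmetric])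
  finally show ?thesis .
qed

lemma bernstein_path_uniform_limit:
  fixes w :: "real \<Rightarrow> real \<times> real"
  assumes "0 < T" "continuous_on {0..T} w" "0 < d"
  shows "eventually (\<lambda>m. \<forall>t\<in>{0..T}. dist (w t) (bernstein_path T m (\<lambda>k. w (T * (real k / real m))) t) < d) sequentially"
proof -
  have c: "continuous_on {0..1} (\<lambda>q. w (T * q))"
    by (rule continuous_on_compose2[OF assms(2)]) (use assms(1) in \<open>auto intro!: continuous_intros simp: mult_le_cancel_left1\<close>)
  obtain N1 where N1: "\<And>n q. N1 \<le> n \<Longrightarrow> q \<in> {0..1} \<Longrightarrow>
      \<bar>fst (w (T * q)) - (\<Sum>k\<le>n. fst (w (T * (k/n))) * Bernstein n k q)\<bar> < d/2"
    using Bernstein_Weierstrass[OF continuous_on_fst[OF c], of "d/2"] assms(3) by auto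
  obtain N2 where N2: "\<And>n q. N2 \<le> n \<Longrightarrow> q \<in> {0..1} \<Longrightarrow>
      \<bar>snd (w (T * q)) - (\<Sum>k\<le>n. snd (w (T * (k/n))) * Bernstein n k q)\<bar> < d/2"
    using Bernstein_Weierstrass[OF continuous_on_snd[OF c], of "d/2"] assms(3) by auto
  have pair: "dist p q \<le> \<bar>fst p - fst q\<bar> + \<bar>snd p - snd q\<bar>" for p q :: "real \<times> real"
    using norm_Pair_le[of "fst p - fst q" "snd p - snd q"] by (cases p; cases q) (simp add: dist_norm)
  show ?thesis
    unfolding eventually_sequentially
  proof (intro exI[of _ "max N1 N2"] allI impI ballI)
    fix m t assume m: "max N1 N2 \<le> m" and t: "t \<in> {0..T}"
    define q where "q = t / T"
    have q: "q \<in> {0..1}" "T * q = t" using t assms(1) by (auto simp: q_def)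
    let ?v = "\<lambda>k. w (T * (real k / real m))"
    have f: "fst (bernstein_path T m ?v t) = (\<Sum>k\<le>m. fst (w (T * (k/m))) * Bernstein m k q)"
      by (simp add: bernstein_path_def fst_sum q_def mult.commute)
    have s: "snd (bernstein_path T m ?v t) = (\<Sum>k\<le>m. snd (w (T * (k/m))) * Bernstein m k q)"
      by (simp add: bernstein_path_def snd_sum q_def mult.commute)
    have "dist (w t) (bernstein_path T m ?v t) \<le> \<bar>fst (w t) - fst (bernstein_path T m ?v t)\<bar> + \<bar>snd (w t) - snd (bernstein_path T m ?v t)\<bar>"
      by (rule pair)
    also have "\<dots> < d/2 + d/2"
      using N1[of m q] N2[of m q] m q unfolding f s by (intro add_strict_mono) auto
    finally show "dist (w t) (bernstein_path T m ?v t) < d" by simp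
  qed
qed

text \<open>Uniform continuity of sample paths makes the functional the pointwise limit of its
  values along Bernstein paths, and each of those is a continuous function of finitely many
  coordinates. This yields measurability with respect to the coordinates of the process
  alone.\<close>

lemma test_fun_measurable:
  fixes X :: "real \<Rightarrow> 'a \<Rightarrow> real \<times> real"
  assumes f: "test_fun T f" and T: "0 < T"
    and Xm: "\<And>t. t \<in> {0..T} \<Longrightarrow> X t \<in> borel_measurable N"
    and Xc: "\<And>x. x \<in> space N \<Longrightarrow> continuous_on {0..T} (\<lambda>t. X t x)"
  shows "(\<lambda>x. f (\<lambda>t. X t x) y) \<in> borel_measurable N"
proof (rule borel_measurable_LIMSEQ_real)
  have fc: "\<exists>d>0. \<forall>w' z. continuous_on {0..T} w' \<and> (\<forall>t\<in>{0..T}. dist (w t) (w' t) < d) \<and> \<bar>y - z\<bar> < d \<longrightarrow> \<bar>f w y - f w' z\<bar> < e"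
    if "continuous_on {0..T} w" "e > 0" for w e y
    using f that unfolding test_fun_def by blast
  define g where "g m v = f (bernstein_path T m v) y" for m v
  \<comment> \<open>The \<open>min\<close> keeps the sampling times in the interval for all indices;
    coordinates beyond \<open>m\<close> never enter the Bernstein path.\<close>
  define v where "v m x = (\<lambda>k. X (T * (real (min k m) / real m)) x)" for m x
  \<comment> \<open>Continuity is for the product topology: closeness of the coordinates up to
    \<open>m\<close> already makes the Bernstein paths uniformly close.\<close>
  have "continuous_on UNIV (g m)" for m
    unfolding continuous_on_eq_continuous_at[OF open_UNIV] isCont_def
  proof (intro ballI tendstoI)
    fix u :: "nat \<Rightarrow> real \<times> real" and e :: real assume e: "e > 0"
    obtain d where d: "d > 0" "\<And>w'. continuous_on {0..T} w' \<Longrightarrow> (\<forall>t\<in>{0..T}. dist (bernstein_path T m u t) (w' t) < d) \<Longrightarrow> \<bar>f (bernstein_path T m u) y - f w' y\<bar> < e"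
      using fc[OF continuous_on_bernstein_path[of "{0..T}" T m u] e, of y] by (metis abs_zero diff_self)
    have "eventually (\<lambda>u'. \<forall>k\<in>{..m}. dist (u' k) (u k) < d/2) (at u)"
    proof (intro eventually_ball_finite ballI)
      fix k assume "k \<in> {..m}"
      have "continuous_on UNIV (\<lambda>u::nat \<Rightarrow> real \<times> real. u k)" by (rule continuous_on_product_coordinates)
      then have "((\<lambda>u'. u' k) \<longlongrightarrow> u k) (at u)" 
        unfolding continuous_on_eq_continuous_at[OF open_UNIV] isCont_def by blast
      then show "eventually (\<lambda>u'. dist (u' k) (u k) < d/2) (at u)" using d(1) by (intro tendstoD) auto
    qed simp
    then show "eventually (\<lambda>u'. dist (g m u') (g m u) < e) (at u)"
    proof eventually_elim
      case (elim u')
      have "dist (bernstein_path T m u t) (bernstein_path T m u' t) < d" if "t \<in> {0..T}" for t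
        using dist_bernstein_path_le[OF T that, of m u u' "d/2"] elim d(1) by (force simp: dist_commute)
      from d(2)[OF continuous_on_bernstein_path, of T m u'] this show ?case
        by (simp add: g_def dist_real_def abs_minus_commute)
    qed
  qed
  then have gm[measurable]: "g m \<in> borel_measurable borel" for m
    by (rule borel_measurable_continuous_onI)
  have vm[measurable]: "v m \<in> borel_measurable N" for m
    unfolding v_def
  proof (rule measurable_coordinatewise_then_product)
    fix k
    have "real (min k m) / real m \<le> 1" by (cases "m = 0") auto
    then have "T * (real (min k m) / real m) \<in> {0..T}"
      using T mult_left_mono[of "real (min k m) / real m" 1 T] by auto
    then show "(\<lambda>x. X (T * (real (min k m) / real m)) x) \<in> borel_measurable N" by (rule Xm)
  qed
  show "(\<lambda>x. g m (v m x)) \<in> borel_measurable N" for m by measurable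
  fix x assume x: "x \<in> space N"
  show "(\<lambda>m. g m (v m x)) \<longlonglongrightarrow> f (\<lambda>t. X t x) y"
  proof (rule tendstoI)
    fix e :: real assume e: "e > 0"
    obtain d where d: "d > 0" "\<And>w'. continuous_on {0..T} w' \<Longrightarrow> (\<forall>t\<in>{0..T}. dist (X t x) (w' t) < d) \<Longrightarrow> \<bar>f (\<lambda>t. X t x) y - f w' y\<bar> < e"
      using fc[OF Xc[OF x] e, of y] by (metis abs_zero diff_self)
    have "eventually (\<lambda>m. \<forall>t\<in>{0..T}. dist (X t x) (bernstein_path T m (\<lambda>k. X (T * (real k / real m)) x) t) < d) sequentially"
      using bernstein_path_uniform_limit[OF T Xc[OF x] d(1)] by simp
    then show "eventually (\<lambda>m. dist (g m (v m x)) (f (\<lambda>t. X t x) y) < e) sequentially"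
    proof eventually_elim
      case (elim m)
      have "bernstein_path T m (\<lambda>k. X (T * (real k / real m)) x) = bernstein_path T m (v m x)"
        by (auto simp: bernstein_path_def v_def fun_eq_iff intro!: sum.cong)
      with d(2)[OF continuous_on_bernstein_path, of T m "v m x"] elim show ?case
        by (simp add: g_def dist_real_def abs_minus_commute)
    qed
  qed
qed

text \<open>With the path component fixed, \<open>f\<close> becomes a random function of the real
  variable alone, measurable with respect to \<open>L\<close> and continuous in that variable, so
  stable convergence applies along every sequence decreasing to 0.\<close>

lemma (in prob_space) conv_law_indep_by_characteristic_functions:
  fixes X :: "real \<Rightarrow> 'a \<Rightarrow> real \<times> real" and Y :: "real \<Rightarrow> 'a \<Rightarrow> real"
  assumes T: "0 < T" and Y: "\<And>\<epsilon>. 0 < \<epsilon> \<Longrightarrow> Y \<epsilon> \<in> borel_measurable M" and nu: "real_distribution \<nu>"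
    and L: "L \<subseteq> borel_measurable M" and L0: "(\<lambda>_. 0) \<in> L"
    and Ladd: "\<And>l u c. l \<in> L \<Longrightarrow> u \<in> L \<Longrightarrow> (\<lambda>x. l x + c * u x) \<in> L"
    and XL: "\<And>t. t \<in> {0..T} \<Longrightarrow> (\<lambda>x. fst (X t x)) \<in> L" "\<And>t. t \<in> {0..T} \<Longrightarrow> (\<lambda>x. snd (X t x)) \<in> L"
    and Xc: "\<And>x. x \<in> space M \<Longrightarrow> continuous_on {0..T} (\<lambda>t. X t x)"
    and lim: "\<And>l c. l \<in> L \<Longrightarrow> ((\<lambda>\<epsilon>. \<integral>x. iexp (l x) * (iexp (c * Y \<epsilon> x) - char \<nu> c) \<partial>M) \<longlongrightarrow> 0) (at_right 0)"
  shows "conv_law_indep M T X Y \<nu>"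
  unfolding conv_law_indep_def
proof (intro allI impI)
  fix f assume f: "test_fun T f"
  show "((\<lambda>\<epsilon>. \<integral>x. f (\<lambda>t. X t x) (Y \<epsilon> x) \<partial>M) \<longlongrightarrow> (\<integral>x. (\<integral>y. f (\<lambda>t. X t x) y \<partial>\<nu>) \<partial>M)) (at_right 0)"
  proof (rule tendsto_at_right_sequentially[of 0 1])
    fix S :: "nat \<Rightarrow> real" assume S: "\<And>n. 0 < S n" "\<And>n. S n < 1" "decseq S" "S \<longlonglongrightarrow> 0"
    have flim: "filterlim S (at_right 0) sequentially"
    proof -
      have "S n \<noteq> 0" for n using S(1)[of n] by simp
      then show ?thesis using S by (auto simp: filterlim_at less_imp_le)
    qed
    obtain K where K: "\<And>w x. \<bar>f w x\<bar> \<le> K" using f unfolding test_fun_def by auto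
    show "(\<lambda>n. \<integral>x. f (\<lambda>t. X t x) (Y (S n) x) \<partial>M) \<longlonglongrightarrow> (\<integral>x. (\<integral>y. f (\<lambda>t. X t x) y \<partial>\<nu>) \<partial>M)"
    proof (rule stable_convergence_Caratheodory[OF _ nu L L0 Ladd, where K=K])
      show "Y (S n) \<in> borel_measurable M" for n using Y S by auto
      show "(\<lambda>n. \<integral>x. iexp (l x) * (iexp (c * Y (S n) x) - char \<nu> c) \<partial>M) \<longlonglongrightarrow> 0" if "l \<in> L" for l c
        using filterlim_compose[OF lim[OF that] flim] .
      show "(\<lambda>x. f (\<lambda>t. X t x) y) \<in> borel_measurable (generated_algebra M L)" for y
      proof (rule test_fun_measurable[OF f T])
        fix t assume t: "t \<in> {0..T}"
        have "(\<lambda>x. (fst (X t x), snd (X t x))) \<in> borel_measurable (generated_algebra M L)"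
          using XL[OF t] by (intro borel_measurable_Pair measurable_generated_algebra)
        then show "X t \<in> borel_measurable (generated_algebra M L)" by simp
      qed (use Xc in auto)
      show "isCont (\<lambda>y. f (\<lambda>t. X t x) y) y" if x: "x \<in> space M" for x y
        unfolding isCont_def
      proof (rule tendstoI)
        fix e :: real assume "e > 0"
        then have "\<exists>d>0. \<forall>w' z. continuous_on {0..T} w' \<and> (\<forall>t\<in>{0..T}. dist (X t x) (w' t) < d) \<and> \<bar>y - z\<bar> < d \<longrightarrow>
            \<bar>f (\<lambda>t. X t x) y - f w' z\<bar> < e"
          using f Xc[OF x] unfolding test_fun_def by blast
        then obtain d where d0: "d > 0" and d': "\<And>w' z. continuous_on {0..T} w' \<Longrightarrow> (\<forall>t\<in>{0..T}. dist (X t x) (w' t) < d) \<Longrightarrow> \<bar>y - z\<bar> < d \<Longrightarrow>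
            \<bar>f (\<lambda>t. X t x) y - f w' z\<bar> < e" by blast
        have d: "d > 0" "\<And>z. \<bar>y - z\<bar> < d \<Longrightarrow> \<bar>f (\<lambda>t. X t x) y - f (\<lambda>t. X t x) z\<bar> < e"
          using d0 d'[OF Xc[OF x]] by auto
        have "eventually (\<lambda>z. dist z y < d) (at y)" using d(1) by (auto simp: eventually_at)
        then show "eventually (\<lambda>z. dist (f (\<lambda>t. X t x) z) (f (\<lambda>t. X t x) y) < e) (at y)"
          by eventually_elim (use d(2) in \<open>auto simp: dist_real_def abs_minus_commute\<close>)
      qed
    qed (use K in auto)
  qed simp
qed

section \<open>Gaussian spaces\<close>

lemma (in prob_space) centered_gaussian_measurable:
  "centered_gaussian M X v \<Longrightarrow> X \<in> borel_measurable M"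
  by (auto simp: centered_gaussian_def dest: distributed_measurable)

lemma (in prob_space) centered_gaussian_char:
  assumes "centered_gaussian M X v"
  shows "(\<integral>x. iexp (c * X x) \<partial>M) = complex_of_real (exp (- (c\<^sup>2 * v) / 2))"
  using assms unfolding centered_gaussian_def
proof (elim disjE conjE)
  assume v: "v = 0" and [measurable]: "X \<in> borel_measurable M" and "AE x in M. X x = 0"
  then have "(\<integral>x. iexp (c * X x) \<partial>M) = (\<integral>x. 1 \<partial>M)" by (intro integral_cong_AE) auto
  then show ?thesis using v by (simp add: prob_space)
next
  assume v: "v > 0" and d: "distributed M lborel X (normal_density 0 (sqrt v))"
  let ?Z = "\<lambda>x. X x / sqrt v"
  have d': "distributed M lborel ?Z std_normal_density"
    using d normal_standard_normal_convert[of "sqrt v" X 0] v by simp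
  have [measurable]: "X \<in> borel_measurable M" using distributed_measurable[OF d] by simp
  have "distr M borel ?Z = distr M lborel ?Z" by (rule distr_cong) auto
  then have "distr M borel ?Z = std_normal_distribution" using distributed_distr_eq_density[OF d'] by simp
  then have "(\<integral>x. iexp (c * sqrt v * ?Z x) \<partial>M) = char std_normal_distribution (c * sqrt v)"
    unfolding char_def by (subst integral_distr[of _ M borel, symmetric]) auto
  moreover have "c * sqrt v * ?Z x = c * X x" for x using v by simp
  ultimately show ?thesis using v by (simp add: char_std_normal_distribution power_mult_distrib)
qed

lemma (in prob_space) centered_gaussian_moments:
  assumes "centered_gaussian M X v"
  shows "integrable M (\<lambda>x. X x ^ k)" "(\<integral>x. X x ^ 2 \<partial>M) = v" "(\<integral>x. X x ^ 4 \<partial>M) = 3 * v\<^sup>2"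
proof -
  have "integrable M (\<lambda>x. X x ^ k) \<and> (\<integral>x. X x ^ 2 \<partial>M) = v \<and> (\<integral>x. X x ^ 4 \<partial>M) = 3 * v\<^sup>2"
    using assms unfolding centered_gaussian_def
  proof (elim disjE conjE)
    assume v: "v = 0" and [measurable]: "X \<in> borel_measurable M" and z: "AE x in M. X x = 0"
    have "integrable M (\<lambda>x. X x ^ k) \<longleftrightarrow> integrable M (\<lambda>x. (0::real) ^ k)"
      by (rule integrable_cong_AE) (use z in auto)
    moreover have "(\<integral>x. X x ^ 2 \<partial>M) = (\<integral>x. 0 \<partial>M)" "(\<integral>x. X x ^ 4 \<partial>M) = (\<integral>x. 0 \<partial>M)"
      by (intro integral_cong_AE; use z in auto)+
    ultimately show ?thesis using v by simp
  next
    assume v: "v > 0" and d: "distributed M lborel X (normal_density 0 (sqrt v))"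
    have s: "sqrt v > 0" using v by simp
    have "integrable M (\<lambda>x. X x ^ k)"
      using integrable_normal_moment[OF s, of 0 k] distributed_integrable[OF d, of "\<lambda>x. x ^ k"] by simp
    moreover have "(\<integral>x. X x ^ (2 * j) \<partial>M) = fact (2 * j) / ((2 / (sqrt v)\<^sup>2)^j * fact j)" for j
      using has_bochner_integral_integral_eq[OF normal_moment_even[OF s, of 0 j]]
        distributed_integral[OF d, of "\<lambda>x. x ^ (2 * j)"] by simp
    from this[of 1] this[of 2] have "(\<integral>x. X x ^ 2 \<partial>M) = v" "(\<integral>x. X x ^ 4 \<partial>M) = 3 * v\<^sup>2"
      using v by (simp_all add: fact_numeral power2_eq_square field_simps)
    ultimately show ?thesis by simp
  qed
  then show "integrable M (\<lambda>x. X x ^ k)" "(\<integral>x. X x ^ 2 \<partial>M) = v" "(\<integral>x. X x ^ 4 \<partial>M) = 3 * v\<^sup>2" by auto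
qed

text \<open>Linear closure makes polarisation available; the variance is left existential and is
  later identified as the integral of the square.\<close>

definition gaussian_space :: "'a measure \<Rightarrow> ('a \<Rightarrow> real) set \<Rightarrow> bool" where
  "gaussian_space M G \<longleftrightarrow> (\<lambda>_. 0) \<in> G \<and> (\<forall>X\<in>G. \<forall>Y\<in>G. \<forall>c. (\<lambda>x. X x + c * Y x) \<in> G) \<and>
     (\<forall>X\<in>G. \<exists>v. centered_gaussian M X v)"

context prob_space
begin

context
  fixes G :: "('a \<Rightarrow> real) set"
  assumes G: "gaussian_space M G"
begin

lemma gaussian_space_zero: "(\<lambda>_. 0) \<in> G"
  and gaussian_space_lincomb: "X \<in> G \<Longrightarrow> Y \<in> G \<Longrightarrow> (\<lambda>x. X x + c * Y x) \<in> G"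
  using G unfolding gaussian_space_def by auto

lemma gaussian_space_add: "X \<in> G \<Longrightarrow> Y \<in> G \<Longrightarrow> (\<lambda>x. X x + Y x) \<in> G"
  using gaussian_space_lincomb[of X Y 1] by simp

lemma gaussian_space_diff: "X \<in> G \<Longrightarrow> Y \<in> G \<Longrightarrow> (\<lambda>x. X x - Y x) \<in> G"
  using gaussian_space_lincomb[of X Y "-1"] by simp

lemma gaussian_space_sum:
  "finite I \<Longrightarrow> (\<And>i. i \<in> I \<Longrightarrow> X i \<in> G) \<Longrightarrow> (\<lambda>x. \<Sum>i\<in>I. c i * X i x) \<in> G"
proof (induction I rule: finite_induct)
  case empty then show ?case using gaussian_space_zero by simp
next
  case (insert i I)
  then show ?case using gaussian_space_lincomb[of "\<lambda>x. \<Sum>i\<in>I. c i * X i x" "X i" "c i"]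
    by (simp add: add.commute)
qed

lemma gaussian_space_measurable: "X \<in> G \<Longrightarrow> X \<in> borel_measurable M"
  using G centered_gaussian_measurable unfolding gaussian_space_def by blast

lemma gaussian_space_gaussian:
  assumes "X \<in> G"
  shows "centered_gaussian M X (\<integral>x. X x * X x \<partial>M)"
proof -
  obtain v where v: "centered_gaussian M X v" using G assms unfolding gaussian_space_def by blast
  with centered_gaussian_moments(2)[OF v] show ?thesis by (simp add: power2_eq_square)
qed

lemma gaussian_space_integrable_product:
  assumes "X \<in> G" "Y \<in> G"
  shows "integrable M (\<lambda>x. X x * Y x)"
proof (rule Bochner_Integration.integrable_bound)
  show "integrable M (\<lambda>x. X x ^ 2 + Y x ^ 2)"
    by (intro Bochner_Integration.integrable_add centered_gaussian_moments(1)[OF gaussian_space_gaussian] assms)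
  have "\<bar>a * b\<bar> \<le> a\<^sup>2 + b\<^sup>2" for a b :: real
  proof -
    have half: "p \<le> q" if "2 * p \<le> q" "0 \<le> q" for p q :: real using that by linarith
    show ?thesis by (rule half) (use sum_squares_bound[of "\<bar>a\<bar>" "\<bar>b\<bar>"] in \<open>auto simp: abs_mult\<close>)
  qed
  then show "AE x in M. norm (X x * Y x) \<le> norm (X x ^ 2 + Y x ^ 2)" by (intro AE_I2) auto
qed (intro borel_measurable_times gaussian_space_measurable assms)

lemma gaussian_space_integrable:
  assumes "X \<in> G" shows "integrable M X"
  using centered_gaussian_moments(1)[OF gaussian_space_gaussian[OF assms], of 1] by simp

lemma gaussian_space_integrable_product4:
  assumes "X \<in> G" "Y \<in> G" "Z \<in> G" "W \<in> G"
  shows "integrable M (\<lambda>x. X x * Y x * (Z x * W x))"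
proof (rule Bochner_Integration.integrable_bound)
  show "integrable M (\<lambda>x. (X x ^ 4 + Y x ^ 4) + (Z x ^ 4 + W x ^ 4))"
    by (intro Bochner_Integration.integrable_add centered_gaussian_moments(1)[OF gaussian_space_gaussian] assms)
  have sq: "\<bar>a * b\<bar> \<le> (a\<^sup>2 + b\<^sup>2) / 2" for a b :: real
    using sum_squares_bound[of "\<bar>a\<bar>" "\<bar>b\<bar>"] by (simp add: abs_mult)
  have quarter: "(p / 2 + q / 2) / 2 \<le> p + q" if "0 \<le> p" "0 \<le> q" for p q :: real
    using that by (simp add: field_simps)
  have "\<bar>a * b * (c * d)\<bar> \<le> (a ^ 4 + b ^ 4) + (c ^ 4 + d ^ 4)" for a b c d :: real
  proof -
    have "\<bar>a * b * (c * d)\<bar> \<le> ((a * b)\<^sup>2 + (c * d)\<^sup>2) / 2" by (rule sq)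
    also have "(a * b)\<^sup>2 \<le> (a ^ 4 + b ^ 4) / 2"
      using sq[of "a\<^sup>2" "b\<^sup>2"] by (simp add: power_mult_distrib)
    also have "(c * d)\<^sup>2 \<le> (c ^ 4 + d ^ 4) / 2"
      using sq[of "c\<^sup>2" "d\<^sup>2"] by (simp add: power_mult_distrib)
    finally have "\<bar>a * b * (c * d)\<bar> \<le> ((a ^ 4 + b ^ 4) / 2 + (c ^ 4 + d ^ 4) / 2) / 2" by simp
    also have "\<dots> \<le> (a ^ 4 + b ^ 4) + (c ^ 4 + d ^ 4)" by (rule quarter) auto
    finally show ?thesis .
  qed
  then show "AE x in M. norm (X x * Y x * (Z x * W x)) \<le> norm ((X x ^ 4 + Y x ^ 4) + (Z x ^ 4 + W x ^ 4))"
    by (intro AE_I2) auto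
qed (intro borel_measurable_times gaussian_space_measurable assms)

section \<open>Moments of order four: the Isserlis formula by polarisation\<close>

lemma gaussian_space_fourth_moment:
  assumes "X \<in> G"
  shows "(\<integral>x. X x * X x * (X x * X x) \<partial>M) = 3 * (\<integral>x. X x * X x \<partial>M)\<^sup>2"
  using centered_gaussian_moments(3)[OF gaussian_space_gaussian[OF assms]]
  by (simp add: power4_eq_xxxx mult.assoc)

text \<open>Comes from (X+Y)^4 + (X-Y)^4 = 2 X^4 + 12 X^2 Y^2 + 2 Y^4 and the one-dimensional fourth
  moment applied to X+Y, X-Y, X and Y.\<close>

lemma isserlis_squares:
  assumes X: "X \<in> G" and Y: "Y \<in> G"
  shows "(\<integral>x. X x * X x * (Y x * Y x) \<partial>M) =
    (\<integral>x. X x * X x \<partial>M) * (\<integral>x. Y x * Y x \<partial>M) + 2 * (\<integral>x. X x * Y x \<partial>M)\<^sup>2"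
proof -
  note i2 = gaussian_space_integrable_product and i4 = gaussian_space_integrable_product4
  define P where "P = (\<lambda>x. X x + Y x)" define Q where "Q = (\<lambda>x. X x - Y x)"
  have PQ: "P \<in> G" "Q \<in> G" unfolding P_def Q_def using X Y gaussian_space_add gaussian_space_diff by auto
  let ?a = "\<integral>x. X x * X x \<partial>M" and ?b = "\<integral>x. Y x * Y x \<partial>M" and ?c = "\<integral>x. X x * Y x \<partial>M"
  have "(\<lambda>x. 12 * (X x * X x * (Y x * Y x))) = (\<lambda>x. P x * P x * (P x * P x) + Q x * Q x * (Q x * Q x)
      - 2 * (X x * X x * (X x * X x)) - 2 * (Y x * Y x * (Y x * Y x)))"
    by (auto simp: P_def Q_def fun_eq_iff algebra_simps)
  then have "(\<integral>x. 12 * (X x * X x * (Y x * Y x)) \<partial>M) = (\<integral>x. P x * P x * (P x * P x) + Q x * Q x * (Q x * Q x)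
      - 2 * (X x * X x * (X x * X x)) - 2 * (Y x * Y x * (Y x * Y x)) \<partial>M)" by simp
  also have "\<dots> = 3 * (\<integral>x. P x * P x \<partial>M)\<^sup>2 + 3 * (\<integral>x. Q x * Q x \<partial>M)\<^sup>2 - 2 * (3 * ?a\<^sup>2) - 2 * (3 * ?b\<^sup>2)"
    using i4[OF PQ(1) PQ(1) PQ(1) PQ(1)] i4[OF PQ(2) PQ(2) PQ(2) PQ(2)] i4[OF X X X X] i4[OF Y Y Y Y]
    by (simp add: gaussian_space_fourth_moment X Y PQ)
  also have "(\<integral>x. P x * P x \<partial>M) = ?a + 2 * ?c + ?b"
  proof -
    have "(\<integral>x. P x * P x \<partial>M) = (\<integral>x. X x * X x + 2 * (X x * Y x) + Y x * Y x \<partial>M)"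
      by (rule Bochner_Integration.integral_cong) (auto simp: P_def algebra_simps)
    then show ?thesis using i2[OF X X] i2[OF X Y] i2[OF Y Y] by simp
  qed
  also have "(\<integral>x. Q x * Q x \<partial>M) = ?a - 2 * ?c + ?b"
  proof -
    have "(\<integral>x. Q x * Q x \<partial>M) = (\<integral>x. X x * X x - 2 * (X x * Y x) + Y x * Y x \<partial>M)"
      by (rule Bochner_Integration.integral_cong) (auto simp: Q_def algebra_simps)
    then show ?thesis using i2[OF X X] i2[OF X Y] i2[OF Y Y] by simp
  qed
  finally show ?thesis unfolding integral_mult_right_zero by (simp add: power2_eq_square algebra_simps)
qed

text \<open>Polarises the first square through 4XZ = (X+Z)^2 - (X-Z)^2.\<close>

lemma isserlis_square_product:
  assumes X: "X \<in> G" and Z: "Z \<in> G" and Y: "Y \<in> G"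
  shows "(\<integral>x. X x * Z x * (Y x * Y x) \<partial>M) =
    (\<integral>x. X x * Z x \<partial>M) * (\<integral>x. Y x * Y x \<partial>M) + 2 * (\<integral>x. X x * Y x \<partial>M) * (\<integral>x. Z x * Y x \<partial>M)"
proof -
  note i2 = gaussian_space_integrable_product and i4 = gaussian_space_integrable_product4
  define P where "P = (\<lambda>x. X x + Z x)" define Q where "Q = (\<lambda>x. X x - Z x)"
  have PQ: "P \<in> G" "Q \<in> G" unfolding P_def Q_def using X Z gaussian_space_add gaussian_space_diff by auto
  have e: "4 * (\<integral>x. X x * Z x * (Y x * Y x) \<partial>M) = (\<integral>x. P x * P x * (Y x * Y x) \<partial>M) - (\<integral>x. Q x * Q x * (Y x * Y x) \<partial>M)"
  proof -
    have "(\<integral>x. 4 * (X x * Z x * (Y x * Y x)) \<partial>M) = (\<integral>x. P x * P x * (Y x * Y x) - Q x * Q x * (Y x * Y x) \<partial>M)"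
      by (rule Bochner_Integration.integral_cong) (auto simp: P_def Q_def algebra_simps)
    then show ?thesis using i4[OF PQ(1) PQ(1) Y Y] i4[OF PQ(2) PQ(2) Y Y] by simp
  qed
  have PP: "(\<integral>x. P x * P x \<partial>M) - (\<integral>x. Q x * Q x \<partial>M) = 4 * (\<integral>x. X x * Z x \<partial>M)"
  proof -
    have "(\<integral>x. P x * P x - Q x * Q x \<partial>M) = (\<integral>x. 4 * (X x * Z x) \<partial>M)"
      by (rule Bochner_Integration.integral_cong) (auto simp: P_def Q_def algebra_simps)
    then show ?thesis using i2 PQ by simp
  qed
  have PY: "(\<integral>x. P x * Y x \<partial>M) = (\<integral>x. X x * Y x \<partial>M) + (\<integral>x. Z x * Y x \<partial>M)"
    "(\<integral>x. Q x * Y x \<partial>M) = (\<integral>x. X x * Y x \<partial>M) - (\<integral>x. Z x * Y x \<partial>M)"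
    using i2[OF X Y] i2[OF Z Y] by (simp_all add: P_def Q_def distrib_right left_diff_distrib)
  have "4 * (\<integral>x. X x * Z x * (Y x * Y x) \<partial>M) = ((\<integral>x. P x * P x \<partial>M) - (\<integral>x. Q x * Q x \<partial>M)) * (\<integral>x. Y x * Y x \<partial>M)
     + 2 * ((\<integral>x. P x * Y x \<partial>M)\<^sup>2 - (\<integral>x. Q x * Y x \<partial>M)\<^sup>2)"
    unfolding e isserlis_squares[OF PQ(1) Y] isserlis_squares[OF PQ(2) Y] by (simp add: algebra_simps)
  then show ?thesis unfolding PP PY by (simp add: power2_eq_square algebra_simps)
qed

text \<open>Polarises the remaining square in the same way, giving one term for each of the three
  pairings.\<close>

lemma isserlis:
  assumes X: "X \<in> G" and Z: "Z \<in> G" and Y: "Y \<in> G" and W: "W \<in> G"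
  shows "(\<integral>x. X x * Z x * (Y x * W x) \<partial>M) =
    (\<integral>x. X x * Z x \<partial>M) * (\<integral>x. Y x * W x \<partial>M) + (\<integral>x. X x * Y x \<partial>M) * (\<integral>x. Z x * W x \<partial>M)
      + (\<integral>x. X x * W x \<partial>M) * (\<integral>x. Z x * Y x \<partial>M)"
proof -
  note i2 = gaussian_space_integrable_product and i4 = gaussian_space_integrable_product4
  define P where "P = (\<lambda>x. Y x + W x)" define Q where "Q = (\<lambda>x. Y x - W x)"
  have PQ: "P \<in> G" "Q \<in> G" unfolding P_def Q_def using Y W gaussian_space_add gaussian_space_diff by auto
  have e: "4 * (\<integral>x. X x * Z x * (Y x * W x) \<partial>M) = (\<integral>x. X x * Z x * (P x * P x) \<partial>M) - (\<integral>x. X x * Z x * (Q x * Q x) \<partial>M)"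
  proof -
    have "(\<integral>x. 4 * (X x * Z x * (Y x * W x)) \<partial>M) = (\<integral>x. X x * Z x * (P x * P x) - X x * Z x * (Q x * Q x) \<partial>M)"
      by (rule Bochner_Integration.integral_cong) (auto simp: P_def Q_def algebra_simps)
    then show ?thesis using i4[OF X Z PQ(1) PQ(1)] i4[OF X Z PQ(2) PQ(2)] by simp
  qed
  have PP: "(\<integral>x. P x * P x \<partial>M) - (\<integral>x. Q x * Q x \<partial>M) = 4 * (\<integral>x. Y x * W x \<partial>M)"
  proof -
    have "(\<integral>x. P x * P x - Q x * Q x \<partial>M) = (\<integral>x. 4 * (Y x * W x) \<partial>M)"
      by (rule Bochner_Integration.integral_cong) (auto simp: P_def Q_def algebra_simps)
    then show ?thesis using i2 PQ by simp
  qed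
  have l: "(\<integral>x. V x * P x \<partial>M) = (\<integral>x. V x * Y x \<partial>M) + (\<integral>x. V x * W x \<partial>M)"
    "(\<integral>x. V x * Q x \<partial>M) = (\<integral>x. V x * Y x \<partial>M) - (\<integral>x. V x * W x \<partial>M)" if "V \<in> G" for V
    using i2[OF that Y] i2[OF that W] by (simp_all add: P_def Q_def distrib_left right_diff_distrib)
  have "4 * (\<integral>x. X x * Z x * (Y x * W x) \<partial>M) = (\<integral>x. X x * Z x \<partial>M) * ((\<integral>x. P x * P x \<partial>M) - (\<integral>x. Q x * Q x \<partial>M))
     + 2 * ((\<integral>x. X x * P x \<partial>M) * (\<integral>x. Z x * P x \<partial>M) - (\<integral>x. X x * Q x \<partial>M) * (\<integral>x. Z x * Q x \<partial>M))"
    unfolding e isserlis_square_product[OF X Z PQ(1)] isserlis_square_product[OF X Z PQ(2)] by (simp add: algebra_simps)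
  then show ?thesis unfolding PP l[OF X] l[OF Z] by (simp add: algebra_simps)
qed

end

section \<open>L1 bounds for linear and quadratic forms in Gaussian variables\<close>

lemma expectation_abs_le_sqrt:
  fixes Z :: "'a \<Rightarrow> real"
  assumes [measurable]: "Z \<in> borel_measurable M" and "integrable M (\<lambda>x. (Z x)\<^sup>2)"
  shows "(\<integral>x. \<bar>Z x\<bar> \<partial>M) \<le> sqrt (\<integral>x. (Z x)\<^sup>2 \<partial>M)"
proof -
  have i: "integrable M (\<lambda>x. \<bar>Z x\<bar>)"
  proof (rule Bochner_Integration.integrable_bound)
    show "integrable M (\<lambda>x. 1 + (Z x)\<^sup>2)" using assms by auto
    have "\<bar>a\<bar> \<le> 1 + a\<^sup>2" for a :: real
      using sum_squares_bound[of 1 "\<bar>a\<bar>"] by simp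
    then show "AE x in M. norm \<bar>Z x\<bar> \<le> norm (1 + (Z x)\<^sup>2)" by (intro AE_I2) (simp add: abs_of_nonneg)
  qed measurable
  have "0 \<le> variance (\<lambda>x. \<bar>Z x\<bar>)" by (rule variance_positive)
  also have "\<dots> = (\<integral>x. (Z x)\<^sup>2 \<partial>M) - (\<integral>x. \<bar>Z x\<bar> \<partial>M)\<^sup>2"
    using variance_eq[OF i] assms by simp
  finally show ?thesis by (intro real_le_rsqrt) simp
qed

end

text \<open>The indices i, j, l, k run around a four-cycle. For two opposite edges the product is
  bounded by half the sum of squares; the other two edges are then summed out one index at a time,
  each costing a row sum \<open>S\<close>. Both halves agree after relabelling.\<close>

lemma sum_four_cycle_le:
  fixes R :: "nat \<Rightarrow> nat \<Rightarrow> real"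
  assumes sym: "\<And>i j. R i j = R j i" and S: "\<And>i. i < n \<Longrightarrow> (\<Sum>j<n. \<bar>R i j\<bar>) \<le> S" and S0: "0 \<le> S"
  shows "(\<Sum>i<n. \<Sum>j<n. \<Sum>k<n. \<Sum>l<n. R i j * R k l * (R i k * R j l)) \<le> S\<^sup>2 * (\<Sum>i<n. \<Sum>j<n. (R i j)\<^sup>2)"
proof -
  have fac: "(\<Sum>k<n. \<Sum>l<n. c * (f k * g l)) = c * ((\<Sum>k<n. f k) * (\<Sum>l<n. g l))" for c :: real and f g
    by (simp only: sum_product) (simp only: sum_distrib_left)
  have 1: "(\<Sum>i<n. \<Sum>j<n. \<Sum>k<n. \<Sum>l<n. (R i j)\<^sup>2 * (\<bar>R i k\<bar> * \<bar>R j l\<bar>)) \<le> S\<^sup>2 * (\<Sum>i<n. \<Sum>j<n. (R i j)\<^sup>2)"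
  proof -
    have "(\<Sum>i<n. \<Sum>j<n. \<Sum>k<n. \<Sum>l<n. (R i j)\<^sup>2 * (\<bar>R i k\<bar> * \<bar>R j l\<bar>)) =
        (\<Sum>i<n. \<Sum>j<n. (R i j)\<^sup>2 * ((\<Sum>k<n. \<bar>R i k\<bar>) * (\<Sum>l<n. \<bar>R j l\<bar>)))"
      by (simp only: fac)
    also have "\<dots> \<le> (\<Sum>i<n. \<Sum>j<n. (R i j)\<^sup>2 * (S * S))"
      by (intro sum_mono mult_left_mono mult_mono S) (auto intro!: sum_nonneg S0)
    finally show ?thesis by (simp add: sum_distrib_left sum_distrib_right power2_eq_square mult.commute)
  qed
  have 2: "(\<Sum>i<n. \<Sum>j<n. \<Sum>k<n. \<Sum>l<n. (R k l)\<^sup>2 * (\<bar>R i k\<bar> * \<bar>R j l\<bar>)) =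
      (\<Sum>i<n. \<Sum>j<n. \<Sum>k<n. \<Sum>l<n. (R i j)\<^sup>2 * (\<bar>R i k\<bar> * \<bar>R j l\<bar>))"
  proof -
    have "(\<Sum>i<n. \<Sum>j<n. \<Sum>k<n. \<Sum>l<n. (R k l)\<^sup>2 * (\<bar>R i k\<bar> * \<bar>R j l\<bar>)) =
      (\<Sum>k<n. \<Sum>l<n. (R k l)\<^sup>2 * ((\<Sum>i<n. \<bar>R i k\<bar>) * (\<Sum>j<n. \<bar>R j l\<bar>)))"
    proof -
      have "(\<Sum>i<n. \<Sum>j<n. \<Sum>k<n. \<Sum>l<n. (R k l)\<^sup>2 * (\<bar>R i k\<bar> * \<bar>R j l\<bar>)) =
          (\<Sum>i<n. \<Sum>k<n. \<Sum>j<n. \<Sum>l<n. (R k l)\<^sup>2 * (\<bar>R i k\<bar> * \<bar>R j l\<bar>))"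
        by (rule sum.cong[OF refl], rule sum.swap)
      also have "\<dots> = (\<Sum>k<n. \<Sum>i<n. \<Sum>j<n. \<Sum>l<n. (R k l)\<^sup>2 * (\<bar>R i k\<bar> * \<bar>R j l\<bar>))"
        by (rule sum.swap)
      also have "\<dots> = (\<Sum>k<n. \<Sum>i<n. \<Sum>l<n. \<Sum>j<n. (R k l)\<^sup>2 * (\<bar>R i k\<bar> * \<bar>R j l\<bar>))"
        by (rule sum.cong[OF refl], rule sum.cong[OF refl], rule sum.swap)
      also have "\<dots> = (\<Sum>k<n. \<Sum>l<n. \<Sum>i<n. \<Sum>j<n. (R k l)\<^sup>2 * (\<bar>R i k\<bar> * \<bar>R j l\<bar>))"
        by (rule sum.cong[OF refl], rule sum.swap)
      finally show ?thesis by (simp only: fac)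
    qed
    also have "\<dots> = (\<Sum>i<n. \<Sum>j<n. (R i j)\<^sup>2 * ((\<Sum>k<n. \<bar>R i k\<bar>) * (\<Sum>l<n. \<bar>R j l\<bar>)))"
      by (simp add: sym)
    finally show ?thesis by (simp only: fac)
  qed
  have "R i j * R k l * (R i k * R j l) \<le> 1/2 * ((R i j)\<^sup>2 * (\<bar>R i k\<bar> * \<bar>R j l\<bar>)) + 1/2 * ((R k l)\<^sup>2 * (\<bar>R i k\<bar> * \<bar>R j l\<bar>))" for i j k l
  proof -
    have "R i j * R k l * (R i k * R j l) \<le> \<bar>R i j * R k l\<bar> * (\<bar>R i k\<bar> * \<bar>R j l\<bar>)"
      by (metis abs_ge_self abs_mult)
    also have "\<dots> \<le> (((R i j)\<^sup>2 + (R k l)\<^sup>2) / 2) * (\<bar>R i k\<bar> * \<bar>R j l\<bar>)"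
      using sum_squares_bound[of "\<bar>R i j\<bar>" "\<bar>R k l\<bar>"] by (intro mult_right_mono) (auto simp: abs_mult)
    finally show ?thesis by (simp add: field_simps)
  qed
  then have "(\<Sum>i<n. \<Sum>j<n. \<Sum>k<n. \<Sum>l<n. R i j * R k l * (R i k * R j l)) \<le>
     (\<Sum>i<n. \<Sum>j<n. \<Sum>k<n. \<Sum>l<n. 1/2 * ((R i j)\<^sup>2 * (\<bar>R i k\<bar> * \<bar>R j l\<bar>)) + 1/2 * ((R k l)\<^sup>2 * (\<bar>R i k\<bar> * \<bar>R j l\<bar>)))"
    by (intro sum_mono)
  also have "\<dots> = 1/2 * (\<Sum>i<n. \<Sum>j<n. \<Sum>k<n. \<Sum>l<n. (R i j)\<^sup>2 * (\<bar>R i k\<bar> * \<bar>R j l\<bar>)) +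
     1/2 * (\<Sum>i<n. \<Sum>j<n. \<Sum>k<n. \<Sum>l<n. (R k l)\<^sup>2 * (\<bar>R i k\<bar> * \<bar>R j l\<bar>))"
    by (simp only: sum.distrib sum_distrib_left)
  finally show ?thesis using 1 unfolding 2 by simp
qed

text \<open>Turns an L1 estimate of the conditional variance into one of the characteristic
  function. The constant 1/2 is the Lipschitz constant on the nonnegative half-line.\<close>

lemma abs_exp_diff_le:
  fixes a b :: real
  assumes "0 \<le> a" "0 \<le> b"
  shows "\<bar>exp (- a / 2) - exp (- b / 2)\<bar> \<le> \<bar>a - b\<bar> / 2"
proof -
  have *: "exp (- x / 2) - exp (- y / 2) \<le> (y - x) / 2" if "0 \<le> x" "x \<le> y" for x y :: real
  proof -
    have "exp (- x / 2) - exp (- y / 2) = exp (- x / 2) * (1 - exp (- (y - x) / 2))"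
      by (simp add: right_diff_distrib exp_add[symmetric] field_simps)
    also have "\<dots> \<le> 1 * ((y - x) / 2)"
    proof (rule mult_mono)
      show "1 - exp (- (y - x) / 2) \<le> (y - x) / 2"
        using exp_ge_add_one_self[of "- (y - x) / 2"] by (simp add: field_simps)
    qed (use that in auto)
    finally show ?thesis by simp
  qed
  show ?thesis
  proof (cases "a \<le> b")
    case True
    then have "exp (- b / 2) \<le> exp (- a / 2)" by simp
    then show ?thesis using *[OF assms(1) True] True by simp
  next
    case False
    then have "b \<le> a" "exp (- a / 2) \<le> exp (- b / 2)" by simp_all
    then show ?thesis using *[OF assms(2) \<open>b \<le> a\<close>] by simp
  qed
qed

context prob_space
begin

lemma gaussian_variance_expand:
  fixes n :: nat
  assumes G: "gaussian_space M G" and C: "C \<in> G" and D: "\<And>i. i < n \<Longrightarrow> D i \<in> G"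
  shows "(\<integral>x. (C x + (\<Sum>i<n. a i * D i x)) * (C x + (\<Sum>i<n. a i * D i x)) \<partial>M) =
    (\<integral>x. C x * C x \<partial>M) + 2 * (\<Sum>i<n. a i * (\<integral>x. C x * D i x \<partial>M)) +
    (\<Sum>i<n. \<Sum>j<n. a i * a j * (\<integral>x. D i x * D j x \<partial>M))"
proof -
  note i2 = gaussian_space_integrable_product[OF G]
  have iCD: "integrable M (\<lambda>x. \<Sum>i<n. a i * (C x * D i x))"
    by (intro Bochner_Integration.integrable_sum integrable_mult_right i2 C D) simp
  have iDD: "integrable M (\<lambda>x. \<Sum>i<n. \<Sum>j<n. a i * a j * (D i x * D j x))"
    by (intro Bochner_Integration.integrable_sum integrable_mult_right i2 C D) simp_all
  have "(\<integral>x. (C x + (\<Sum>i<n. a i * D i x)) * (C x + (\<Sum>i<n. a i * D i x)) \<partial>M) =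
    (\<integral>x. C x * C x + 2 * (\<Sum>i<n. a i * (C x * D i x)) + (\<Sum>i<n. \<Sum>j<n. a i * a j * (D i x * D j x)) \<partial>M)"
  proof (rule Bochner_Integration.integral_cong[OF refl])
    fix x
    let ?s = "\<Sum>i<n. a i * D i x"
    have "C x * ?s = (\<Sum>i<n. a i * (C x * D i x))" by (simp add: sum_distrib_left mult_ac)
    moreover have "?s * ?s = (\<Sum>i<n. \<Sum>j<n. a i * a j * (D i x * D j x))"
      by (simp only: sum_product) (simp add: mult_ac)
    moreover have "(C x + ?s) * (C x + ?s) = C x * C x + 2 * (C x * ?s) + ?s * ?s" by (simp add: algebra_simps)
    ultimately show "(C x + ?s) * (C x + ?s) = C x * C x + 2 * (\<Sum>i<n. a i * (C x * D i x)) +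
       (\<Sum>i<n. \<Sum>j<n. a i * a j * (D i x * D j x))" by simp
  qed
  also have "\<dots> = (\<integral>x. C x * C x \<partial>M) + 2 * (\<integral>x. (\<Sum>i<n. a i * (C x * D i x)) \<partial>M) +
     (\<integral>x. (\<Sum>i<n. \<Sum>j<n. a i * a j * (D i x * D j x)) \<partial>M)"
    using i2[OF C C] iCD iDD by simp
  also have "(\<integral>x. (\<Sum>i<n. a i * (C x * D i x)) \<partial>M) = (\<Sum>i<n. a i * (\<integral>x. C x * D i x \<partial>M))"
    by (subst Bochner_Integration.integral_sum) (auto intro!: integrable_mult_right i2 C D)
  also have "(\<integral>x. (\<Sum>i<n. \<Sum>j<n. a i * a j * (D i x * D j x)) \<partial>M) = (\<Sum>i<n. \<Sum>j<n. a i * a j * (\<integral>x. D i x * D j x \<partial>M))"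
  proof -
    have "(\<integral>x. (\<Sum>i<n. \<Sum>j<n. a i * a j * (D i x * D j x)) \<partial>M) = (\<Sum>i<n. \<integral>x. (\<Sum>j<n. a i * a j * (D i x * D j x)) \<partial>M)"
      by (rule Bochner_Integration.integral_sum) (intro Bochner_Integration.integrable_sum integrable_mult_right i2 C D; simp)
    also have "\<dots> = (\<Sum>i<n. \<Sum>j<n. \<integral>x. a i * a j * (D i x * D j x) \<partial>M)"
      by (rule sum.cong[OF refl], rule Bochner_Integration.integral_sum) (intro integrable_mult_right i2 C D; simp)
    finally show ?thesis by simp
  qed
  finally show ?thesis .
qed

text \<open>The second moment of the linear form is a double sum of covariances, at most
  \<open>a\<^sup>2\<close> times \<open>n\<close> row sums. The lemma controls the cross term
  between the functional of the second process and the bilinear form.\<close>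

lemma gaussian_linear_abs_le:
  assumes G: "gaussian_space M G" and D: "\<And>i. i < n \<Longrightarrow> D i \<in> G"
    and A: "\<And>i. i < n \<Longrightarrow> \<bar>A i\<bar> \<le> a" and S: "\<And>i. i < n \<Longrightarrow> (\<Sum>j<n. \<bar>\<integral>x. D i x * D j x \<partial>M\<bar>) \<le> S"
    and a0: "0 \<le> a"
  shows "(\<integral>x. \<bar>\<Sum>i<n. A i * D i x\<bar> \<partial>M) \<le> a * sqrt (real n * S)"
proof -
  define R where "R i j = (\<integral>x. D i x * D j x \<partial>M)" for i j
  define Z where "Z x = (\<Sum>i<n. A i * D i x)" for x
  have Z: "Z \<in> G" unfolding Z_def by (rule gaussian_space_sum[OF G]) (use D in auto)
  have "(\<integral>x. \<bar>Z x\<bar> \<partial>M) \<le> sqrt (\<integral>x. (Z x)\<^sup>2 \<partial>M)"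
    using gaussian_space_measurable[OF G Z] gaussian_space_integrable_product[OF G Z Z]
    by (intro expectation_abs_le_sqrt) (auto simp: power2_eq_square)
  also have "(\<integral>x. (Z x)\<^sup>2 \<partial>M) = (\<Sum>i<n. \<Sum>j<n. A i * A j * R i j)"
    using gaussian_variance_expand[OF G gaussian_space_zero[OF G], of n D A] D
    by (simp add: Z_def power2_eq_square R_def)
  also have "sqrt \<dots> \<le> sqrt (a\<^sup>2 * (real n * S))"
  proof (rule real_sqrt_le_mono)
    have "(\<Sum>i<n. \<Sum>j<n. A i * A j * R i j) \<le> (\<Sum>i<n. \<Sum>j<n. a\<^sup>2 * \<bar>R i j\<bar>)"
    proof (intro sum_mono)
      fix i j assume ij: "i \<in> {..<n}" "j \<in> {..<n}"
      have "A i * A j * R i j \<le> \<bar>A i\<bar> * \<bar>A j\<bar> * \<bar>R i j\<bar>" by (metis abs_ge_self abs_mult)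
      also have "\<dots> \<le> a * a * \<bar>R i j\<bar>" using A ij a0 by (intro mult_right_mono mult_mono) auto
      finally show "A i * A j * R i j \<le> a\<^sup>2 * \<bar>R i j\<bar>" by (simp add: power2_eq_square)
    qed
    also have "\<dots> = a\<^sup>2 * (\<Sum>i<n. \<Sum>j<n. \<bar>R i j\<bar>)" by (simp add: sum_distrib_left)
    also have "\<dots> \<le> a\<^sup>2 * (\<Sum>i<n. S)" using S by (intro mult_left_mono sum_mono) (auto simp: R_def)
    finally show "(\<Sum>i<n. \<Sum>j<n. A i * A j * R i j) \<le> a\<^sup>2 * (real n * S)" by simp
  qed
  also have "\<dots> = a * sqrt (real n * S)" using a0 by (simp add: real_sqrt_mult)
  finally show ?thesis unfolding Z_def .
qed

text \<open>The coefficients of the quadratic form are its own covariances, since both processes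
  have the same law. Hence the mean is the sum of squares of \<open>R\<close>, and the variance
  consists of four-cycle sums.\<close>

lemma gaussian_quadratic_abs_le:
  fixes n :: nat
  assumes G: "gaussian_space M G" and D: "\<And>i. i < n \<Longrightarrow> D i \<in> G"
    and R: "\<And>i j. R i j = (\<integral>x. D i x * D j x \<partial>M)"
    and S: "\<And>i. i < n \<Longrightarrow> (\<Sum>j<n. \<bar>R i j\<bar>) \<le> S" and S0: "0 \<le> S"
  shows "integrable M (\<lambda>x. \<Sum>i<n. \<Sum>j<n. D i x * D j x * R i j)"
    and "(\<integral>x. \<bar>(\<Sum>i<n. \<Sum>j<n. D i x * D j x * R i j) - (\<Sum>i<n. \<Sum>j<n. (R i j)\<^sup>2)\<bar> \<partial>M) \<le>
      sqrt (2 * S\<^sup>2 * (\<Sum>i<n. \<Sum>j<n. (R i j)\<^sup>2))"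
proof -
  note i2 = gaussian_space_integrable_product[OF G] and i4 = gaussian_space_integrable_product4[OF G]
  define W where "W x = (\<Sum>i<n. \<Sum>j<n. D i x * D j x * R i j)" for x
  define q where "q = (\<Sum>i<n. \<Sum>j<n. (R i j)\<^sup>2)"
  have sym: "R i j = R j i" for i j by (simp add: R mult.commute)
  show iW: "integrable M W"
    unfolding W_def by (intro Bochner_Integration.integrable_sum integrable_mult_left i2 D; simp)
  have EW: "(\<integral>x. W x \<partial>M) = q"
  proof -
    have "(\<integral>x. W x \<partial>M) = (\<Sum>i<n. \<integral>x. (\<Sum>j<n. D i x * D j x * R i j) \<partial>M)"
      unfolding W_def by (rule Bochner_Integration.integral_sum) (intro Bochner_Integration.integrable_sum integrable_mult_left i2 D; simp)
    also have "\<dots> = (\<Sum>i<n. \<Sum>j<n. \<integral>x. D i x * D j x * R i j \<partial>M)"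
      by (rule sum.cong[OF refl], rule Bochner_Integration.integral_sum) (intro integrable_mult_left i2 D; simp)
    finally show ?thesis by (simp add: q_def power2_eq_square R[symmetric])
  qed
  have WW: "W x * W x = (\<Sum>i<n. \<Sum>j<n. \<Sum>k<n. \<Sum>l<n. R i j * R k l * (D i x * D j x * (D k x * D l x)))" for x
    unfolding W_def sum_distrib_right sum_distrib_left
    by (intro sum.cong refl) (simp add: mult_ac)
  have i4': "integrable M (\<lambda>x. R i j * R k l * (D i x * D j x * (D k x * D l x)))" if "i<n" "j<n" "k<n" "l<n" for i j k l
    using that by (intro integrable_mult_right i4 D)
  have iWW: "integrable M (\<lambda>x. W x * W x)"
    unfolding WW by (intro Bochner_Integration.integrable_sum i4'; simp)
  have EWW: "(\<integral>x. W x * W x \<partial>M) = (\<Sum>i<n. \<Sum>j<n. \<Sum>k<n. \<Sum>l<n. R i j * R k l * (R i j * R k l + R i k * R j l + R i l * R j k))"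
  proof -
    have "(\<integral>x. W x * W x \<partial>M) = (\<Sum>i<n. \<integral>x. (\<Sum>j<n. \<Sum>k<n. \<Sum>l<n. R i j * R k l * (D i x * D j x * (D k x * D l x))) \<partial>M)"
      unfolding WW by (rule Bochner_Integration.integral_sum) (intro Bochner_Integration.integrable_sum i4'; simp)
    also have "\<dots> = (\<Sum>i<n. \<Sum>j<n. \<integral>x. (\<Sum>k<n. \<Sum>l<n. R i j * R k l * (D i x * D j x * (D k x * D l x))) \<partial>M)"
      by (rule sum.cong[OF refl], rule Bochner_Integration.integral_sum) (intro Bochner_Integration.integrable_sum i4'; simp)
    also have "\<dots> = (\<Sum>i<n. \<Sum>j<n. \<Sum>k<n. \<integral>x. (\<Sum>l<n. R i j * R k l * (D i x * D j x * (D k x * D l x))) \<partial>M)"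
      by (rule sum.cong[OF refl], rule sum.cong[OF refl], rule Bochner_Integration.integral_sum) (intro Bochner_Integration.integrable_sum i4'; simp)
    also have "\<dots> = (\<Sum>i<n. \<Sum>j<n. \<Sum>k<n. \<Sum>l<n. \<integral>x. R i j * R k l * (D i x * D j x * (D k x * D l x)) \<partial>M)"
      by (rule sum.cong[OF refl], rule sum.cong[OF refl], rule sum.cong[OF refl], rule Bochner_Integration.integral_sum) (intro i4'; simp)
    also have "\<dots> = (\<Sum>i<n. \<Sum>j<n. \<Sum>k<n. \<Sum>l<n. R i j * R k l * (R i j * R k l + R i k * R j l + R i l * R j k))"
    proof (intro sum.cong refl)
      fix i j k l assume "i \<in> {..<n}" "j \<in> {..<n}" "k \<in> {..<n}" "l \<in> {..<n}"
      then show "(\<integral>x. R i j * R k l * (D i x * D j x * (D k x * D l x)) \<partial>M) = R i j * R k l * (R i j * R k l + R i k * R j l + R i l * R j k)"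
        unfolding integral_mult_right_zero by (subst isserlis[OF G]) (auto simp: D R)
    qed
    finally show ?thesis .
  qed
  \<comment> \<open>The pairing that matches each factor of the product with itself reproduces the
    squared mean and cancels in the variance.\<close>
  have q2: "q * q = (\<Sum>i<n. \<Sum>j<n. \<Sum>k<n. \<Sum>l<n. R i j * R k l * (R i j * R k l))"
    unfolding q_def sum_distrib_right sum_distrib_left
    by (intro sum.cong refl) (simp add: power2_eq_square mult_ac)
  define c where "c = (\<Sum>i<n. \<Sum>j<n. \<Sum>k<n. \<Sum>l<n. R i j * R k l * (R i k * R j l))"
  \<comment> \<open>The two crossed pairings differ by exchanging k and l, so they contribute
    equally; this is the factor 2 in the variance.\<close>
  have c': "(\<Sum>i<n. \<Sum>j<n. \<Sum>k<n. \<Sum>l<n. R i j * R k l * (R i l * R j k)) = c"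
  proof -
    have "(\<Sum>i<n. \<Sum>j<n. \<Sum>k<n. \<Sum>l<n. R i j * R k l * (R i l * R j k)) =
      (\<Sum>i<n. \<Sum>j<n. \<Sum>l<n. \<Sum>k<n. R i j * R k l * (R i l * R j k))"
      by (rule sum.cong[OF refl], rule sum.cong[OF refl], rule sum.swap)
    also have "\<dots> = c" unfolding c_def by (intro sum.cong refl) (simp add: sym)
    finally show ?thesis .
  qed
  have "(\<integral>x. W x * W x \<partial>M) = q * q + c + c"
    unfolding EWW distrib_left sum.distrib c' unfolding q2 c_def ..
  then have var: "(\<integral>x. (W x - q)\<^sup>2 \<partial>M) = 2 * c"
    using variance_eq[OF iW] iWW EW by (simp add: power2_eq_square)
  have cS: "c \<le> S\<^sup>2 * q" unfolding c_def q_def by (rule sum_four_cycle_le[OF sym S S0])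
  have "(\<integral>x. \<bar>W x - q\<bar> \<partial>M) \<le> sqrt (\<integral>x. (W x - q)\<^sup>2 \<partial>M)"
  proof (rule expectation_abs_le_sqrt)
    show "(\<lambda>x. W x - q) \<in> borel_measurable M" using iW by auto
    have "integrable M (\<lambda>x. W x * W x - 2 * q * W x + q * q)" using iW iWW by auto
    then show "integrable M (\<lambda>x. (W x - q)\<^sup>2)" by (simp add: power2_eq_square algebra_simps)
  qed
  also have "\<dots> \<le> sqrt (2 * S\<^sup>2 * q)" unfolding var using cS by (intro real_sqrt_le_mono) simp
  finally show "(\<integral>x. \<bar>(\<Sum>i<n. \<Sum>j<n. D i x * D j x * R i j) - (\<Sum>i<n. \<Sum>j<n. (R i j)\<^sup>2)\<bar> \<partial>M) \<le>
      sqrt (2 * S\<^sup>2 * (\<Sum>i<n. \<Sum>j<n. (R i j)\<^sup>2))"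
    unfolding W_def q_def .
qed

text \<open>The three error terms are the cross covariance with \<open>C\<close>, the fluctuation of
  the quadratic form, and the distance of its mean from \<open>v\<close>. Independence enters only
  through \<open>decouple\<close>, which permits integrating the second variable first, where the
  exponent is Gaussian.\<close>

lemma gaussian_bilinear_estimate:
  fixes \<kappa> v :: real
  assumes G1: "gaussian_space M G1" and G2: "gaussian_space M G2"
    and U: "U \<in> G1" and C: "C \<in> G2" and D: "\<And>i. i < n \<Longrightarrow> D i \<in> G1" and D': "\<And>i. i < n \<Longrightarrow> D' i \<in> G2"
    and R: "\<And>i j. R i j = (\<integral>x. D i x * D j x \<partial>M)" and R': "\<And>i j. i < n \<Longrightarrow> j < n \<Longrightarrow> R i j = (\<integral>x. D' i x * D' j x \<partial>M)"
    and S: "\<And>i. i < n \<Longrightarrow> (\<Sum>j<n. \<bar>R i j\<bar>) \<le> S" and S0: "0 \<le> S"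
    and A: "\<And>i. i < n \<Longrightarrow> \<bar>\<integral>x. C x * D' i x \<partial>M\<bar> \<le> a" and a0: "0 \<le> a" and v: "0 \<le> v"
    and decouple: "(\<integral>x. iexp (U x + C x + \<kappa> * (\<Sum>i<n. D i x * D' i x)) \<partial>M) =
      (\<integral>x. (\<integral>y. iexp (U x + C y + \<kappa> * (\<Sum>i<n. D i x * D' i y)) \<partial>M) \<partial>M)"
  shows "norm ((\<integral>x. iexp (U x + C x + \<kappa> * (\<Sum>i<n. D i x * D' i x)) \<partial>M) -
      (\<integral>x. iexp (U x) \<partial>M) * (\<integral>x. iexp (C x) \<partial>M) * exp (- v / 2)) \<le>
    \<bar>\<kappa>\<bar> * a * sqrt (real n * S) + sqrt (2 * (\<kappa> * S)\<^sup>2 * (\<kappa>\<^sup>2 * (\<Sum>i<n. \<Sum>j<n. (R i j)\<^sup>2))) / 2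
      + \<bar>\<kappa>\<^sup>2 * (\<Sum>i<n. \<Sum>j<n. (R i j)\<^sup>2) - v\<bar> / 2"
proof -
  define Av where "Av i = (\<integral>x. C x * D' i x \<partial>M)" for i
  define VC where "VC = (\<integral>x. C x * C x \<partial>M)"
  define l where "l x = (\<Sum>i<n. Av i * D i x)" for x
  define W where "W x = (\<Sum>i<n. \<Sum>j<n. D i x * D j x * R i j)" for x
  define q where "q = (\<Sum>i<n. \<Sum>j<n. (R i j)\<^sup>2)"
  \<comment> \<open>\<open>Q x\<close> is the variance of the exponent given the first Gaussian space.\<close>
  define Q where "Q x = VC + 2 * \<kappa> * l x + \<kappa>\<^sup>2 * W x" for x
  have VC0: "VC \<ge> 0" unfolding VC_def by (intro integral_nonneg_AE) simp
  have q0: "0 \<le> q" unfolding q_def by (intro sum_nonneg) simp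
  have C': "(\<integral>x. iexp (C x) \<partial>M) = complex_of_real (exp (- VC / 2))"
    using centered_gaussian_char[OF gaussian_space_gaussian[OF G2 C], of 1] by (simp add: VC_def)
  have inner: "(\<integral>y. iexp (U x + C y + \<kappa> * (\<Sum>i<n. D i x * D' i y)) \<partial>M) = iexp (U x) * complex_of_real (exp (- Q x / 2))"
    and Q0: "0 \<le> Q x" for x
  proof -
    let ?E = "\<lambda>y. C y + (\<Sum>i<n. (\<kappa> * D i x) * D' i y)"
    have E: "?E \<in> G2"
      using gaussian_space_add[OF G2 C gaussian_space_sum[OF G2, of "{..<n}" D' "\<lambda>i. \<kappa> * D i x"]] D' by simp
    have "(\<integral>y. ?E y * ?E y \<partial>M) = VC + 2 * (\<Sum>i<n. (\<kappa> * D i x) * Av i) + (\<Sum>i<n. \<Sum>j<n. (\<kappa> * D i x) * (\<kappa> * D j x) * (\<integral>y. D' i y * D' j y \<partial>M))"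
      unfolding VC_def Av_def by (rule gaussian_variance_expand[OF G2 C D'])
    also have "(\<Sum>i<n. (\<kappa> * D i x) * Av i) = \<kappa> * l x"
      unfolding l_def sum_distrib_left by (intro sum.cong refl) (simp add: mult_ac)
    also have "(\<Sum>i<n. \<Sum>j<n. (\<kappa> * D i x) * (\<kappa> * D j x) * (\<integral>y. D' i y * D' j y \<partial>M)) = \<kappa>\<^sup>2 * W x"
      unfolding W_def sum_distrib_left by (intro sum.cong refl) (simp add: R'[symmetric] power2_eq_square mult_ac)
    finally have V: "(\<integral>y. ?E y * ?E y \<partial>M) = Q x" by (simp add: Q_def)
    \<comment> \<open>As a variance \<open>Q x\<close> is nonnegative, which the Lipschitz bound for
      the exponential requires.\<close>
    show "0 \<le> Q x" unfolding V[symmetric] by (intro integral_nonneg_AE) simp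
    have "(\<integral>y. iexp (U x + C y + \<kappa> * (\<Sum>i<n. D i x * D' i y)) \<partial>M) = (\<integral>y. iexp (U x) * iexp (1 * ?E y) \<partial>M)"
    proof (rule Bochner_Integration.integral_cong[OF refl])
      fix y
      have "U x + C y + \<kappa> * (\<Sum>i<n. D i x * D' i y) = U x + ?E y" by (simp add: sum_distrib_left mult_ac)
      then show "iexp (U x + C y + \<kappa> * (\<Sum>i<n. D i x * D' i y)) = iexp (U x) * iexp (1 * ?E y)"
        by (simp only: of_real_add distrib_left exp_add mult_1)
    qed
    also have "\<dots> = iexp (U x) * (\<integral>y. iexp (1 * ?E y) \<partial>M)" by (rule integral_mult_right_zero)
    also have "(\<integral>y. iexp (1 * ?E y) \<partial>M) = complex_of_real (exp (- Q x / 2))"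
      using centered_gaussian_char[OF gaussian_space_gaussian[OF G2 E], of 1] unfolding V by simp
    finally show "(\<integral>y. iexp (U x + C y + \<kappa> * (\<Sum>i<n. D i x * D' i y)) \<partial>M) = iexp (U x) * complex_of_real (exp (- Q x / 2))" .
  qed
  have [measurable]: "U \<in> borel_measurable M" by (rule gaussian_space_measurable[OF G1 U])
  have lG: "l \<in> G1" unfolding l_def by (rule gaussian_space_sum[OF G1]) (use D in auto)
  have il: "integrable M l" by (rule gaussian_space_integrable[OF G1 lG])
  have iW: "integrable M W" unfolding W_def by (rule gaussian_quadratic_abs_le(1)[OF G1 D R S S0])
  have Qm[measurable]: "Q \<in> borel_measurable M" unfolding Q_def using il iW by auto
  have i1: "integrable M (\<lambda>x. iexp (U x) * complex_of_real (exp (- Q x / 2)))"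
    by (rule integrable_const_bound[where B=1]) (use Q0 in \<open>auto simp: norm_mult\<close>)
  have i2: "integrable M (\<lambda>x. iexp (U x) * complex_of_real (exp (- (VC + v) / 2)))"
    by (rule integrable_const_bound[where B=1]) (use VC0 v in \<open>auto simp: norm_mult\<close>)
  have eq: "(\<integral>x. iexp (U x + C x + \<kappa> * (\<Sum>i<n. D i x * D' i x)) \<partial>M) - (\<integral>x. iexp (U x) \<partial>M) * (\<integral>x. iexp (C x) \<partial>M) * exp (- v / 2)
     = (\<integral>x. iexp (U x) * complex_of_real (exp (- Q x / 2)) - iexp (U x) * complex_of_real (exp (- (VC + v) / 2)) \<partial>M)"
    unfolding Bochner_Integration.integral_diff[OF i1 i2]
    unfolding decouple inner C' integral_mult_left_zero by (simp add: exp_add[symmetric] mult.assoc add_divide_distrib flip: of_real_mult)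
  have "norm ((\<integral>x. iexp (U x + C x + \<kappa> * (\<Sum>i<n. D i x * D' i x)) \<partial>M) - (\<integral>x. iexp (U x) \<partial>M) * (\<integral>x. iexp (C x) \<partial>M) * exp (- v / 2))
      \<le> (\<integral>x. \<bar>\<kappa>\<bar> * \<bar>l x\<bar> + \<kappa>\<^sup>2 / 2 * \<bar>W x - q\<bar> + \<bar>\<kappa>\<^sup>2 * q - v\<bar> / 2 \<partial>M)"
    unfolding eq
  proof (rule norm_integral_le_integral)
    show "integrable M (\<lambda>x. \<bar>\<kappa>\<bar> * \<bar>l x\<bar> + \<kappa>\<^sup>2 / 2 * \<bar>W x - q\<bar> + \<bar>\<kappa>\<^sup>2 * q - v\<bar> / 2)" using il iW by auto
    fix x
    have "norm (iexp (U x) * complex_of_real (exp (- Q x / 2)) - iexp (U x) * complex_of_real (exp (- (VC + v) / 2))) =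
        \<bar>exp (- Q x / 2) - exp (- (VC + v) / 2)\<bar>"
      unfolding right_diff_distrib[symmetric] of_real_diff[symmetric] norm_mult norm_of_real by simp
    also have "\<dots> \<le> \<bar>Q x - (VC + v)\<bar> / 2" by (rule abs_exp_diff_le) (use Q0 VC0 v in auto)
    also have "\<dots> \<le> \<bar>\<kappa>\<bar> * \<bar>l x\<bar> + \<kappa>\<^sup>2 / 2 * \<bar>W x - q\<bar> + \<bar>\<kappa>\<^sup>2 * q - v\<bar> / 2"
    proof -
      have "Q x - (VC + v) = 2 * (\<kappa> * l x) + \<kappa>\<^sup>2 * (W x - q) + (\<kappa>\<^sup>2 * q - v)" by (simp add: Q_def algebra_simps)
      then have "\<bar>Q x - (VC + v)\<bar> \<le> 2 * \<bar>\<kappa> * l x\<bar> + \<bar>\<kappa>\<^sup>2 * (W x - q)\<bar> + \<bar>\<kappa>\<^sup>2 * q - v\<bar>" by linarith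
      then have "\<bar>Q x - (VC + v)\<bar> \<le> 2 * (\<bar>\<kappa>\<bar> * \<bar>l x\<bar>) + \<kappa>\<^sup>2 * \<bar>W x - q\<bar> + \<bar>\<kappa>\<^sup>2 * q - v\<bar>"
        by (simp add: abs_mult)
      then show ?thesis by simp
    qed
    finally show "norm (iexp (U x) * complex_of_real (exp (- Q x / 2)) - iexp (U x) * complex_of_real (exp (- (VC + v) / 2))) \<le>
       \<bar>\<kappa>\<bar> * \<bar>l x\<bar> + \<kappa>\<^sup>2 / 2 * \<bar>W x - q\<bar> + \<bar>\<kappa>\<^sup>2 * q - v\<bar> / 2" .
  qed
  also have "\<dots> = \<bar>\<kappa>\<bar> * (\<integral>x. \<bar>l x\<bar> \<partial>M) + \<kappa>\<^sup>2 / 2 * (\<integral>x. \<bar>W x - q\<bar> \<partial>M) + \<bar>\<kappa>\<^sup>2 * q - v\<bar> / 2"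
  proof -
    have "integrable M (\<lambda>x. \<bar>\<kappa>\<bar> * \<bar>l x\<bar>)" "integrable M (\<lambda>x. \<kappa>\<^sup>2 / 2 * \<bar>W x - q\<bar>)" using il iW by auto
    then show ?thesis
      by (subst Bochner_Integration.integral_add, simp, simp, subst Bochner_Integration.integral_add)
        (simp_all only: integral_mult_right_zero lebesgue_integral_const prob_space scaleR_one)
  qed
  also have "\<dots> \<le> \<bar>\<kappa>\<bar> * (a * sqrt (real n * S)) + \<kappa>\<^sup>2 / 2 * sqrt (2 * S\<^sup>2 * q) + \<bar>\<kappa>\<^sup>2 * q - v\<bar> / 2"
  proof (intro add_mono mult_left_mono order_refl)
    show "(\<integral>x. \<bar>l x\<bar> \<partial>M) \<le> a * sqrt (real n * S)"
      unfolding l_def using A S a0 by (intro gaussian_linear_abs_le[OF G1 D]) (simp_all only: Av_def R)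
    show "(\<integral>x. \<bar>W x - q\<bar> \<partial>M) \<le> sqrt (2 * S\<^sup>2 * q)"
      unfolding W_def q_def by (rule gaussian_quadratic_abs_le(2)[OF G1 D R S S0])
  qed auto
  \<comment> \<open>Regrouped so that only \<open>\<kappa> * S\<close> and
    \<open>\<kappa>\<^sup>2 * q\<close> occur, the combinations whose limits are known
    later.\<close>
  also have "\<kappa>\<^sup>2 / 2 * sqrt (2 * S\<^sup>2 * q) = sqrt (2 * (\<kappa> * S)\<^sup>2 * (\<kappa>\<^sup>2 * q)) / 2"
    by (simp add: real_sqrt_mult power_mult_distrib power2_eq_square mult_ac)
  finally show ?thesis unfolding q_def by (simp add: mult.assoc)
qed

end

section \<open>Increments of fractional Brownian motion\<close>

definition process_span :: "(real \<Rightarrow> 'a \<Rightarrow> real) \<Rightarrow> ('a \<Rightarrow> real) set" where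
  "process_span B = {(\<lambda>\<omega>. \<Sum>t\<in>F. c t * B t \<omega>) | F c. finite F \<and> F \<subseteq> {0..}}"

lemma process_span_base: "0 \<le> t \<Longrightarrow> B t \<in> process_span B"
  unfolding process_span_def by (rule CollectI, rule exI[of _ "{t}"], rule exI[of _ "\<lambda>_. 1"]) auto

lemma process_span_zero: "(\<lambda>_. 0) \<in> process_span B"
  unfolding process_span_def by (rule CollectI, rule exI[of _ "{}"]) auto

lemma process_span_lincomb:
  assumes "X \<in> process_span B" "Y \<in> process_span B"
  shows "(\<lambda>x. X x + k * Y x) \<in> process_span B"
proof -
  obtain F c F' c' where X: "X = (\<lambda>\<omega>. \<Sum>t\<in>F. c t * B t \<omega>)" "finite F" "F \<subseteq> {0..}"
    and Y: "Y = (\<lambda>\<omega>. \<Sum>t\<in>F'. c' t * B t \<omega>)" "finite F'" "F' \<subseteq> {0..}"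
    using assms unfolding process_span_def by auto
  \<comment> \<open>Both representations are extended by zero coefficients to the common index
    set.\<close>
  have ext: "(\<Sum>t\<in>A. d t * B t \<omega>) = (\<Sum>t\<in>F \<union> F'. (if t \<in> A then d t else 0) * B t \<omega>)"
    if "A \<subseteq> F \<union> F'" for A d \<omega>
    using that X Y by (intro sum.mono_neutral_cong_left) auto
  have "X x + k * Y x = (\<Sum>t\<in>F \<union> F'. ((if t \<in> F then c t else 0) + k * (if t \<in> F' then c' t else 0)) * B t x)" for x
    unfolding X(1) Y(1) ext[of F c x, OF Un_upper1] ext[of F' c' x, OF Un_upper2]
    by (simp only: distrib_right sum.distrib sum_distrib_left mult.assoc)
  then show ?thesis unfolding process_span_def using X Y
    by (intro CollectI exI[of _ "F \<union> F'"] exI[of _ "\<lambda>t. (if t \<in> F then c t else 0) + k * (if t \<in> F' then c' t else 0)"]) auto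
qed

lemma gaussian_space_process_span:
  assumes "is_fbm M H B"
  shows "gaussian_space M (process_span B)"
  unfolding gaussian_space_def
proof (intro conjI ballI allI)
  fix X assume "X \<in> process_span B"
  then show "\<exists>v. centered_gaussian M X v"
    using assms unfolding process_span_def is_fbm_def by blast
qed (auto intro: process_span_zero process_span_lincomb)

lemma (in prob_space) fbm_covariance:
  assumes B: "is_fbm M H B" and s: "0 \<le> s" and t: "0 \<le> t"
  shows "(\<integral>\<omega>. B s \<omega> * B t \<omega> \<partial>M) = fbm_cov H s t"
proof -
  note G = gaussian_space_process_span[OF B]
  note i2 = gaussian_space_integrable_product[OF G process_span_base process_span_base]
  have cg: "centered_gaussian M (\<lambda>\<omega>. \<Sum>t\<in>F. c t * B t \<omega>) (\<Sum>s\<in>F. \<Sum>t\<in>F. c s * c t * fbm_cov H s t)"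
    if "finite F" "F \<subseteq> {0..}" for F c using B that unfolding is_fbm_def by blast
  have one: "(\<integral>\<omega>. B s \<omega> * B s \<omega> \<partial>M) = fbm_cov H s s" if "0 \<le> s" for s
    using centered_gaussian_moments(2)[OF cg[of "{s}" "\<lambda>_. 1"]] that by (simp add: power2_eq_square)
  show ?thesis
  proof (cases "s = t")
    case True then show ?thesis using one s by simp
  next
    case False
    have sym: "fbm_cov H t s = fbm_cov H s t" by (simp add: fbm_cov_def abs_minus_commute)
    have "(\<integral>\<omega>. (B s \<omega> + B t \<omega>)\<^sup>2 \<partial>M) = fbm_cov H s s + 2 * fbm_cov H s t + fbm_cov H t t"
      using centered_gaussian_moments(2)[OF cg[of "{s,t}" "\<lambda>_. 1"]] s t False by (simp add: sym)
    also have "(\<integral>\<omega>. (B s \<omega> + B t \<omega>)\<^sup>2 \<partial>M) = (\<integral>\<omega>. B s \<omega> * B s \<omega> + 2 * (B s \<omega> * B t \<omega>) + B t \<omega> * B t \<omega> \<partial>M)"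
      by (rule Bochner_Integration.integral_cong) (auto simp: power2_eq_square algebra_simps)
    also have "\<dots> = fbm_cov H s s + 2 * (\<integral>\<omega>. B s \<omega> * B t \<omega> \<partial>M) + fbm_cov H t t"
      using i2[OF s s] i2[OF s t] i2[OF t t] by (simp add: one s t)
    finally show ?thesis by simp
  qed
qed

lemma fbm_shifted_path_continuous:
  assumes "is_fbm M H B" "\<omega> \<in> space M" "0 \<le> \<epsilon>"
  shows "continuous_on {0..T} (\<lambda>u. B (u + \<epsilon>) \<omega>)"
proof -
  have "continuous_on {0..} (\<lambda>t. B t \<omega>)" using assms unfolding is_fbm_def by blast
  then show ?thesis by (rule continuous_on_compose2) (use assms in \<open>auto intro!: continuous_intros\<close>)
qed

lemma fbm_increment_continuous:
  assumes "is_fbm M H B" "\<omega> \<in> space M" "0 \<le> \<epsilon>"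
  shows "continuous_on {0..T} (\<lambda>u. B (u + \<epsilon>) \<omega> - B u \<omega>)"
  using fbm_shifted_path_continuous[OF assms] fbm_shifted_path_continuous[OF assms(1,2), of 0]
  by (auto intro!: continuous_on_diff)

text \<open>Half the second difference of |x|^(2H): the covariance of two increments of length
  \<open>\<epsilon>\<close> whose starting times differ by x. For \<open>\<epsilon> = 1\<close> it
  is half of what is squared in \<open>sigma_hat_sq\<close>.\<close>

definition increment_cov :: "real \<Rightarrow> real \<Rightarrow> real \<Rightarrow> real" where
  "increment_cov H \<epsilon> x = (\<bar>x + \<epsilon>\<bar> powr (2*H) + \<bar>x - \<epsilon>\<bar> powr (2*H) - 2 * \<bar>x\<bar> powr (2*H)) / 2"

lemma increment_cov_abs: "increment_cov H \<epsilon> \<bar>x\<bar> = increment_cov H \<epsilon> x"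
proof (cases "0 \<le> x")
  case False
  then have "\<bar>\<bar>x\<bar> + \<epsilon>\<bar> = \<bar>x - \<epsilon>\<bar>" "\<bar>\<bar>x\<bar> - \<epsilon>\<bar> = \<bar>x + \<epsilon>\<bar>" by (auto simp: abs_if)
  then show ?thesis by (simp add: increment_cov_def)
qed simp

lemma (in prob_space) fbm_increment_covariance:
  assumes B: "is_fbm M H B" and s: "0 \<le> s" and t: "0 \<le> t" and e: "0 \<le> \<epsilon>"
  shows "(\<integral>\<omega>. (B (s + \<epsilon>) \<omega> - B s \<omega>) * (B (t + \<epsilon>) \<omega> - B t \<omega>) \<partial>M) = increment_cov H \<epsilon> (s - t)"
proof -
  note G = gaussian_space_process_span[OF B]
  note i2 = gaussian_space_integrable_product[OF G process_span_base process_span_base]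
  have nn: "0 \<le> s + \<epsilon>" "0 \<le> t + \<epsilon>" using s t e by auto
  have "(\<integral>\<omega>. (B (s + \<epsilon>) \<omega> - B s \<omega>) * (B (t + \<epsilon>) \<omega> - B t \<omega>) \<partial>M) =
    (\<integral>\<omega>. B (s + \<epsilon>) \<omega> * B (t + \<epsilon>) \<omega> - B (s + \<epsilon>) \<omega> * B t \<omega> - B s \<omega> * B (t + \<epsilon>) \<omega> + B s \<omega> * B t \<omega> \<partial>M)"
    by (rule Bochner_Integration.integral_cong) (auto simp: algebra_simps)
  also have "\<dots> = fbm_cov H (s + \<epsilon>) (t + \<epsilon>) - fbm_cov H (s + \<epsilon>) t - fbm_cov H s (t + \<epsilon>) + fbm_cov H s t"
    using i2[OF nn(1) nn(2)] i2[OF nn(1) t] i2[OF s nn(2)] i2[OF s t]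
    by (simp add: fbm_covariance[OF B] s t nn)
  also have "\<dots> = increment_cov H \<epsilon> (s - t)"
    unfolding fbm_cov_def increment_cov_def by (simp add: algebra_simps field_simps)
  finally show ?thesis .
qed

section \<open>Decoupling two independent processes\<close>

lemma (in prob_space) indep_var_decouple:
  fixes g :: "'b \<times> 'b \<Rightarrow> complex"
  assumes indep: "indep_var S X T Y" and g[measurable]: "g \<in> borel_measurable (S \<Otimes>\<^sub>M T)"
    and bound: "\<And>z. norm (g z) \<le> K"
  shows "(\<integral>\<omega>. g (X \<omega>, Y \<omega>) \<partial>M) = (\<integral>\<omega>. (\<integral>\<omega>'. g (X \<omega>, Y \<omega>') \<partial>M) \<partial>M)"
proof -
  have X[measurable]: "X \<in> measurable M S" and Y[measurable]: "Y \<in> measurable M T"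
    and eq: "distr M S X \<Otimes>\<^sub>M distr M T Y = distr M (S \<Otimes>\<^sub>M T) (\<lambda>x. (X x, Y x))"
    using indep by (auto simp: indep_var_distribution_eq)
  interpret PX: prob_space "distr M S X" by (rule prob_space_distr) fact
  interpret PY: prob_space "distr M T Y" by (rule prob_space_distr) fact
  interpret P: pair_prob_space "distr M S X" "distr M T Y" ..
  have gm: "g \<in> borel_measurable (distr M S X \<Otimes>\<^sub>M distr M T Y)" by simp
  have gi: "integrable (distr M S X \<Otimes>\<^sub>M distr M T Y) g"
    by (rule P.integrable_const_bound[where B=K]) (use bound gm in auto)
  have "(\<integral>\<omega>. g (X \<omega>, Y \<omega>) \<partial>M) = integral\<^sup>L (distr M S X \<Otimes>\<^sub>M distr M T Y) g"
    unfolding eq by (subst integral_distr) auto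
  also have "\<dots> = (\<integral>x. (\<integral>y. g (x, y) \<partial>distr M T Y) \<partial>distr M S X)"
    by (rule P.integral_fst'[OF gi, symmetric])
  also have "\<dots> = (\<integral>\<omega>. (\<integral>y. g (X \<omega>, y) \<partial>distr M T Y) \<partial>M)"
    by (subst integral_distr) (auto intro!: PY.borel_measurable_lebesgue_integral)
  also have "\<dots> = (\<integral>\<omega>. (\<integral>\<omega>'. g (X \<omega>, Y \<omega>') \<partial>M) \<partial>M)"
  proof (rule Bochner_Integration.integral_cong[OF refl])
    fix \<omega> assume "\<omega> \<in> space M"
    then have "X \<omega> \<in> space S" by (rule measurable_space[OF X])
    then have "(\<lambda>y. g (X \<omega>, y)) \<in> borel_measurable T" using g by measurable
    then show "(\<integral>y. g (X \<omega>, y) \<partial>distr M T Y) = (\<integral>\<omega>'. g (X \<omega>, Y \<omega>') \<partial>M)" by (subst integral_distr) auto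
  qed
  finally show ?thesis .
qed

text \<open>The exponent involves finitely many times, so it is a measurable function on the product
  path space and Fubini for the product law applies.\<close>

lemma (in prob_space) process_decouple:
  fixes B1 B2 :: "real \<Rightarrow> 'a \<Rightarrow> real"
  assumes indep: "indep_var (Pi\<^sub>M {0..} (\<lambda>_. borel)) (\<lambda>\<omega>. restrict (\<lambda>t. B1 t \<omega>) {0..})
       (Pi\<^sub>M {0..} (\<lambda>_. borel)) (\<lambda>\<omega>. restrict (\<lambda>t. B2 t \<omega>) {0..})"
    and U: "U \<in> process_span B1" and C: "C \<in> process_span B2" and u: "\<And>i. 0 \<le> u i" and e: "0 \<le> \<epsilon>"
  shows "(\<integral>x. iexp (U x + C x + \<kappa> * (\<Sum>i<n. (B1 (u i + \<epsilon>) x - B1 (u i) x) * (B2 (u i + \<epsilon>) x - B2 (u i) x))) \<partial>M) =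
      (\<integral>x. (\<integral>y. iexp (U x + C y + \<kappa> * (\<Sum>i<n. (B1 (u i + \<epsilon>) x - B1 (u i) x) * (B2 (u i + \<epsilon>) y - B2 (u i) y))) \<partial>M) \<partial>M)"
proof -
  obtain F c F' c' where U': "U = (\<lambda>\<omega>. \<Sum>t\<in>F. c t * B1 t \<omega>)" "finite F" "F \<subseteq> {0..}"
    and C': "C = (\<lambda>\<omega>. \<Sum>t\<in>F'. c' t * B2 t \<omega>)" "finite F'" "F' \<subseteq> {0..}"
    using U C unfolding process_span_def by auto
  define g where "g z = iexp ((\<Sum>t\<in>F. c t * fst z t) + (\<Sum>t\<in>F'. c' t * snd z t)
     + \<kappa> * (\<Sum>i<n. (fst z (u i + \<epsilon>) - fst z (u i)) * (snd z (u i + \<epsilon>) - snd z (u i))))" for z :: "(real \<Rightarrow> real) \<times> (real \<Rightarrow> real)"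
  let ?P = "Pi\<^sub>M {0..} (\<lambda>_. borel) :: (real \<Rightarrow> real) measure"
  have f: "(\<lambda>z. fst z t) \<in> borel_measurable (?P \<Otimes>\<^sub>M ?P)" if "0 \<le> t" for t
    using that by (intro measurable_compose[OF measurable_fst measurable_component_singleton]) auto
  have s: "(\<lambda>z. snd z t) \<in> borel_measurable (?P \<Otimes>\<^sub>M ?P)" if "0 \<le> t" for t
    using that by (intro measurable_compose[OF measurable_snd measurable_component_singleton]) auto
  have u': "0 \<le> u i + \<epsilon>" for i using u[of i] e by simp
  have gm: "g \<in> borel_measurable (?P \<Otimes>\<^sub>M ?P)"
  proof -
    have "(\<lambda>z. (\<Sum>t\<in>F. c t * fst z t) + (\<Sum>t\<in>F'. c' t * snd z t)
       + \<kappa> * (\<Sum>i<n. (fst z (u i + \<epsilon>) - fst z (u i)) * (snd z (u i + \<epsilon>) - snd z (u i)))) \<in> borel_measurable (?P \<Otimes>\<^sub>M ?P)"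
      using U'(3) C'(3) u u'
      by (intro borel_measurable_add borel_measurable_sum borel_measurable_times borel_measurable_diff borel_measurable_const f s) auto
    then show ?thesis unfolding g_def by measurable
  qed
  have gv: "g (restrict (\<lambda>t. B1 t x) {0..}, restrict (\<lambda>t. B2 t y) {0..}) =
     iexp (U x + C y + \<kappa> * (\<Sum>i<n. (B1 (u i + \<epsilon>) x - B1 (u i) x) * (B2 (u i + \<epsilon>) y - B2 (u i) y)))" for x y
  proof -
    have "(\<Sum>t\<in>F. c t * restrict (\<lambda>t. B1 t x) {0..} t) = U x" unfolding U'(1) using U'(3) by (intro sum.cong) auto
    moreover have "(\<Sum>t\<in>F'. c' t * restrict (\<lambda>t. B2 t y) {0..} t) = C y" unfolding C'(1) using C'(3) by (intro sum.cong) auto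
    ultimately show ?thesis unfolding g_def fst_conv snd_conv using u u' by simp
  qed
  have "norm (g z) \<le> 1" for z by (simp add: g_def)
  from indep_var_decouple[OF indep gm this] show ?thesis unfolding gv .
qed

section \<open>Riemann sums, and sums over pairs of grid points\<close>

lemma riemann_sum_tendsto_integral:
  fixes g :: "real \<Rightarrow> real"
  assumes T: "0 < T" and g: "continuous_on {0..T} g"
  shows "(\<lambda>n. T / real n * (\<Sum>i<n. g (T * (real i / real n)))) \<longlonglongrightarrow> integral {0..T} g"
proof (rule LIMSEQ_I)
  fix r :: real assume r: "r > 0"
  define e where "e = r / (2 * T)"
  have e: "e > 0" using r T by (simp add: e_def)
  have "uniformly_continuous_on {0..T} g" using g by (intro compact_uniformly_continuous) auto
  then obtain d where d: "d > 0" "\<And>x y. x \<in> {0..T} \<Longrightarrow> y \<in> {0..T} \<Longrightarrow> dist y x < d \<Longrightarrow> dist (g y) (g x) < e"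
    unfolding uniformly_continuous_on_def using e by metis
  obtain N where N: "real N > T / d" using reals_Archimedean2 by blast
  have "norm (T / real n * (\<Sum>i<n. g (T * (real i / real n))) - integral {0..T} g) < r" if n: "n \<ge> Suc N" for n
  proof -
    have n0: "real n > 0" using n by simp
    have "T / d < real n" using N n by linarith
    then have small: "T / real n < d" using d(1) n0 by (simp add: field_simps)
    define t where "t i = T * (real i / real n)" for i
    have t0: "t 0 = 0" and tn: "t n = T" using n0 by (auto simp: t_def)
    have tS: "t (Suc i) = t i + T / real n" for i using n0 by (simp add: t_def field_simps)
    have tm: "0 \<le> t i" for i using T by (simp add: t_def)
    have tT: "t i \<le> T" if "i \<le> n" for i
      using that n0 T by (simp add: t_def field_simps)
    \<comment> \<open>Errors accumulate cell by cell: each of the first k cells contributes at most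
      the oscillation \<open>e\<close> times the mesh.\<close>
    have step: "k \<le> n \<Longrightarrow> \<bar>T / real n * (\<Sum>i<k. g (t i)) - integral {0..t k} g\<bar> \<le> real k * (e * (T / real n))" for k
    proof (induction k)
      case 0 then show ?case by (simp add: t0)
    next
      case (Suc k)
      have le: "t k \<le> t (Suc k)" using T n0 by (simp add: tS)
      have sub: "{t k..t (Suc k)} \<subseteq> {0..T}" using tm[of k] tT[OF Suc.prems] by auto
      have ci: "g integrable_on {t k..t (Suc k)}"
        by (rule integrable_continuous_interval) (rule continuous_on_subset[OF g sub])
      have "integral {0..t k} g + integral {t k..t (Suc k)} g = integral {0..t (Suc k)} g"
      proof (rule Henstock_Kurzweil_Integration.integral_combine[OF tm le])
        show "g integrable_on {0..t (Suc k)}"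
          by (rule integrable_continuous_interval) (rule continuous_on_subset[OF g], use tT[OF Suc.prems] in auto)
      qed
      moreover have "\<bar>T / real n * g (t k) - integral {t k..t (Suc k)} g\<bar> \<le> e * (T / real n)"
      proof -
        have cst: "integral {t k..t (Suc k)} (\<lambda>x. g (t k)) = T / real n * g (t k)"
          using le by (simp add: tS)
        have "norm (integral {t k..t (Suc k)} (\<lambda>x. g x - g (t k))) \<le> e * (t (Suc k) - t k)"
        proof (rule integral_bound[OF le])
          show "continuous_on {t k..t (Suc k)} (\<lambda>x. g x - g (t k))"
            by (intro continuous_intros continuous_on_subset[OF g sub])
          fix x assume x: "x \<in> {t k..t (Suc k)}"
          have "dist (g x) (g (t k)) < e"
            by (rule d(2)) (use x sub le small tS[of k] in \<open>auto simp: dist_real_def\<close>)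
          then show "norm (g x - g (t k)) \<le> e" by (simp add: dist_real_def)
        qed
        moreover have "integral {t k..t (Suc k)} (\<lambda>x. g x - g (t k)) = integral {t k..t (Suc k)} g - T / real n * g (t k)"
          unfolding cst[symmetric] by (rule Henstock_Kurzweil_Integration.integral_diff[OF ci]) auto
        ultimately show ?thesis by (simp add: tS abs_minus_commute)
      qed
      ultimately have "\<bar>T / real n * (\<Sum>i<Suc k. g (t i)) - integral {0..t (Suc k)} g\<bar> \<le> real k * (e * (T / real n)) + e * (T / real n)"
        using Suc.IH Suc.prems unfolding sum.lessThan_Suc distrib_left by linarith
      moreover have "real (Suc k) * z = real k * z + z" for z by (simp add: distrib_right)
      ultimately show ?case by (simp only:)
    qed
    have "\<bar>T / real n * (\<Sum>i<n. g (t i)) - integral {0..T} g\<bar> \<le> e * T"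
      using step[of n] n0 unfolding tn by simp
    also have "\<dots> < r" using r T by (simp add: e_def)
    finally show ?thesis unfolding t_def by simp
  qed
  then show "\<exists>no. \<forall>n\<ge>no. norm (T / real n * (\<Sum>i<n. g (T * (real i / real n))) - integral {0..T} g) < r" by blast
qed

text \<open>Absolute difference on naturals; covariances on the grid depend on the indices only
  through it.\<close>

definition nat_dist :: "nat \<Rightarrow> nat \<Rightarrow> nat" where
  "nat_dist i j = (if i \<le> j then j - i else i - j)"

lemma sum_nat_dist_below: "(\<Sum>i<n. g (nat_dist i n)) + g 0 = (\<Sum>m<n. g m) + (g n :: real)"
proof -
  have "(\<Sum>i<n. g (nat_dist i n)) = (\<Sum>i<n. g (n - i))" by (intro sum.cong) (auto simp: nat_dist_def)
  also have "\<dots> + g 0 = (\<Sum>i\<le>n. g (n - i))" by (simp add: lessThan_Suc_atMost[symmetric])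
  also have "\<dots> = (\<Sum>i\<le>n. g i)" by (rule sum.nat_diff_reindex[of g "Suc n", simplified lessThan_Suc_atMost, simplified])
  finally show ?thesis by (simp add: lessThan_Suc_atMost[symmetric])
qed

text \<open>A distance m > 0 occurs for 2(n - m) ordered pairs and distance 0 for n of them; the
  subtracted term undoes the double count of the diagonal.\<close>

lemma sum_sum_nat_dist:
  fixes g :: "nat \<Rightarrow> real"
  shows "(\<Sum>i<n. \<Sum>j<n. g (nat_dist i j)) = 2 * (\<Sum>m<n. (real n - real m) * g m) - real n * g 0"
proof (induction n)
  case (Suc n)
  have "(\<Sum>i<Suc n. \<Sum>j<Suc n. g (nat_dist i j)) =
     (\<Sum>i<n. \<Sum>j<n. g (nat_dist i j)) + (\<Sum>i<n. g (nat_dist i n)) + (\<Sum>j<n. g (nat_dist n j)) + g 0"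
    by (simp add: sum.distrib nat_dist_def)
  also have "(\<Sum>j<n. g (nat_dist n j)) = (\<Sum>j<n. g (nat_dist j n))"
    by (intro sum.cong) (auto simp: nat_dist_def)
  finally have "(\<Sum>i<Suc n. \<Sum>j<Suc n. g (nat_dist i j)) =
     2 * (\<Sum>m<n. (real n - real m) * g m) - real n * g 0 + 2 * ((\<Sum>m<n. g m) + g n - g 0) + g 0"
    using Suc.IH sum_nat_dist_below[of g n] by simp
  moreover have "(\<Sum>m<Suc n. (real (Suc n) - real m) * g m) = (\<Sum>m<n. (real n - real m) * g m) + (\<Sum>m<n. g m) + g n"
    by (simp add: sum.distrib[symmetric] algebra_simps)
  ultimately show ?case by (simp add: algebra_simps)
qed simp

text \<open>Within one row each distance is attained at most twice, once on either side of the
  diagonal.\<close>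

lemma sum_nat_dist_le:
  fixes g :: "nat \<Rightarrow> real"
  assumes g: "\<And>m. 0 \<le> g m" and i: "i < n"
  shows "(\<Sum>j<n. g (nat_dist i j)) \<le> 2 * (\<Sum>m<n. g m)"
proof -
  have "(\<Sum>j<n. g (nat_dist i j)) = (\<Sum>j\<in>{..i}. g (nat_dist i j)) + (\<Sum>j\<in>{i<..<n}. g (nat_dist i j))"
    using i by (subst sum.union_disjoint[symmetric]) (auto intro!: sum.cong)
  also have "(\<Sum>j\<in>{..i}. g (nat_dist i j)) = (\<Sum>m\<in>{..i}. g m)"
    by (rule sum.reindex_bij_witness[of _ "\<lambda>j. i - j" "\<lambda>j. i - j"]) (auto simp: nat_dist_def)
  also have "\<dots> \<le> (\<Sum>m<n. g m)" using i g by (intro sum_mono2) auto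
  also have "(\<Sum>j\<in>{i<..<n}. g (nat_dist i j)) = (\<Sum>m\<in>{0<..<n-i}. g m)"
    by (rule sum.reindex_bij_witness[of _ "\<lambda>j. i + j" "\<lambda>j. j - i"]) (auto simp: nat_dist_def)
  also have "\<dots> \<le> (\<Sum>m<n. g m)" using g by (intro sum_mono2) auto
  finally show ?thesis by simp
qed

lemma continuous_increment_cov: "0 < H \<Longrightarrow> continuous_on S (increment_cov H \<epsilon>)"
  unfolding increment_cov_def by (intro continuous_intros continuous_on_powr') auto

text \<open>The discrete estimate on the grid \<open>T * i / n\<close> in the limit of fine mesh.
  The row-sum bound becomes \<open>s\<close>, and the sum of squared covariances becomes
  \<open>q\<close>, the double integral of the squared lag covariance over a square of side
  \<open>T\<close>, written as an integral over the lag.\<close>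

lemma (in prob_space) fbm_product_integral_estimate:
  fixes B1 B2 :: "real \<Rightarrow> 'a \<Rightarrow> real" and \<kappa> v :: real
  assumes T: "0 < T" and H: "0 < H" and B1: "is_fbm M H B1" and B2: "is_fbm M H B2"
    and indep: "indep_var (Pi\<^sub>M {0..} (\<lambda>_. borel)) (\<lambda>\<omega>. restrict (\<lambda>t. B1 t \<omega>) {0..})
       (Pi\<^sub>M {0..} (\<lambda>_. borel)) (\<lambda>\<omega>. restrict (\<lambda>t. B2 t \<omega>) {0..})"
    and U: "U \<in> process_span B1" and C: "C \<in> process_span B2" and e: "0 < \<epsilon>"
    and A: "\<And>u. u \<in> {0..T} \<Longrightarrow> \<bar>\<integral>\<omega>. C \<omega> * (B2 (u + \<epsilon>) \<omega> - B2 u \<omega>) \<partial>M\<bar> \<le> a"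
    and a0: "0 \<le> a" and v: "0 \<le> v"
  defines "s \<equiv> 2 * integral {0..T} (\<lambda>x. \<bar>increment_cov H \<epsilon> x\<bar>)"
    and "q \<equiv> 2 * integral {0..T} (\<lambda>x. (T - x) * (increment_cov H \<epsilon> x)\<^sup>2)"
    and "I \<equiv> (\<lambda>\<omega>. integral {0..T} (\<lambda>u. (B1 (u + \<epsilon>) \<omega> - B1 u \<omega>) * (B2 (u + \<epsilon>) \<omega> - B2 u \<omega>)))"
  shows "I \<in> borel_measurable M"
    and "norm ((\<integral>\<omega>. iexp (U \<omega> + C \<omega> + \<kappa> * I \<omega>) \<partial>M) - (\<integral>\<omega>. iexp (U \<omega>) \<partial>M) * (\<integral>\<omega>. iexp (C \<omega>) \<partial>M) * exp (- v / 2))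
      \<le> \<bar>\<kappa>\<bar> * a * sqrt (T * s) + sqrt (2 * (\<kappa> * s)\<^sup>2 * (\<kappa>\<^sup>2 * q)) / 2 + \<bar>\<kappa>\<^sup>2 * q - v\<bar> / 2"
proof -
  define r where "r = increment_cov H \<epsilon>"
  define u where "u n i = T * (real i / real n)" for n i :: nat
  define D1 where "D1 n i \<omega> = B1 (u n i + \<epsilon>) \<omega> - B1 (u n i) \<omega>" for n i \<omega>
  define D2 where "D2 n i \<omega> = B2 (u n i + \<epsilon>) \<omega> - B2 (u n i) \<omega>" for n i \<omega>
  define In where "In n \<omega> = T / real n * (\<Sum>i<n. D1 n i \<omega> * D2 n i \<omega>)" for n \<omega>
  note G1 = gaussian_space_process_span[OF B1] and G2 = gaussian_space_process_span[OF B2]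
  have u0: "0 \<le> u n i" for n i using T by (simp add: u_def)
  have u1: "0 \<le> u n i + \<epsilon>" for n i using u0[of n i] e by simp
  have uT: "u n i \<in> {0..T}" if "i < n" for n i using that T by (simp add: u_def field_simps)
  have D1G: "D1 n i \<in> process_span B1" for n i
    unfolding D1_def by (intro gaussian_space_diff[OF G1] process_span_base u0 u1)
  have D2G: "D2 n i \<in> process_span B2" for n i
    unfolding D2_def by (intro gaussian_space_diff[OF G2] process_span_base u0 u1)
  have [measurable]: "D1 n i \<in> borel_measurable M" "D2 n i \<in> borel_measurable M" for n i
    using gaussian_space_measurable[OF G1 D1G] gaussian_space_measurable[OF G2 D2G] by auto
  have Um[measurable]: "U \<in> borel_measurable M" and Cm[measurable]: "C \<in> borel_measurable M"
    using gaussian_space_measurable[OF G1 U] gaussian_space_measurable[OF G2 C] by auto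
  have Inm[measurable]: "In n \<in> borel_measurable M" for n unfolding In_def by measurable
  have In_lim: "(\<lambda>n. In n \<omega>) \<longlonglongrightarrow> I \<omega>" if "\<omega> \<in> space M" for \<omega>
    unfolding In_def I_def D1_def D2_def u_def
    by (rule riemann_sum_tendsto_integral[OF T]) (intro continuous_on_mult fbm_increment_continuous[OF B1] fbm_increment_continuous[OF B2] that; use e in simp)
  show Im[measurable]: "I \<in> borel_measurable M"
    by (rule borel_measurable_LIMSEQ_real[OF In_lim Inm])
  have R1: "(\<integral>\<omega>. D1 n i \<omega> * D1 n j \<omega> \<partial>M) = r (u n i - u n j)" for n i j
    unfolding D1_def r_def using fbm_increment_covariance[OF B1 u0 u0] e by simp
  have R2: "(\<integral>\<omega>. D2 n i \<omega> * D2 n j \<omega> \<partial>M) = r (u n i - u n j)" for n i j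
    unfolding D2_def r_def using fbm_increment_covariance[OF B2 u0 u0] e by simp
  have rd: "r (u n i - u n j) = r (u n (nat_dist i j))" for n i j
  proof -
    have "\<bar>u n i - u n j\<bar> = u n (nat_dist i j)"
    proof -
      have "u n i - u n j = T / real n * (real i - real j)" by (simp add: u_def right_diff_distrib diff_divide_distrib)
      moreover have "\<bar>real i - real j\<bar> = real (nat_dist i j)" by (auto simp: nat_dist_def)
      ultimately show ?thesis using T by (simp add: abs_mult u_def)
    qed
    then show ?thesis unfolding r_def by (metis increment_cov_abs)
  qed
  have rc: "continuous_on {0..T} r" unfolding r_def by (rule continuous_increment_cov[OF H])
  define S where "S n = 2 * (\<Sum>m<n. \<bar>r (u n m)\<bar>)" for n
  define Q where "Q n = (\<Sum>i<n. \<Sum>j<n. (r (u n i - u n j))\<^sup>2)" for n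
  have S0: "0 \<le> S n" for n unfolding S_def by (simp add: sum_nonneg)
  have S_lim: "(\<lambda>n. T / real n * S n) \<longlonglongrightarrow> s"
  proof -
    have "(\<lambda>n. 2 * (T / real n * (\<Sum>m<n. \<bar>r (u n m)\<bar>))) \<longlonglongrightarrow> 2 * integral {0..T} (\<lambda>x. \<bar>r x\<bar>)"
      unfolding u_def by (intro tendsto_mult tendsto_const riemann_sum_tendsto_integral[OF T] continuous_intros rc)
    then show ?thesis unfolding S_def s_def r_def by (simp add: mult.left_commute)
  qed
  have Q_lim: "(\<lambda>n. (T / real n)\<^sup>2 * Q n) \<longlonglongrightarrow> q"
  proof -
    \<comment> \<open>The subtracted term is the diagonal correction of the pair count; scaled by
      the squared mesh it disappears in the limit.\<close>
    have "(\<lambda>n. 2 * (T / real n * (\<Sum>m<n. (T - u n m) * (r (u n m))\<^sup>2)) - T * (T / real n) * (r 0)\<^sup>2) \<longlonglongrightarrow>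
       2 * integral {0..T} (\<lambda>x. (T - x) * (r x)\<^sup>2) - T * 0 * (r 0)\<^sup>2"
      unfolding u_def
      by (intro tendsto_diff tendsto_mult tendsto_const riemann_sum_tendsto_integral[OF T] continuous_intros rc lim_const_over_n)
    moreover have eqn: "2 * (T / real n * (\<Sum>m<n. (T - u n m) * (r (u n m))\<^sup>2)) - T * (T / real n) * (r 0)\<^sup>2 = (T / real n)\<^sup>2 * Q n" if n: "n > 0" for n
    proof -
      have "Q n = 2 * (\<Sum>m<n. (real n - real m) * (r (u n m))\<^sup>2) - real n * (r (u n 0))\<^sup>2"
        unfolding Q_def rd by (rule sum_sum_nat_dist)
      then have "(T / real n)\<^sup>2 * Q n = 2 * (T / real n * (\<Sum>m<n. T / real n * ((real n - real m) * (r (u n m))\<^sup>2))) - (T / real n)\<^sup>2 * (real n * (r (u n 0))\<^sup>2)"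
        by (simp add: right_diff_distrib power2_eq_square sum_distrib_left mult_ac)
      also have "(\<Sum>m<n. T / real n * ((real n - real m) * (r (u n m))\<^sup>2)) = (\<Sum>m<n. (T - u n m) * (r (u n m))\<^sup>2)"
      proof (rule sum.cong[OF refl])
        fix m
        have "T / real n * (real n - real m) = T - u n m" using n by (simp add: u_def field_simps)
        then show "T / real n * ((real n - real m) * (r (u n m))\<^sup>2) = (T - u n m) * (r (u n m))\<^sup>2"
          by (metis mult.assoc)
      qed
      also have "(T / real n)\<^sup>2 * (real n * (r (u n 0))\<^sup>2) = T * (T / real n) * (r 0)\<^sup>2"
        using n by (simp add: u_def power2_eq_square)
      finally show ?thesis by simp
    qed
    have "eventually (\<lambda>n. 2 * (T / real n * (\<Sum>m<n. (T - u n m) * (r (u n m))\<^sup>2)) - T * (T / real n) * (r 0)\<^sup>2 = (T / real n)\<^sup>2 * Q n) sequentially"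
      by (rule eventually_mono[OF eventually_gt_at_top[of 0] eqn])
    ultimately show ?thesis unfolding q_def r_def by (auto dest: Lim_transform_eventually)
  qed
  define E where "E = (\<integral>\<omega>. iexp (U \<omega>) \<partial>M) * (\<integral>\<omega>. iexp (C \<omega>) \<partial>M) * exp (- v / 2)"
  have est: "norm ((\<integral>\<omega>. iexp (U \<omega> + C \<omega> + \<kappa> * In n \<omega>) \<partial>M) - E) \<le>
      \<bar>\<kappa>\<bar> * a * sqrt (T * (T / real n * S n)) + sqrt (2 * (\<kappa> * (T / real n * S n))\<^sup>2 * (\<kappa>\<^sup>2 * ((T / real n)\<^sup>2 * Q n))) / 2
      + \<bar>\<kappa>\<^sup>2 * ((T / real n)\<^sup>2 * Q n) - v\<bar> / 2" if n: "n > 0" for n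
  proof -
    \<comment> \<open>The mesh is absorbed into the coefficient, turning the discrete bilinear sum
      into the Riemann sum \<open>In n\<close>.\<close>
    define k where "k = \<kappa> * (T / real n)"
    have dec: "(\<integral>x. iexp (U x + C x + k * (\<Sum>i<n. D1 n i x * D2 n i x)) \<partial>M) =
      (\<integral>x. (\<integral>y. iexp (U x + C y + k * (\<Sum>i<n. D1 n i x * D2 n i y)) \<partial>M) \<partial>M)"
      unfolding D1_def D2_def by (rule process_decouple[OF indep U C u0]) (use e in simp)
    have row: "(\<Sum>j<n. \<bar>r (u n i - u n j)\<bar>) \<le> S n" if "i < n" for i
      unfolding S_def rd using that by (intro sum_nat_dist_le) auto
    have cA: "\<bar>\<integral>\<omega>. C \<omega> * D2 n i \<omega> \<partial>M\<bar> \<le> a" if "i < n" for i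
      unfolding D2_def by (rule A[OF uT[OF that]])
    have "norm ((\<integral>x. iexp (U x + C x + k * (\<Sum>i<n. D1 n i x * D2 n i x)) \<partial>M) - E) \<le>
      \<bar>k\<bar> * a * sqrt (real n * S n) + sqrt (2 * (k * S n)\<^sup>2 * (k\<^sup>2 * Q n)) / 2 + \<bar>k\<^sup>2 * Q n - v\<bar> / 2"
      unfolding E_def Q_def
      by (rule gaussian_bilinear_estimate[where R="\<lambda>i j. r (u n i - u n j)" and D="D1 n" and D'="D2 n",
            OF G1 G2 U C]) (simp_all only: D1G D2G R1 R2 row S0 cA a0 v dec)
    moreover have "k * (\<Sum>i<n. D1 n i x * D2 n i x) = \<kappa> * In n x" for x by (simp add: k_def In_def)
    moreover have "\<bar>k\<bar> * a * sqrt (real n * S n) = \<bar>\<kappa>\<bar> * a * sqrt (T * (T / real n * S n))"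
    proof -
      have "sqrt (T * (T / real n * S n)) = sqrt ((T / real n)\<^sup>2 * (real n * S n))"
        using n by (simp add: power2_eq_square)
      also have "\<dots> = T / real n * sqrt (real n * S n)" using T by (simp add: real_sqrt_mult)
      finally show ?thesis using T by (simp add: k_def abs_mult)
    qed
    moreover have "k * S n = \<kappa> * (T / real n * S n)" "k\<^sup>2 * Q n = \<kappa>\<^sup>2 * ((T / real n)\<^sup>2 * Q n)"
      by (simp_all only: k_def mult.assoc power_mult_distrib)
    ultimately show ?thesis by (simp only:)
  qed
  have lim1: "(\<lambda>n. \<integral>\<omega>. iexp (U \<omega> + C \<omega> + \<kappa> * In n \<omega>) \<partial>M) \<longlonglongrightarrow> (\<integral>\<omega>. iexp (U \<omega> + C \<omega> + \<kappa> * I \<omega>) \<partial>M)"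
  proof (rule integral_dominated_convergence[where w="\<lambda>_. 1"])
    show "AE \<omega> in M. (\<lambda>n. iexp (U \<omega> + C \<omega> + \<kappa> * In n \<omega>)) \<longlonglongrightarrow> iexp (U \<omega> + C \<omega> + \<kappa> * I \<omega>)"
      by (intro AE_I2 tendsto_intros In_lim)
  qed auto
  have "norm ((\<integral>\<omega>. iexp (U \<omega> + C \<omega> + \<kappa> * I \<omega>) \<partial>M) - E) \<le>
    \<bar>\<kappa>\<bar> * a * sqrt (T * s) + sqrt (2 * (\<kappa> * s)\<^sup>2 * (\<kappa>\<^sup>2 * q)) / 2 + \<bar>\<kappa>\<^sup>2 * q - v\<bar> / 2"
  proof (rule tendsto_le[OF sequentially_bot])
    show "(\<lambda>n. norm ((\<integral>\<omega>. iexp (U \<omega> + C \<omega> + \<kappa> * In n \<omega>) \<partial>M) - E)) \<longlonglongrightarrow> norm ((\<integral>\<omega>. iexp (U \<omega> + C \<omega> + \<kappa> * I \<omega>) \<partial>M) - E)"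
      by (intro tendsto_intros lim1)
    show "(\<lambda>n. \<bar>\<kappa>\<bar> * a * sqrt (T * (T / real n * S n)) + sqrt (2 * (\<kappa> * (T / real n * S n))\<^sup>2 * (\<kappa>\<^sup>2 * ((T / real n)\<^sup>2 * Q n))) / 2
      + \<bar>\<kappa>\<^sup>2 * ((T / real n)\<^sup>2 * Q n) - v\<bar> / 2) \<longlonglongrightarrow>
      \<bar>\<kappa>\<bar> * a * sqrt (T * s) + sqrt (2 * (\<kappa> * s)\<^sup>2 * (\<kappa>\<^sup>2 * q)) / 2 + \<bar>\<kappa>\<^sup>2 * q - v\<bar> / 2"
      by (intro tendsto_intros S_lim Q_lim) auto
    show "eventually (\<lambda>n. norm ((\<integral>\<omega>. iexp (U \<omega> + C \<omega> + \<kappa> * In n \<omega>) \<partial>M) - E) \<le>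
      \<bar>\<kappa>\<bar> * a * sqrt (T * (T / real n * S n)) + sqrt (2 * (\<kappa> * (T / real n * S n))\<^sup>2 * (\<kappa>\<^sup>2 * ((T / real n)\<^sup>2 * Q n))) / 2
      + \<bar>\<kappa>\<^sup>2 * ((T / real n)\<^sup>2 * Q n) - v\<bar> / 2) sequentially"
      using eventually_gt_at_top[of 0] by eventually_elim (rule est)
  qed
  then show "norm ((\<integral>\<omega>. iexp (U \<omega> + C \<omega> + \<kappa> * I \<omega>) \<partial>M) - (\<integral>\<omega>. iexp (U \<omega>) \<partial>M) * (\<integral>\<omega>. iexp (C \<omega>) \<partial>M) * exp (- v / 2))
      \<le> \<bar>\<kappa>\<bar> * a * sqrt (T * s) + sqrt (2 * (\<kappa> * s)\<^sup>2 * (\<kappa>\<^sup>2 * q)) / 2 + \<bar>\<kappa>\<^sup>2 * q - v\<bar> / 2"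
    unfolding E_def .
qed

section \<open>Asymptotics of the increment covariance\<close>

text \<open>Self-similarity; it reduces every estimate in \<open>\<epsilon>\<close> to the behaviour
  of the unit lag covariance at infinity.\<close>

lemma increment_cov_scaling:
  assumes "0 < \<epsilon>"
  shows "increment_cov H \<epsilon> x = \<epsilon> powr (2*H) * increment_cov H 1 (x / \<epsilon>)"
proof -
  have e: "\<epsilon> powr (2*H) * \<bar>y / \<epsilon>\<bar> powr (2*H) = \<bar>y\<bar> powr (2*H)" for y
  proof -
    have "\<epsilon> * \<bar>y / \<epsilon>\<bar> = \<bar>y\<bar>" using assms by simp
    then show ?thesis using powr_mult[of \<epsilon> "\<bar>y / \<epsilon>\<bar>" "2*H"] assms by simp
  qed
  have "x / \<epsilon> + 1 = (x + \<epsilon>) / \<epsilon>" "x / \<epsilon> - 1 = (x - \<epsilon>) / \<epsilon>" using assms by (auto simp: field_simps)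
  then have "\<epsilon> powr (2*H) * increment_cov H 1 (x / \<epsilon>) =
    (\<epsilon> powr (2*H) * \<bar>(x + \<epsilon>) / \<epsilon>\<bar> powr (2*H) + \<epsilon> powr (2*H) * \<bar>(x - \<epsilon>) / \<epsilon>\<bar> powr (2*H) - 2 * (\<epsilon> powr (2*H) * \<bar>x / \<epsilon>\<bar> powr (2*H))) / 2"
    unfolding increment_cov_def by (simp only: ring_distribs times_divide_eq_right mult.left_commute[of _ 2])
  also have "\<dots> = increment_cov H \<epsilon> x" unfolding e increment_cov_def ..
  finally show ?thesis by simp
qed

text \<open>A second difference with unit step behaves like the second derivative, here half of
  2H(2H-1) x^(2H-2).\<close>

lemma increment_cov_asymptotic:
  assumes "0 < H" "H < 1"
  shows "((\<lambda>x. increment_cov H 1 x * x powr (2 - 2*H)) \<longlongrightarrow> H * (2*H - 1)) at_top"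
proof -
  have "((\<lambda>x. ((x + 1) powr (2*H) + (x - 1) powr (2*H) - 2 * x powr (2*H)) / 2 * x powr (2 - 2*H)) \<longlongrightarrow> H * (2*H - 1)) at_top"
    using assms by real_asymp
  moreover have "eventually (\<lambda>x. ((x + 1) powr (2*H) + (x - 1) powr (2*H) - 2 * x powr (2*H)) / 2 * x powr (2 - 2*H) =
     increment_cov H 1 x * x powr (2 - 2*H)) at_top"
    using eventually_gt_at_top[of 1] by eventually_elim (simp add: increment_cov_def)
  ultimately show ?thesis by (rule Lim_transform_eventually)
qed

section \<open>Growth of primitives by l'Hospital's rule\<close>

lemma eventually_DERIV_integral:
  fixes g :: "real \<Rightarrow> real"
  assumes "continuous_on {0..} g"
  shows "eventually (\<lambda>x. DERIV (\<lambda>x. integral {0..x} g) x :> g x) at_top"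
  using eventually_gt_at_top[of 0]
proof eventually_elim
  case (elim x)
  have "((\<lambda>x. integral {0..x} g) has_real_derivative g x) (at x within {0..x + 1})"
    by (rule integral_has_real_derivative) (use elim in \<open>auto intro: continuous_on_subset[OF assms]\<close>)
  moreover have "at x within {0..x + 1} = at x" by (rule at_within_interior) (use elim in auto)
  ultimately show ?case by simp
qed

text \<open>The form of l'Hospital's rule used asks only the denominator to diverge, so convergent
  and divergent integrals are treated alike.\<close>

lemma integral_over_powr_tendsto:
  fixes g :: "real \<Rightarrow> real"
  assumes g: "continuous_on {0..} g" and p: "0 < p"
    and lim: "((\<lambda>x. g x * x powr (1 - p)) \<longlongrightarrow> l) at_top"
  shows "((\<lambda>x. integral {0..x} g / x powr p) \<longlongrightarrow> l / p) at_top"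
proof (rule lhospital_at_top_at_top)
  show "LIM x at_top. x powr p :> at_top" using p by real_asymp
  show "eventually (\<lambda>x. p * x powr (p - 1) \<noteq> 0) at_top"
    using eventually_gt_at_top[of 0] by eventually_elim (use p in auto)
  show "eventually (\<lambda>x. DERIV (\<lambda>x. x powr p) x :> p * x powr (p - 1)) at_top"
    using eventually_gt_at_top[of 0] by eventually_elim (auto intro!: has_real_derivative_powr)
  have "((\<lambda>x. g x * x powr (1 - p) / p) \<longlongrightarrow> l / p) at_top" using p by (intro tendsto_intros lim) auto
  moreover have "eventually (\<lambda>x. g x * x powr (1 - p) / p = g x / (p * x powr (p - 1))) at_top"
    using eventually_gt_at_top[of 0]
  proof eventually_elim
    case (elim x)
    have "x powr (1 - p) = inverse (x powr (p - 1))" using powr_minus[of x "p - 1"] by simp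
    then show ?case by (simp add: field_simps)
  qed
  ultimately show "((\<lambda>x. g x / (p * x powr (p - 1))) \<longlongrightarrow> l / p) at_top" by (rule Lim_transform_eventually)
qed (rule eventually_DERIV_integral[OF g])

text \<open>The borderline exponent, where decay like l/x produces logarithmic growth; this is the
  source of the logarithm at H = 3/4.\<close>

lemma integral_over_ln_tendsto:
  fixes g :: "real \<Rightarrow> real"
  assumes g: "continuous_on {0..} g" and lim: "((\<lambda>x. g x * x) \<longlongrightarrow> l) at_top"
  shows "((\<lambda>x. integral {0..x} g / ln x) \<longlongrightarrow> l) at_top"
proof (rule lhospital_at_top_at_top)
  show "LIM x at_top. ln (x::real) :> at_top" by (rule ln_at_top)
  show "eventually (\<lambda>x. inverse x \<noteq> (0::real)) at_top"
    using eventually_gt_at_top[of 0] by eventually_elim auto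
  show "eventually (\<lambda>x. DERIV ln x :> inverse (x::real)) at_top"
    using eventually_gt_at_top[of 0] by eventually_elim (auto intro!: DERIV_ln)
  show "((\<lambda>x. g x / inverse x) \<longlongrightarrow> l) at_top" using lim by (simp add: field_simps)
qed (rule eventually_DERIV_integral[OF g])

lemma integral_rescale:
  fixes f :: "real \<Rightarrow> real"
  assumes "0 < \<epsilon>" "0 < T"
  shows "integral {0..T} (\<lambda>x. f (x / \<epsilon>)) = \<epsilon> * integral {0..T / \<epsilon>} f"
proof -
  have "(\<lambda>x. x / (1 / \<epsilon>)) ` {0..T / \<epsilon>} = {0..T}"
  proof -
    have "(\<lambda>x. x / (1 / \<epsilon>)) ` {0..T / \<epsilon>} = (\<lambda>x. \<epsilon> * x) ` {0..T / \<epsilon>}" by (simp add: mult.commute)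
    also have "\<dots> = {\<epsilon> * 0..\<epsilon> * (T / \<epsilon>)}" using assms by (subst image_mult_atLeastAtMost) auto
    finally show ?thesis using assms by simp
  qed
  with integral_stretch_real[of "1 / \<epsilon>" 0 "T / \<epsilon>" f] assms show ?thesis by simp
qed

text \<open>This and the next two primitives of the unit lag covariance, taken at
  \<open>T / \<epsilon>\<close>, express the row-sum bound and the mean of the quadratic
  form.\<close>

definition cov_abs_integral :: "real \<Rightarrow> real \<Rightarrow> real" where
  "cov_abs_integral H x = integral {0..x} (\<lambda>y. \<bar>increment_cov H 1 y\<bar>)"

definition cov_sq_integral :: "real \<Rightarrow> real \<Rightarrow> real" where
  "cov_sq_integral H x = integral {0..x} (\<lambda>y. (increment_cov H 1 y)\<^sup>2)"

definition cov_sq_moment :: "real \<Rightarrow> real \<Rightarrow> real" where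
  "cov_sq_moment H x = integral {0..x} (\<lambda>y. y * (increment_cov H 1 y)\<^sup>2)"

lemma increment_cov_abs_integral:
  assumes "0 < \<epsilon>" "0 < T"
  shows "integral {0..T} (\<lambda>x. \<bar>increment_cov H \<epsilon> x\<bar>) = \<epsilon> powr (2*H) * (\<epsilon> * cov_abs_integral H (T / \<epsilon>))"
proof -
  have "integral {0..T} (\<lambda>x. \<bar>increment_cov H \<epsilon> x\<bar>) = integral {0..T} (\<lambda>x. \<epsilon> powr (2*H) * \<bar>increment_cov H 1 (x / \<epsilon>)\<bar>)"
    by (simp add: increment_cov_scaling[OF assms(1)] abs_mult)
  also have "\<dots> = \<epsilon> powr (2*H) * integral {0..T} (\<lambda>x. \<bar>increment_cov H 1 (x / \<epsilon>)\<bar>)" by simp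
  also have "integral {0..T} (\<lambda>x. \<bar>increment_cov H 1 (x / \<epsilon>)\<bar>) = \<epsilon> * cov_abs_integral H (T / \<epsilon>)"
    unfolding cov_abs_integral_def by (rule integral_rescale[OF assms])
  finally show ?thesis .
qed

text \<open>Substituting \<open>x = \<epsilon> * y\<close>: the squared scaling gives the power 4H,
  the measure one more factor \<open>\<epsilon>\<close>, and the weight becomes
  \<open>T - \<epsilon> * y\<close>, which splits the integral in two.\<close>

lemma increment_cov_sq_integral:
  assumes e: "0 < \<epsilon>" and T: "0 < T" and H: "0 < H"
  shows "integral {0..T} (\<lambda>x. (T - x) * (increment_cov H \<epsilon> x)\<^sup>2) =
    \<epsilon> powr (4*H) * (\<epsilon> * (T * cov_sq_integral H (T / \<epsilon>) - \<epsilon> * cov_sq_moment H (T / \<epsilon>)))"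
proof -
  have c: "continuous_on S (increment_cov H 1)" for S by (rule continuous_increment_cov[OF H])
  have pw: "(\<epsilon> powr (2*H))\<^sup>2 = \<epsilon> powr (4*H)" using e by (simp add: power2_eq_square powr_add[symmetric])
  have "integral {0..T} (\<lambda>x. (T - x) * (increment_cov H \<epsilon> x)\<^sup>2) =
     integral {0..T} (\<lambda>x. \<epsilon> powr (4*H) * ((T - \<epsilon> * (x / \<epsilon>)) * (increment_cov H 1 (x / \<epsilon>))\<^sup>2))"
  proof (rule integral_cong)
    fix x
    show "(T - x) * (increment_cov H \<epsilon> x)\<^sup>2 = \<epsilon> powr (4*H) * ((T - \<epsilon> * (x / \<epsilon>)) * (increment_cov H 1 (x / \<epsilon>))\<^sup>2)"
      unfolding increment_cov_scaling[OF e, of H x] power_mult_distrib pw using e by simp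
  qed
  also have "\<dots> = \<epsilon> powr (4*H) * integral {0..T} (\<lambda>x. (T - \<epsilon> * (x / \<epsilon>)) * (increment_cov H 1 (x / \<epsilon>))\<^sup>2)"
    by (rule integral_mult_right)
  also have "integral {0..T} (\<lambda>x. (T - \<epsilon> * (x / \<epsilon>)) * (increment_cov H 1 (x / \<epsilon>))\<^sup>2) =
     \<epsilon> * integral {0..T / \<epsilon>} (\<lambda>y. (T - \<epsilon> * y) * (increment_cov H 1 y)\<^sup>2)"
    by (rule integral_rescale[OF e T])
  also have "integral {0..T / \<epsilon>} (\<lambda>y. (T - \<epsilon> * y) * (increment_cov H 1 y)\<^sup>2) =
     integral {0..T / \<epsilon>} (\<lambda>y. T * (increment_cov H 1 y)\<^sup>2 - \<epsilon> * (y * (increment_cov H 1 y)\<^sup>2))"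
    by (simp add: algebra_simps)
  also have "\<dots> = T * cov_sq_integral H (T / \<epsilon>) - \<epsilon> * cov_sq_moment H (T / \<epsilon>)"
    unfolding cov_sq_integral_def cov_sq_moment_def
    by (subst Henstock_Kurzweil_Integration.integral_diff)
      (auto intro!: integrable_continuous_interval continuous_intros c simp: integral_mult_right)
  finally show ?thesis .
qed

context
  fixes H :: real
  assumes H: "0 < H" "H < 1"
begin

lemma increment_cov_powr_tendsto:
  assumes "p > 2*H - 1"
  shows "((\<lambda>x. \<bar>increment_cov H 1 x\<bar> * x powr (1 - p)) \<longlongrightarrow> 0) at_top"
proof -
  have "((\<lambda>x. \<bar>increment_cov H 1 x * x powr (2 - 2*H)\<bar> * x powr (2*H - 1 - p)) \<longlongrightarrow> \<bar>H * (2*H - 1)\<bar> * 0) at_top"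
  proof (rule tendsto_mult[OF tendsto_rabs[OF increment_cov_asymptotic[OF H]]])
    show "((\<lambda>x. x powr (2*H - 1 - p)) \<longlongrightarrow> 0) at_top"
      using assms tendsto_neg_powr[of "2*H - 1 - p" "\<lambda>x. x" at_top] filterlim_ident by auto
  qed
  moreover have "eventually (\<lambda>x. \<bar>increment_cov H 1 x * x powr (2 - 2*H)\<bar> * x powr (2*H - 1 - p) =
      \<bar>increment_cov H 1 x\<bar> * x powr (1 - p)) at_top"
    using eventually_gt_at_top[of 0]
    by eventually_elim (simp add: abs_mult mult.assoc powr_add[symmetric])
  ultimately show ?thesis by (auto dest: Lim_transform_eventually)
qed

text \<open>The integral grows at most like x^(2H-1) for H > 1/2 and stays bounded otherwise, so any
  exponent p above both 0 and 2H - 1 dominates it.\<close>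

lemma cov_abs_integral_tendsto:
  assumes "0 < p" "p > 2*H - 1"
  shows "((\<lambda>x. cov_abs_integral H x / x powr p) \<longlongrightarrow> 0) at_top"
  using integral_over_powr_tendsto[OF _ assms(1) increment_cov_powr_tendsto[OF assms(2)]]
  unfolding cov_abs_integral_def by (simp add: continuous_on_rabs continuous_increment_cov H)

lemma increment_cov_sq_asymptotic:
  "((\<lambda>x. (increment_cov H 1 x)\<^sup>2 * x powr (4 - 4*H)) \<longlongrightarrow> (H * (2*H - 1))\<^sup>2) at_top"
proof -
  have "((\<lambda>x. (increment_cov H 1 x * x powr (2 - 2*H))\<^sup>2) \<longlongrightarrow> (H * (2*H - 1))\<^sup>2) at_top"
    by (intro tendsto_power increment_cov_asymptotic H)
  moreover have "(increment_cov H 1 x * x powr (2 - 2*H))\<^sup>2 = (increment_cov H 1 x)\<^sup>2 * x powr (4 - 4*H)" for x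
    by (simp add: power_mult_distrib power2_eq_square[of "x powr _"] powr_add[symmetric])
  ultimately show ?thesis by simp
qed

text \<open>A Cesaro mean has the limit of its integrand. Below 3/4 this limit is 0; at 3/4 it is a
  constant, still negligible against the logarithm.\<close>

lemma cov_sq_moment_tendsto:
  assumes "((\<lambda>x. x * (increment_cov H 1 x)\<^sup>2) \<longlongrightarrow> l) at_top"
  shows "((\<lambda>x. cov_sq_moment H x / x) \<longlongrightarrow> l) at_top"
proof -
  have "((\<lambda>x. integral {0..x} (\<lambda>y. y * (increment_cov H 1 y)\<^sup>2) / x powr 1) \<longlongrightarrow> l / 1) at_top"
  proof (rule integral_over_powr_tendsto)
    show "continuous_on {0..} (\<lambda>y. y * (increment_cov H 1 y)\<^sup>2)"
      by (intro continuous_intros continuous_increment_cov H)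
    have "eventually (\<lambda>x. x * (increment_cov H 1 x)\<^sup>2 = x * (increment_cov H 1 x)\<^sup>2 * x powr (1 - 1)) at_top"
      using eventually_gt_at_top[of 0] by eventually_elim simp
    with assms show "((\<lambda>x. x * (increment_cov H 1 x)\<^sup>2 * x powr (1 - 1)) \<longlongrightarrow> l) at_top"
      by (rule Lim_transform_eventually)
  qed simp
  moreover have "eventually (\<lambda>x. integral {0..x} (\<lambda>y. y * (increment_cov H 1 y)\<^sup>2) / x powr 1 = cov_sq_moment H x / x) at_top"
    using eventually_gt_at_top[of 0] by eventually_elim (simp add: cov_sq_moment_def)
  ultimately show ?thesis by (auto dest: Lim_transform_eventually)
qed

text \<open>Here 3/4 enters: the tail is compared with x^(4H-4), whose exponent is below -1 for H <
  3/4. On bounded intervals continuity suffices.\<close>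

lemma increment_cov_sq_set_integrable:
  assumes "H < 3/4"
  shows "set_integrable lborel {0..} (\<lambda>x. (increment_cov H 1 x)\<^sup>2)"
proof -
  let ?f = "\<lambda>x. (increment_cov H 1 x)\<^sup>2"
  \<comment> \<open>Any constant above the limit of the rescaled square bounds it from some point
    on.\<close>
  define C where "C = (H * (2*H - 1))\<^sup>2 + 1"
  have "eventually (\<lambda>x. ?f x * x powr (4 - 4*H) < C) at_top"
    by (rule order_tendstoD(2)[OF increment_cov_sq_asymptotic]) (simp add: C_def)
  then obtain a where a: "\<And>x. x \<ge> a \<Longrightarrow> ?f x * x powr (4 - 4*H) < C"
    by (auto simp: eventually_at_top_linorder)
  define b where "b = max a 1"
  have b: "b \<ge> 1" "b > 0" by (auto simp: b_def)
  have bound: "?f x \<le> C * x powr (4*H - 4)" if "x \<ge> b" for x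
  proof -
    have x: "x > 0" "x \<ge> a" using that b by (auto simp: b_def)
    have "?f x = ?f x * x powr (4 - 4*H) * x powr (4*H - 4)" using x by (simp add: mult.assoc powr_add[symmetric])
    also have "\<dots> \<le> C * x powr (4*H - 4)" using a[OF x(2)] by (intro mult_right_mono) auto
    finally show ?thesis .
  qed
  have fm[measurable]: "?f \<in> borel_measurable borel"
    by (intro borel_measurable_continuous_onI continuous_intros continuous_increment_cov H)
  have pi: "set_integrable lborel {b..} (\<lambda>x. C * x powr (4*H - 4))"
  proof -
    have "((\<lambda>x. x powr (4*H - 4)) has_integral -(b powr (4*H - 4 + 1)) / (4*H - 4 + 1)) {b..}"
      by (rule has_integral_powr_to_inf) (use assms b in auto)
    then have "(\<lambda>x. x powr (4*H - 4)) absolutely_integrable_on {b..}"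
      by (intro nonnegative_absolutely_integrable_1) (auto simp: integrable_on_def)
    then have "set_integrable lborel {b..} (\<lambda>x. x powr (4*H - 4))"
      unfolding set_integrable_def by (subst (asm) integrable_completion) auto
    then show ?thesis by (rule set_integrable_mult_right)
  qed
  have i1: "set_integrable lborel {b..} ?f"
    unfolding set_integrable_def
  proof (rule Bochner_Integration.integrable_bound[OF pi[unfolded set_integrable_def]])
    show "AE x in lborel. norm (indicator {b..} x *\<^sub>R ?f x) \<le> norm (indicator {b..} x *\<^sub>R (C * x powr (4*H - 4)))"
      using bound by (intro AE_I2) (auto simp: indicator_def intro: order_trans[OF _ abs_ge_self])
  qed measurable
  have i2: "set_integrable lborel {0..b} ?f"
    by (rule borel_integrable_atLeastAtMost') (intro continuous_intros continuous_increment_cov H)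
  have "set_integrable lborel ({0..b} \<union> {b..}) ?f" by (rule set_integrable_Un[OF i2 i1]) auto
  moreover have "{0..b} \<union> {b..} = {0..}" using b by auto
  ultimately show ?thesis by simp
qed

text \<open>The half arises because the square is even and only positive lags are integrated. The
  prefactor 1/4 in \<open>sigma_hat_sq\<close> cancels the 4 from squaring twice
  \<open>increment_cov\<close>.\<close>

lemma cov_sq_integral_tendsto:
  assumes "H < 3/4"
  shows "((\<lambda>x. cov_sq_integral H x) \<longlongrightarrow> sigma_hat_sq H / 2) at_top"
proof -
  let ?f = "\<lambda>x. (increment_cov H 1 x)\<^sup>2"
  note si = increment_cov_sq_set_integrable[OF assms]
  have "has_bochner_integral lborel (\<lambda>x. indicator {0..} x *\<^sub>R ?f x) (set_lebesgue_integral lborel {0..} ?f)"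
    using si unfolding set_integrable_def set_lebesgue_integral_def by (rule has_bochner_integral_integrable)
  then have "has_bochner_integral lborel ?f (2 *\<^sub>R set_lebesgue_integral lborel {0..} ?f)"
  proof (rule has_bochner_integral_even_function)
    show "?f (- x) = ?f x" for x using increment_cov_abs[of H 1 x] increment_cov_abs[of H 1 "-x"] by simp
  qed
  then have "(LBINT x. ?f x) = 2 * set_lebesgue_integral lborel {0..} ?f" by (simp add: has_bochner_integral_integral_eq)
  moreover have "sigma_hat_sq H = (LBINT x. ?f x)"
  proof -
    have "(\<bar>x + 1\<bar> powr (2*H) + \<bar>x - 1\<bar> powr (2*H) - 2 * \<bar>x\<bar> powr (2*H))\<^sup>2 = 4 * ?f x" for x
      by (simp add: increment_cov_def power_divide)
    then show ?thesis unfolding sigma_hat_sq_def by simp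
  qed
  moreover have "((\<lambda>x. set_lebesgue_integral lborel {0..x} ?f) \<longlongrightarrow> set_lebesgue_integral lborel {0..} ?f) at_top"
    by (rule tendsto_set_lebesgue_integral_at_top[OF _ si]) auto
  moreover have "set_lebesgue_integral lborel {0..x} ?f = cov_sq_integral H x" for x
    unfolding cov_sq_integral_def
    by (rule set_borel_integral_eq_integral, rule borel_integrable_atLeastAtMost') (intro continuous_intros continuous_increment_cov H)
  ultimately show ?thesis by simp
qed

text \<open>At lag 0 the unit covariance equals 1, so its continuous square has positive integral
  near 0. Strict positivity makes the limiting law a genuine normal density.\<close>

lemma sigma_hat_sq_pos:
  assumes "H < 3/4"
  shows "0 < sigma_hat_sq H"
proof -
  let ?f = "\<lambda>x. (increment_cov H 1 x)\<^sup>2"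
  have c: "continuous_on S ?f" for S by (intro continuous_intros continuous_increment_cov H)
  have i: "?f integrable_on {0..x}" for x by (rule integrable_continuous_interval[OF c])
  have "cov_sq_integral H 1 \<noteq> 0"
  proof
    assume "cov_sq_integral H 1 = 0"
    then have "(?f has_integral 0) (cbox 0 1)" using integrable_integral[OF i[of 1]] by (simp add: cov_sq_integral_def)
    then have "?f 0 = 0" by (rule has_integral_0_cbox_imp_0[OF c, rotated]) auto
    then show False by (simp add: increment_cov_def)
  qed
  moreover have "cov_sq_integral H 1 \<ge> 0" unfolding cov_sq_integral_def by (rule integral_nonneg[OF i]) simp
  ultimately have p: "cov_sq_integral H 1 > 0" by simp
  have "cov_sq_integral H 1 \<le> sigma_hat_sq H / 2"
  proof (rule tendsto_lowerbound[OF cov_sq_integral_tendsto[OF assms]])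
    show "eventually (\<lambda>x. cov_sq_integral H 1 \<le> cov_sq_integral H x) at_top"
      using eventually_ge_at_top[of 1] unfolding cov_sq_integral_def
      by eventually_elim (intro integral_subset_le i; auto)
  qed simp
  with p show ?thesis by simp
qed

end

section \<open>Hoelder bounds for powers, and the covariance of a fixed functional with a short
  increment\<close>

lemma powr_subadditive:
  fixes a b p :: real
  assumes "0 \<le> a" "0 \<le> b" "0 < p" "p \<le> 1"
  shows "(a + b) powr p \<le> a powr p + b powr p"
proof (cases "a + b = 0")
  case True then show ?thesis using assms by simp
next
  case False
  then have s: "a + b > 0" using assms by simp
  \<comment> \<open>A fraction in the unit interval does not decrease when raised to a power at most
    1; summing over the two parts of \<open>a + b\<close> gives subadditivity.\<close>
  have *: "x * (a + b) powr p / (a + b) \<le> x powr p" if "0 \<le> x" "x \<le> a + b" for x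
  proof (cases "x = 0")
    case False
    then have x: "0 < x" using that by simp
    have "(x / (a + b)) powr 1 \<le> (x / (a + b)) powr p"
      by (rule powr_mono') (use x that s assms in auto)
    then have "x / (a + b) \<le> x powr p / (a + b) powr p" using x s by (simp add: powr_divide)
    then show ?thesis using s by (simp add: field_simps)
  qed simp
  have "(a + b) powr p = a * (a + b) powr p / (a + b) + b * (a + b) powr p / (a + b)"
    using s by (simp add: add_divide_distrib[symmetric] distrib_right[symmetric])
  also have "\<dots> \<le> a powr p + b powr p" using assms by (intro add_mono *) auto
  finally show ?thesis .
qed

text \<open>For p at most 1 subadditivity gives Hoelder continuity with constant 1; for larger p the
  mean value theorem gives a Lipschitz bound on the interval. The exponent \<open>min p 1\<close>
  merges the two cases.\<close>

lemma powr_diff_le: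
  fixes p R :: real
  assumes p: "0 < p"
  obtains K where "0 \<le> K" "\<And>x y d. x \<in> {0..R} \<Longrightarrow> y \<in> {0..R} \<Longrightarrow> \<bar>x - y\<bar> \<le> d \<Longrightarrow> \<bar>x powr p - y powr p\<bar> \<le> K * d powr min p 1"
proof (cases "p \<le> 1")
  case True
  have *: "\<bar>x powr p - y powr p\<bar> \<le> d powr p" if "0 \<le> x" "x \<le> y" "\<bar>x - y\<bar> \<le> d" for x y d
  proof -
    have "y powr p \<le> x powr p + (y - x) powr p" using powr_subadditive[of x "y - x" p] that p True by simp
    also have "(y - x) powr p \<le> d powr p" using that p by (intro powr_mono2) auto
    finally have "y powr p - x powr p \<le> d powr p" by simp
    moreover have "x powr p \<le> y powr p" using that p by (intro powr_mono2) auto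
    ultimately show ?thesis by simp
  qed
  show thesis
  proof (rule that[of 1])
    fix x y d assume "x \<in> {0..R}" "y \<in> {0..R}" "\<bar>x - y\<bar> \<le> d"
    then have "\<bar>x powr p - y powr p\<bar> \<le> d powr p" using *[of x y d] *[of y x d] by (cases "x \<le> y") (auto simp: abs_minus_commute)
    then show "\<bar>x powr p - y powr p\<bar> \<le> 1 * d powr min p 1" using True by simp
  qed simp
next
  case False
  let ?K = "p * \<bar>R\<bar> powr (p - 1)"
  have *: "\<bar>x powr p - y powr p\<bar> \<le> ?K * d" if "0 \<le> x" "x < y" "y \<le> R" "\<bar>x - y\<bar> \<le> d" for x y d
  proof -
    have "\<exists>z>x. z < y \<and> y powr p - x powr p = (y - x) * (p * z powr (p - 1))"
    proof -
      have "\<exists>l z. x < z \<and> z < y \<and> DERIV (\<lambda>x. x powr p) z :> l \<and> y powr p - x powr p = (y - x) * l"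
      proof (rule MVT[OF that(2)])
        show "continuous_on {x..y} (\<lambda>x. x powr p)" using that p by (intro continuous_on_powr' continuous_intros) auto
        show "(\<lambda>x. x powr p) differentiable (at z)" if "x < z" "z < y" for z
          using that \<open>0 \<le> x\<close> has_real_derivative_powr[of z p] by (auto simp: real_differentiable_def)
      qed
      then obtain l z where z: "x < z" "z < y" "DERIV (\<lambda>x. x powr p) z :> l" "y powr p - x powr p = (y - x) * l" by auto
      have "l = p * z powr (p - 1)" using z that has_real_derivative_powr[of z p] by (intro DERIV_unique[OF z(3)]) auto
      then show ?thesis using z by auto
    qed
    then obtain z where z: "x < z" "z < y" "y powr p - x powr p = (y - x) * (p * z powr (p - 1))" by auto
    have "(y - x) * (p * z powr (p - 1)) \<le> d * (p * \<bar>R\<bar> powr (p - 1))"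
      using that z p False by (intro mult_mono powr_mono2) auto
    moreover have "0 \<le> (y - x) * (p * z powr (p - 1))" using that p by simp
    ultimately show ?thesis using z(3) by (simp add: mult_ac abs_minus_commute)
  qed
  show thesis
  proof (rule that[of ?K])
    fix x y d assume a: "x \<in> {0..R}" "y \<in> {0..R}" "\<bar>x - y\<bar> \<le> d"
    then have d: "0 \<le> d" by linarith
    have "\<bar>x powr p - y powr p\<bar> \<le> ?K * d"
    proof (cases x y rule: linorder_cases)
      case equal then show ?thesis using p d by simp
    qed (use a *[of x y d] *[of y x d] in \<open>auto simp: abs_minus_commute\<close>)
    then show "\<bar>x powr p - y powr p\<bar> \<le> ?K * d powr min p 1" using False d by simp
  qed (use p in simp)
qed

text \<open>The covariance of one value \<open>B t\<close> with an increment consists of differences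
  of 2H-th powers at arguments at most \<open>\<epsilon>\<close> apart, so the Hoelder bound applies
  uniformly in the position of the increment.\<close>

lemma (in prob_space) process_span_increment_covariance_bound:
  assumes B: "is_fbm M H B" and H: "0 < H" and C: "C \<in> process_span B" and T: "0 < T"
  obtains A where "0 \<le> A" "\<And>\<epsilon> u. 0 < \<epsilon> \<Longrightarrow> \<epsilon> \<le> 1 \<Longrightarrow> u \<in> {0..T} \<Longrightarrow>
    \<bar>\<integral>\<omega>. C \<omega> * (B (u + \<epsilon>) \<omega> - B u \<omega>) \<partial>M\<bar> \<le> A * \<epsilon> powr min (2*H) 1"
proof -
  note G = gaussian_space_process_span[OF B]
  obtain F c where C': "C = (\<lambda>\<omega>. \<Sum>t\<in>F. c t * B t \<omega>)" "finite F" "F \<subseteq> {0..}"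
    using C unfolding process_span_def by auto
  have F0: "0 \<le> t" if "t \<in> F" for t using that C' by auto
  \<comment> \<open>Large enough to contain \<open>u + \<epsilon>\<close> for
    \<open>\<epsilon> \<le> 1\<close> and every distance between a time in \<open>F\<close> and such
    a point.\<close>
  define R where "R = T + 1 + (\<Sum>t\<in>F. t)"
  have tR: "t \<le> (\<Sum>t\<in>F. t)" if "t \<in> F" for t using that C' F0 by (intro member_le_sum) auto
  obtain K where K: "0 \<le> K" "\<And>x y d. x \<in> {0..R} \<Longrightarrow> y \<in> {0..R} \<Longrightarrow> \<bar>x - y\<bar> \<le> d \<Longrightarrow> \<bar>x powr (2*H) - y powr (2*H)\<bar> \<le> K * d powr min (2*H) 1"
    using powr_diff_le[of "2*H" R] H by auto
  define A where "A = (\<Sum>t\<in>F. \<bar>c t\<bar>) * K"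
  show thesis
  proof (rule that[of A])
    show "0 \<le> A" unfolding A_def using K by (intro mult_nonneg_nonneg sum_nonneg) auto
    fix \<epsilon> u :: real assume e: "0 < \<epsilon>" "\<epsilon> \<le> 1" and u: "u \<in> {0..T}"
    have u0: "0 \<le> u" "0 \<le> u + \<epsilon>" using u e by auto
    have D: "(\<lambda>\<omega>. B (u + \<epsilon>) \<omega> - B u \<omega>) \<in> process_span B"
      by (intro gaussian_space_diff[OF G] process_span_base u0)
    have cov: "(\<integral>\<omega>. B t \<omega> * (B (u + \<epsilon>) \<omega> - B u \<omega>) \<partial>M) =
        ((u + \<epsilon>) powr (2*H) - u powr (2*H) - (\<bar>t - (u + \<epsilon>)\<bar> powr (2*H) - \<bar>t - u\<bar> powr (2*H))) / 2" if t: "t \<in> F" for t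
    proof -
      note i2 = gaussian_space_integrable_product[OF G process_span_base process_span_base]
      have "(\<integral>\<omega>. B t \<omega> * (B (u + \<epsilon>) \<omega> - B u \<omega>) \<partial>M) = fbm_cov H t (u + \<epsilon>) - fbm_cov H t u"
        using i2[OF F0[OF t] u0(1)] i2[OF F0[OF t] u0(2)]
        by (simp add: right_diff_distrib fbm_covariance[OF B] F0[OF t] u0)
      then show ?thesis by (simp add: fbm_cov_def field_simps)
    qed
    have covb: "\<bar>\<integral>\<omega>. B t \<omega> * (B (u + \<epsilon>) \<omega> - B u \<omega>) \<partial>M\<bar> \<le> K * \<epsilon> powr min (2*H) 1" if t: "t \<in> F" for t
    proof -
      have "\<bar>(u + \<epsilon>) powr (2*H) - u powr (2*H)\<bar> \<le> K * \<epsilon> powr min (2*H) 1"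
        by (rule K(2)) (use u e tR[OF t] F0[OF t] in \<open>auto simp: R_def\<close>)
      moreover have "\<bar>\<bar>t - (u + \<epsilon>)\<bar> powr (2*H) - \<bar>t - u\<bar> powr (2*H)\<bar> \<le> K * \<epsilon> powr min (2*H) 1"
        by (rule K(2)) (use u e tR[OF t] F0[OF t] in \<open>auto simp: R_def abs_if\<close>)
      \<comment> \<open>The factor 1/2 in the covariance pays for the two power differences, so the
        constant stays \<open>K\<close>.\<close>
      moreover have "\<bar>(x - y) / 2\<bar> \<le> z" if "\<bar>x\<bar> \<le> z" "\<bar>y\<bar> \<le> z" for x y z :: real using that by simp
      ultimately show ?thesis unfolding cov[OF t] by blast
    qed
    have "(\<integral>\<omega>. C \<omega> * (B (u + \<epsilon>) \<omega> - B u \<omega>) \<partial>M) = (\<integral>\<omega>. (\<Sum>t\<in>F. c t * (B t \<omega> * (B (u + \<epsilon>) \<omega> - B u \<omega>))) \<partial>M)"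
      unfolding C'(1) by (simp only: sum_distrib_right mult.assoc)
    also have "\<dots> = (\<Sum>t\<in>F. c t * (\<integral>\<omega>. B t \<omega> * (B (u + \<epsilon>) \<omega> - B u \<omega>) \<partial>M))"
      by (subst Bochner_Integration.integral_sum)
        (auto intro!: integrable_mult_right gaussian_space_integrable_product[OF G _ D] process_span_base F0)
    also have "\<bar>\<dots>\<bar> \<le> (\<Sum>t\<in>F. \<bar>c t\<bar> * (K * \<epsilon> powr min (2*H) 1))"
      using covb by (intro order_trans[OF sum_abs] sum_mono) (auto simp: abs_mult intro!: mult_left_mono)
    also have "\<dots> = A * \<epsilon> powr min (2*H) 1" unfolding A_def by (simp add: sum_distrib_right mult.assoc)
    finally show "\<bar>\<integral>\<omega>. C \<omega> * (B (u + \<epsilon>) \<omega> - B u \<omega>) \<partial>M\<bar> \<le> A * \<epsilon> powr min (2*H) 1" .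
  qed
qed

section \<open>Convergence in law\<close>

lemma char_normal_law:
  assumes "0 < v"
  shows "real_distribution (normal_law v)" and "char (normal_law v) c = complex_of_real (exp (- (c\<^sup>2 * v) / 2))"
proof -
  have p: "prob_space (normal_law v)" unfolding normal_law_def using assms by (intro prob_space_normal_density) simp
  then show "real_distribution (normal_law v)"
    by (auto simp: real_distribution_def real_distribution_axioms_def normal_law_def)
  interpret prob_space "normal_law v" by fact
  have "distr (normal_law v) lborel (\<lambda>x. x) = normal_law v"
    by (rule distr_id2) (simp add: normal_law_def)
  then have "distributed (normal_law v) lborel (\<lambda>x. x) (normal_density 0 (sqrt v))"
    unfolding distributed_def by (auto simp: normal_law_def)
  then have "centered_gaussian (normal_law v) (\<lambda>x. x) v" unfolding centered_gaussian_def using assms by auto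
  from centered_gaussian_char[OF this, of c] show "char (normal_law v) c = complex_of_real (exp (- (c\<^sup>2 * v) / 2))"
    by (simp add: char_def)
qed

text \<open>The three limit hypotheses match the three terms of the estimate: \<open>lim1\<close>
  the cross covariance, \<open>lim2\<close> the fluctuation of the conditional variance,
  \<open>lim3\<close> its mean. Both regimes of H are then pure asymptotics.\<close>

lemma (in prob_space) fbm_product_conv_law:
  fixes B1 B2 :: "real \<Rightarrow> 'a \<Rightarrow> real" and k :: "real \<Rightarrow> real" and v :: real
  assumes T: "0 < T" and H: "0 < H" and B1: "is_fbm M H B1" and B2: "is_fbm M H B2"
    and indep: "indep_var (Pi\<^sub>M {0..} (\<lambda>_. borel)) (\<lambda>\<omega>. restrict (\<lambda>t. B1 t \<omega>) {0..})
       (Pi\<^sub>M {0..} (\<lambda>_. borel)) (\<lambda>\<omega>. restrict (\<lambda>t. B2 t \<omega>) {0..})"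
    and v: "0 < v"
    and Y: "\<And>\<epsilon> \<omega>. 0 < \<epsilon> \<Longrightarrow> \<omega> \<in> space M \<Longrightarrow> Y \<epsilon> \<omega> = k \<epsilon> *
      integral {0..T} (\<lambda>u. (B1 (u + \<epsilon>) \<omega> - B1 u \<omega>) * (B2 (u + \<epsilon>) \<omega> - B2 u \<omega>))"
    and lim1: "((\<lambda>\<epsilon>. (k \<epsilon>)\<^sup>2 * (\<epsilon> powr min (2*H) 1)\<^sup>2 * (2 * integral {0..T} (\<lambda>x. \<bar>increment_cov H \<epsilon> x\<bar>))) \<longlongrightarrow> 0) (at_right 0)"
    and lim2: "((\<lambda>\<epsilon>. k \<epsilon> * (2 * integral {0..T} (\<lambda>x. \<bar>increment_cov H \<epsilon> x\<bar>))) \<longlongrightarrow> 0) (at_right 0)"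
    and lim3: "((\<lambda>\<epsilon>. (k \<epsilon>)\<^sup>2 * (2 * integral {0..T} (\<lambda>x. (T - x) * (increment_cov H \<epsilon> x)\<^sup>2))) \<longlongrightarrow> v) (at_right 0)"
  shows "conv_law_indep M T (\<lambda>t \<omega>. (B1 t \<omega>, B2 t \<omega>)) Y (normal_law v)"
proof -
  define s where "s \<epsilon> = 2 * integral {0..T} (\<lambda>x. \<bar>increment_cov H \<epsilon> x\<bar>)" for \<epsilon>
  define q where "q \<epsilon> = 2 * integral {0..T} (\<lambda>x. (T - x) * (increment_cov H \<epsilon> x)\<^sup>2)" for \<epsilon>
  define I where "I \<epsilon> \<omega> = integral {0..T} (\<lambda>u. (B1 (u + \<epsilon>) \<omega> - B1 u \<omega>) * (B2 (u + \<epsilon>) \<omega> - B2 u \<omega>))" for \<epsilon> \<omega>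
  define L where "L = {(\<lambda>x. U x + C x) | U C. U \<in> process_span B1 \<and> C \<in> process_span B2}"
  note G1 = gaussian_space_process_span[OF B1] and G2 = gaussian_space_process_span[OF B2]
  note est = fbm_product_integral_estimate[OF T H B1 B2 indep, folded I_def s_def q_def]
  have Im: "I \<epsilon> \<in> borel_measurable M" if "0 < \<epsilon>" for \<epsilon>
    using est(1)[OF process_span_zero process_span_zero that, of 0 0] by (simp add: I_def[abs_def])
  have Ym: "Y \<epsilon> \<in> borel_measurable M" if "0 < \<epsilon>" for \<epsilon>
  proof -
    have "(\<lambda>\<omega>. k \<epsilon> * I \<epsilon> \<omega>) \<in> borel_measurable M" using Im[OF that] by measurable
    then show ?thesis by (subst measurable_cong[where g="\<lambda>\<omega>. k \<epsilon> * I \<epsilon> \<omega>"]) (use Y[OF that] in \<open>auto simp: I_def\<close>)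
  qed
  show ?thesis
  proof (rule conv_law_indep_by_characteristic_functions[OF T Ym char_normal_law(1)[OF v], where L=L])
    show "L \<subseteq> borel_measurable M"
      unfolding L_def using gaussian_space_measurable[OF G1] gaussian_space_measurable[OF G2] by auto
    show "(\<lambda>_. 0) \<in> L" unfolding L_def
      by (rule CollectI, rule exI[of _ "\<lambda>_. 0"], rule exI[of _ "\<lambda>_. 0"]) (simp add: process_span_zero)
    show "(\<lambda>x. l x + c * l' x) \<in> L" if "l \<in> L" "l' \<in> L" for l l' c
    proof -
      obtain U C U' C' where *: "l = (\<lambda>x. U x + C x)" "l' = (\<lambda>x. U' x + C' x)"
        "U \<in> process_span B1" "C \<in> process_span B2" "U' \<in> process_span B1" "C' \<in> process_span B2"
        using \<open>l \<in> L\<close> \<open>l' \<in> L\<close> unfolding L_def by auto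
      show ?thesis unfolding L_def
        by (rule CollectI, rule exI[of _ "\<lambda>x. U x + c * U' x"], rule exI[of _ "\<lambda>x. C x + c * C' x"])
          (use * in \<open>auto intro!: process_span_lincomb simp: algebra_simps\<close>)
    qed
    fix t assume t: "t \<in> {0..T}"
    show "(\<lambda>x. fst (B1 t x, B2 t x)) \<in> L" unfolding L_def
      by (rule CollectI, rule exI[of _ "B1 t"], rule exI[of _ "\<lambda>_. 0"]) (use t in \<open>auto intro: process_span_zero process_span_base\<close>)
    show "(\<lambda>x. snd (B1 t x, B2 t x)) \<in> L" unfolding L_def
      by (rule CollectI, rule exI[of _ "\<lambda>_. 0"], rule exI[of _ "B2 t"]) (use t in \<open>auto intro: process_span_zero process_span_base\<close>)
  next
    fix x assume "x \<in> space M"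
    then show "continuous_on {0..T} (\<lambda>t. (B1 t x, B2 t x))"
      using fbm_shifted_path_continuous[OF B1, of x 0] fbm_shifted_path_continuous[OF B2, of x 0]
      by (intro continuous_on_Pair) auto
  next
    fix l c assume "l \<in> L"
    then obtain U C where l: "l = (\<lambda>x. U x + C x)" and U: "U \<in> process_span B1" and C: "C \<in> process_span B2"
      unfolding L_def by auto
    have [measurable]: "U \<in> borel_measurable M" "C \<in> borel_measurable M"
      using gaussian_space_measurable[OF G1 U] gaussian_space_measurable[OF G2 C] by auto
    obtain A where A: "0 \<le> A" "\<And>\<epsilon> u. 0 < \<epsilon> \<Longrightarrow> \<epsilon> \<le> 1 \<Longrightarrow> u \<in> {0..T} \<Longrightarrow>
      \<bar>\<integral>\<omega>. C \<omega> * (B2 (u + \<epsilon>) \<omega> - B2 u \<omega>) \<partial>M\<bar> \<le> A * \<epsilon> powr min (2*H) 1"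
      by (rule process_span_increment_covariance_bound[OF B2 H C T]) blast
    define E where "E = (\<integral>\<omega>. iexp (U \<omega>) \<partial>M) * (\<integral>\<omega>. iexp (C \<omega>) \<partial>M)"
    \<comment> \<open>With coefficient 0 and variance 0 the estimate has right-hand side 0, so it
      yields the factorisation of the expectation under independence.\<close>
    have E: "(\<integral>\<omega>. iexp (U \<omega> + C \<omega>) \<partial>M) = E"
    proof -
      have "norm ((\<integral>\<omega>. iexp (U \<omega> + C \<omega> + 0 * I 1 \<omega>) \<partial>M) - E * complex_of_real (exp (- 0 / 2))) \<le>
         \<bar>0\<bar> * (A * 1 powr min (2*H) 1) * sqrt (T * s 1) + sqrt (2 * (0 * s 1)\<^sup>2 * (0\<^sup>2 * q 1)) / 2 + \<bar>0\<^sup>2 * q 1 - 0\<bar> / 2"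
        unfolding E_def by (rule est(2)[OF U C]) (use A(1) A(2)[of 1] in auto)
      then show ?thesis by simp
    qed
    define bd where "bd \<epsilon> = \<bar>c\<bar> * A * sqrt (T * ((k \<epsilon>)\<^sup>2 * (\<epsilon> powr min (2*H) 1)\<^sup>2 * s \<epsilon>)) +
       sqrt (2 * (c * (k \<epsilon> * s \<epsilon>))\<^sup>2 * (c\<^sup>2 * ((k \<epsilon>)\<^sup>2 * q \<epsilon>))) / 2 + \<bar>c\<^sup>2 * ((k \<epsilon>)\<^sup>2 * q \<epsilon>) - c\<^sup>2 * v\<bar> / 2" for \<epsilon>
    have bd_lim: "(bd \<longlongrightarrow> 0) (at_right 0)"
    proof -
      have "(bd \<longlongrightarrow> \<bar>c\<bar> * A * sqrt (T * 0) + sqrt (2 * (c * 0)\<^sup>2 * (c\<^sup>2 * v)) / 2 + \<bar>c\<^sup>2 * v - c\<^sup>2 * v\<bar> / 2) (at_right 0)"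
        unfolding bd_def by (intro tendsto_intros lim1[folded s_def] lim2[folded s_def] lim3[folded q_def]) auto
      then show ?thesis by simp
    qed
    have bound: "norm (\<integral>x. iexp (l x) * (iexp (c * Y \<epsilon> x) - char (normal_law v) c) \<partial>M) \<le> bd \<epsilon>" if e: "0 < \<epsilon>" "\<epsilon> \<le> 1" for \<epsilon>
    proof -
      have [measurable]: "Y \<epsilon> \<in> borel_measurable M" by (rule Ym[OF e(1)])
      have i1: "integrable M (\<lambda>x. iexp (U x + C x + (c * k \<epsilon>) * I \<epsilon> x))"
        by (rule integrable_const_bound[where B=1]) (use Im[OF e(1)] in auto)
      have i2: "integrable M (\<lambda>x. iexp (U x + C x) * char (normal_law v) c)"
        by (intro integrable_mult_left integrable_const_bound[where B=1]) auto
      have "(\<integral>x. iexp (l x) * (iexp (c * Y \<epsilon> x) - char (normal_law v) c) \<partial>M) =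
        (\<integral>x. iexp (U x + C x + (c * k \<epsilon>) * I \<epsilon> x) - iexp (U x + C x) * char (normal_law v) c \<partial>M)"
      proof (rule Bochner_Integration.integral_cong[OF refl])
        fix x assume x: "x \<in> space M"
        have y: "c * Y \<epsilon> x = (c * k \<epsilon>) * I \<epsilon> x" using Y[OF e(1) x] by (simp add: I_def)
        have "iexp (U x + C x + (c * k \<epsilon>) * I \<epsilon> x) = iexp (U x + C x) * iexp ((c * k \<epsilon>) * I \<epsilon> x)"
          by (simp only: of_real_add[of "U x + C x"] distrib_left exp_add)
        then show "iexp (l x) * (iexp (c * Y \<epsilon> x) - char (normal_law v) c) =
           iexp (U x + C x + (c * k \<epsilon>) * I \<epsilon> x) - iexp (U x + C x) * char (normal_law v) c"
          unfolding y l by (simp only: right_diff_distrib)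
      qed
      also have "\<dots> = (\<integral>x. iexp (U x + C x + (c * k \<epsilon>) * I \<epsilon> x) \<partial>M) - (\<integral>x. iexp (U x + C x) * char (normal_law v) c \<partial>M)"
        by (rule Bochner_Integration.integral_diff[OF i1 i2])
      also have "(\<integral>x. iexp (U x + C x) * char (normal_law v) c \<partial>M) = E * char (normal_law v) c"
        using E by (simp only: integral_mult_left_zero)
      also have "E * char (normal_law v) c = (\<integral>\<omega>. iexp (U \<omega>) \<partial>M) * (\<integral>\<omega>. iexp (C \<omega>) \<partial>M) * exp (- (c\<^sup>2 * v) / 2)"
        unfolding char_normal_law(2)[OF v] E_def ..
      finally have eq: "(\<integral>x. iexp (l x) * (iexp (c * Y \<epsilon> x) - char (normal_law v) c) \<partial>M) =
        (\<integral>x. iexp (U x + C x + (c * k \<epsilon>) * I \<epsilon> x) \<partial>M) - (\<integral>\<omega>. iexp (U \<omega>) \<partial>M) * (\<integral>\<omega>. iexp (C \<omega>) \<partial>M) * exp (- (c\<^sup>2 * v) / 2)" .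
      have "norm (\<integral>x. iexp (l x) * (iexp (c * Y \<epsilon> x) - char (normal_law v) c) \<partial>M) \<le>
        \<bar>c * k \<epsilon>\<bar> * (A * \<epsilon> powr min (2*H) 1) * sqrt (T * s \<epsilon>) +
        sqrt (2 * ((c * k \<epsilon>) * s \<epsilon>)\<^sup>2 * ((c * k \<epsilon>)\<^sup>2 * q \<epsilon>)) / 2 + \<bar>(c * k \<epsilon>)\<^sup>2 * q \<epsilon> - c\<^sup>2 * v\<bar> / 2"
        unfolding eq by (rule est(2)[OF U C e(1)]) (use A(2)[OF e] A(1) v in auto)
      also have "\<dots> = bd \<epsilon>"
      proof -
        have "\<bar>k \<epsilon>\<bar> * \<epsilon> powr min (2*H) 1 * sqrt (T * s \<epsilon>) = sqrt (T * ((k \<epsilon>)\<^sup>2 * (\<epsilon> powr min (2*H) 1)\<^sup>2 * s \<epsilon>))"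
          by (simp add: real_sqrt_mult mult_ac)
        then have "\<bar>c * k \<epsilon>\<bar> * (A * \<epsilon> powr min (2*H) 1) * sqrt (T * s \<epsilon>) = \<bar>c\<bar> * A * sqrt (T * ((k \<epsilon>)\<^sup>2 * (\<epsilon> powr min (2*H) 1)\<^sup>2 * s \<epsilon>))"
          by (simp only: abs_mult mult_ac)
        moreover have "(c * k \<epsilon>) * s \<epsilon> = c * (k \<epsilon> * s \<epsilon>)" "(c * k \<epsilon>)\<^sup>2 * q \<epsilon> = c\<^sup>2 * ((k \<epsilon>)\<^sup>2 * q \<epsilon>)"
          by (simp_all only: mult.assoc power_mult_distrib)
        ultimately show ?thesis unfolding bd_def by (simp only:)
      qed
      finally show ?thesis .
    qed
    show "((\<lambda>\<epsilon>. \<integral>x. iexp (l x) * (iexp (c * Y \<epsilon> x) - char (normal_law v) c) \<partial>M) \<longlongrightarrow> 0) (at_right 0)"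
    proof (rule Lim_null_comparison[OF _ bd_lim])
      have "eventually (\<lambda>\<epsilon>. 0 < \<epsilon> \<and> \<epsilon> \<le> (1::real)) (at_right 0)"
        by (auto simp: eventually_at_right_field intro!: exI[of _ 1])
      then show "eventually (\<lambda>\<epsilon>. norm (\<integral>x. iexp (l x) * (iexp (c * Y \<epsilon> x) - char (normal_law v) c) \<partial>M) \<le> bd \<epsilon>) (at_right 0)"
        by eventually_elim (use bound in auto)
    qed
  qed
qed

lemma powr_square: "(x powr a)\<^sup>2 = (x::real) powr (2 * a)"
  by (simp add: power2_eq_square powr_add[symmetric])

lemma tendsto_at_right_rescale:
  fixes f :: "real \<Rightarrow> real"
  assumes "0 < T" "(f \<longlongrightarrow> l) at_top"
  shows "((\<lambda>\<epsilon>. f (T / \<epsilon>)) \<longlongrightarrow> l) (at_right 0)"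
proof (rule filterlim_compose[OF assms(2)])
  show "filterlim (\<lambda>\<epsilon>. T / \<epsilon>) at_top (at_right 0)" using assms(1) by real_asymp
qed

lemma tendsto_powr_rescale:
  fixes f :: "real \<Rightarrow> real"
  assumes T: "0 < T" and f: "((\<lambda>x. f x / x powr p) \<longlongrightarrow> l) at_top"
  shows "((\<lambda>\<epsilon>. \<epsilon> powr p * f (T / \<epsilon>)) \<longlongrightarrow> T powr p * l) (at_right 0)"
proof -
  have "((\<lambda>\<epsilon>. T powr p * (f (T / \<epsilon>) / (T / \<epsilon>) powr p)) \<longlongrightarrow> T powr p * l) (at_right 0)"
    by (intro tendsto_mult tendsto_const tendsto_at_right_rescale[OF T f])
  moreover have "eventually (\<lambda>\<epsilon>. T powr p * (f (T / \<epsilon>) / (T / \<epsilon>) powr p) = \<epsilon> powr p * f (T / \<epsilon>)) (at_right 0)"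
    using eventually_at_right_less[of 0] by eventually_elim (use T in \<open>simp add: powr_divide\<close>)
  ultimately show ?thesis by (rule Lim_transform_eventually)
qed

text \<open>Path continuity identifies the Lebesgue interval integral with the gauge integral of the
  estimates, and pulls out both factors \<open>1 / \<epsilon>\<close>.\<close>

lemma G_hat_eq_integral:
  assumes T: "0 < T" and e: "0 < \<epsilon>" and B1: "is_fbm M H B1" and B2: "is_fbm M H B2" and w: "\<omega> \<in> space M"
  shows "G_hat T B1 B2 \<epsilon> \<omega> = integral {0..T} (\<lambda>u. (B1 (u + \<epsilon>) \<omega> - B1 u \<omega>) * (B2 (u + \<epsilon>) \<omega> - B2 u \<omega>)) / \<epsilon>\<^sup>2"
proof -
  let ?g = "\<lambda>u. ((B1 (u + \<epsilon>) \<omega> - B1 u \<omega>) / \<epsilon>) * ((B2 (u + \<epsilon>) \<omega> - B2 u \<omega>) / \<epsilon>)"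
  have "(LBINT u=0..T. ?g u) = integral {0..T} ?g"
    unfolding zero_ereal_def
  proof (rule interval_integral_eq_integral)
    show "set_integrable lborel {0..T} ?g"
      by (rule borel_integrable_atLeastAtMost') (intro continuous_on_mult continuous_on_divide continuous_on_const
          fbm_increment_continuous[OF B1 w] fbm_increment_continuous[OF B2 w]; use e in simp)
  qed (use T in simp)
  also have "\<dots> = integral {0..T} (\<lambda>u. (B1 (u + \<epsilon>) \<omega> - B1 u \<omega>) * (B2 (u + \<epsilon>) \<omega> - B2 u \<omega>) / \<epsilon>\<^sup>2)"
    by (simp add: power2_eq_square)
  also have "\<dots> = integral {0..T} (\<lambda>u. (B1 (u + \<epsilon>) \<omega> - B1 u \<omega>) * (B2 (u + \<epsilon>) \<omega> - B2 u \<omega>)) / \<epsilon>\<^sup>2"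
    by (rule integral_divide)
  finally show ?thesis unfolding G_hat_def .
qed

lemma (in prob_space) G_hat_conv_law_subcritical:
  fixes B1 B2 :: "real \<Rightarrow> 'a \<Rightarrow> real"
  assumes T: "0 < T" and H: "0 < H" and H34: "H < 3/4" and B1: "is_fbm M H B1" and B2: "is_fbm M H B2"
    and indep: "indep_var (Pi\<^sub>M {0..} (\<lambda>_. borel)) (\<lambda>\<omega>. restrict (\<lambda>t. B1 t \<omega>) {0..})
       (Pi\<^sub>M {0..} (\<lambda>_. borel)) (\<lambda>\<omega>. restrict (\<lambda>t. B2 t \<omega>) {0..})"
  shows "conv_law_indep M T (\<lambda>t \<omega>. (B1 t \<omega>, B2 t \<omega>)) (\<lambda>\<epsilon> \<omega>. \<epsilon> powr (3/2 - 2*H) * G_hat T B1 B2 \<epsilon> \<omega>)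
     (normal_law (T * sigma_hat_sq H))"
proof -
  have H1: "H < 1" using H34 by simp
  \<comment> \<open>The exponent is 3/2 - 2H reduced by 2, the two difference quotients in
    \<open>G_hat\<close> accounting for the reduction.\<close>
  define k where "k \<epsilon> = \<epsilon> powr (-1/2 - 2*H)" for \<epsilon> :: real
  define m where "m = min (2*H) 1"
  have pos: "eventually (\<lambda>\<epsilon>. 0 < \<epsilon>) (at_right (0::real))" by (rule eventually_at_right_less)
  show ?thesis
  proof (rule fbm_product_conv_law[OF T H B1 B2 indep, where k=k])
    show "0 < T * sigma_hat_sq H" using T sigma_hat_sq_pos[OF H H1 H34] by simp
  next
    fix \<epsilon> :: real and \<omega> assume e: "0 < \<epsilon>" and w: "\<omega> \<in> space M"
    have kk: "k \<epsilon> = \<epsilon> powr (3/2 - 2*H) / \<epsilon>\<^sup>2"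
    proof -
      have "(3/2 - 2*H) - 2 = -1/2 - 2*H" by simp
      then have "k \<epsilon> = \<epsilon> powr (3/2 - 2*H) / \<epsilon> powr 2" unfolding k_def by (metis powr_diff)
      then show ?thesis using e by simp
    qed
    show "\<epsilon> powr (3/2 - 2*H) * G_hat T B1 B2 \<epsilon> \<omega> =
      k \<epsilon> * integral {0..T} (\<lambda>u. (B1 (u + \<epsilon>) \<omega> - B1 u \<omega>) * (B2 (u + \<epsilon>) \<omega> - B2 u \<omega>))"
      unfolding G_hat_eq_integral[OF T e B1 B2 w] kk by simp
  next
    \<comment> \<open>Total power of \<open>\<epsilon>\<close>: -1 - 4H from the squared
      normalisation, 2m from the cross covariance, 2H + 1 from the rescaled integral. If H is at
      most 1/2 then p = 2H; otherwise p = 2 - 2H, which exceeds 2H - 1 precisely because H <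
      3/4.\<close>
    define p where "p = 2 * m - 2 * H"
    have p: "0 < p" "p > 2*H - 1" using H H34 by (auto simp: p_def m_def min_def)
    have "((\<lambda>\<epsilon>. 2 * (\<epsilon> powr p * cov_abs_integral H (T / \<epsilon>))) \<longlongrightarrow> 2 * (T powr p * 0)) (at_right 0)"
      by (intro tendsto_mult tendsto_const tendsto_powr_rescale[OF T] cov_abs_integral_tendsto H H1 p)
    then have "((\<lambda>\<epsilon>. 2 * (\<epsilon> powr p * cov_abs_integral H (T / \<epsilon>))) \<longlongrightarrow> 0) (at_right 0)" by simp
    moreover have "eventually (\<lambda>\<epsilon>. 2 * (\<epsilon> powr p * cov_abs_integral H (T / \<epsilon>)) =
       (k \<epsilon>)\<^sup>2 * (\<epsilon> powr min (2*H) 1)\<^sup>2 * (2 * integral {0..T} (\<lambda>x. \<bar>increment_cov H \<epsilon> x\<bar>))) (at_right 0)"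
      using pos
    proof eventually_elim
      case (elim \<epsilon>)
      have "\<epsilon> powr p = \<epsilon> powr (2 * (-1/2 - 2*H)) * \<epsilon> powr (2 * m) * \<epsilon> powr (2*H) * \<epsilon> powr 1"
        unfolding powr_add[symmetric] p_def by (rule arg_cong[of _ _ "\<lambda>z. \<epsilon> powr z"]) simp
      then show ?case unfolding increment_cov_abs_integral[OF elim T] k_def m_def[symmetric] powr_square
        using elim by simp
    qed
    ultimately show "((\<lambda>\<epsilon>. (k \<epsilon>)\<^sup>2 * (\<epsilon> powr min (2*H) 1)\<^sup>2 * (2 * integral {0..T} (\<lambda>x. \<bar>increment_cov H \<epsilon> x\<bar>))) \<longlongrightarrow> 0) (at_right 0)"
      by (rule Lim_transform_eventually)
  next
    \<comment> \<open>The powers combine to 1/2, and 1/2 > 2H - 1 is again the condition H <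
      3/4.\<close>
    have "((\<lambda>\<epsilon>. 2 * (\<epsilon> powr (1/2) * cov_abs_integral H (T / \<epsilon>))) \<longlongrightarrow> 2 * (T powr (1/2) * 0)) (at_right 0)"
      using H34 by (intro tendsto_mult tendsto_const tendsto_powr_rescale[OF T] cov_abs_integral_tendsto H H1) auto
    then have "((\<lambda>\<epsilon>. 2 * (\<epsilon> powr (1/2) * cov_abs_integral H (T / \<epsilon>))) \<longlongrightarrow> 0) (at_right 0)" by simp
    moreover have "eventually (\<lambda>\<epsilon>. 2 * (\<epsilon> powr (1/2) * cov_abs_integral H (T / \<epsilon>)) =
       k \<epsilon> * (2 * integral {0..T} (\<lambda>x. \<bar>increment_cov H \<epsilon> x\<bar>))) (at_right 0)"
      using pos
    proof eventually_elim
      case (elim \<epsilon>)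
      have "\<epsilon> powr (1/2) = \<epsilon> powr (-1/2 - 2*H) * \<epsilon> powr (2*H) * \<epsilon> powr 1"
        unfolding powr_add[symmetric] by (rule arg_cong[of _ _ "\<lambda>z. \<epsilon> powr z"]) simp
      then show ?case unfolding increment_cov_abs_integral[OF elim T] k_def using elim by simp
    qed
    ultimately show "((\<lambda>\<epsilon>. k \<epsilon> * (2 * integral {0..T} (\<lambda>x. \<bar>increment_cov H \<epsilon> x\<bar>))) \<longlongrightarrow> 0) (at_right 0)"
      by (rule Lim_transform_eventually)
  next
    \<comment> \<open>The product behaves like x^(4H-3), so the first-moment part of the mean
      vanishes in the limit.\<close>
    have x0: "((\<lambda>x. x * (increment_cov H 1 x)\<^sup>2) \<longlongrightarrow> 0) at_top"
    proof -
      have "((\<lambda>x. (increment_cov H 1 x)\<^sup>2 * x powr (4 - 4*H) * x powr (4*H - 3)) \<longlongrightarrow> (H * (2*H - 1))\<^sup>2 * 0) at_top"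
        by (rule tendsto_mult[OF increment_cov_sq_asymptotic[OF H H1]])
          (use H34 tendsto_neg_powr[of "4*H - 3" "\<lambda>x. x" at_top] filterlim_ident in auto)
      then have "((\<lambda>x. (increment_cov H 1 x)\<^sup>2 * x powr (4 - 4*H) * x powr (4*H - 3)) \<longlongrightarrow> 0) at_top" by simp
      moreover have "eventually (\<lambda>x. (increment_cov H 1 x)\<^sup>2 * x powr (4 - 4*H) * x powr (4*H - 3) = x * (increment_cov H 1 x)\<^sup>2) at_top"
        using eventually_gt_at_top[of 0] by eventually_elim (simp add: mult.assoc powr_add[symmetric])
      ultimately show ?thesis by (rule Lim_transform_eventually)
    qed
    have "((\<lambda>\<epsilon>. 2 * (T * cov_sq_integral H (T / \<epsilon>) - T * (cov_sq_moment H (T / \<epsilon>) / (T / \<epsilon>)))) \<longlongrightarrow>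
        2 * (T * (sigma_hat_sq H / 2) - T * 0)) (at_right 0)"
      by (intro tendsto_mult tendsto_diff tendsto_const tendsto_at_right_rescale[OF T]
          tendsto_at_right_rescale[OF T cov_sq_moment_tendsto[OF H H1 x0]] cov_sq_integral_tendsto H H1 H34)
    moreover have "eventually (\<lambda>\<epsilon>. 2 * (T * cov_sq_integral H (T / \<epsilon>) - T * (cov_sq_moment H (T / \<epsilon>) / (T / \<epsilon>))) =
       (k \<epsilon>)\<^sup>2 * (2 * integral {0..T} (\<lambda>x. (T - x) * (increment_cov H \<epsilon> x)\<^sup>2))) (at_right 0)"
      using pos
    proof eventually_elim
      case (elim \<epsilon>)
      \<comment> \<open>The normalisation cancels all powers of \<open>\<epsilon>\<close> exactly,
        leaving \<open>T * sigma_hat_sq H\<close> as the limit.\<close>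
      have one: "\<epsilon> powr (2 * (-1/2 - 2*H)) * \<epsilon> powr (4*H) * \<epsilon> powr 1 = 1"
        unfolding powr_add[symmetric] using elim by simp
      have "T * (cov_sq_moment H (T / \<epsilon>) / (T / \<epsilon>)) = \<epsilon> * cov_sq_moment H (T / \<epsilon>)" using T by simp
      then have "2 * (T * cov_sq_integral H (T / \<epsilon>) - T * (cov_sq_moment H (T / \<epsilon>) / (T / \<epsilon>))) =
         (\<epsilon> powr (2 * (-1/2 - 2*H)) * \<epsilon> powr (4*H) * \<epsilon> powr 1) * (2 * (T * cov_sq_integral H (T / \<epsilon>) - \<epsilon> * cov_sq_moment H (T / \<epsilon>)))"
        unfolding one by simp
      then show ?case unfolding increment_cov_sq_integral[OF elim T H] k_def powr_square
        using elim by (simp only: powr_one mult_ac)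
    qed
    ultimately show "((\<lambda>\<epsilon>. (k \<epsilon>)\<^sup>2 * (2 * integral {0..T} (\<lambda>x. (T - x) * (increment_cov H \<epsilon> x)\<^sup>2))) \<longlongrightarrow> T * sigma_hat_sq H) (at_right 0)"
      by (auto dest: Lim_transform_eventually)
  qed
qed

text \<open>Here H(2H-1) = 3/8, so the squared unit covariance is asymptotically (9/64)/x and its
  integral up to \<open>T / \<epsilon>\<close> grows like (9/64) times the logarithm; the factor 2
  for both signs of the lag gives 9T/32.\<close>

lemma (in prob_space) G_hat_conv_law_critical:
  fixes B1 B2 :: "real \<Rightarrow> 'a \<Rightarrow> real"
  assumes T: "0 < T" and H: "H = 3/4" and B1: "is_fbm M H B1" and B2: "is_fbm M H B2"
    and indep: "indep_var (Pi\<^sub>M {0..} (\<lambda>_. borel)) (\<lambda>\<omega>. restrict (\<lambda>t. B1 t \<omega>) {0..})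
       (Pi\<^sub>M {0..} (\<lambda>_. borel)) (\<lambda>\<omega>. restrict (\<lambda>t. B2 t \<omega>) {0..})"
  shows "conv_law_indep M T (\<lambda>t \<omega>. (B1 t \<omega>, B2 t \<omega>)) (\<lambda>\<epsilon> \<omega>. G_hat T B1 B2 \<epsilon> \<omega> / sqrt (ln (1/\<epsilon>)))
     (normal_law (9 * T / 32))"
proof -
  have H0: "0 < H" and H1: "H < 1" using H by simp_all
  define \<Lambda> where "\<Lambda> \<epsilon> = ln (1 / \<epsilon>)" for \<epsilon> :: real
  define k where "k \<epsilon> = 1 / (\<epsilon>\<^sup>2 * sqrt (\<Lambda> \<epsilon>))" for \<epsilon> :: real
  have pos: "eventually (\<lambda>\<epsilon>. 0 < \<epsilon> \<and> \<epsilon> < 1) (at_right (0::real))"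
    by (auto simp: eventually_at_right_field intro!: exI[of _ 1])
  have inv: "((\<lambda>\<epsilon>. 1 / \<Lambda> \<epsilon>) \<longlongrightarrow> 0) (at_right 0)" "((\<lambda>\<epsilon>. 1 / sqrt (\<Lambda> \<epsilon>)) \<longlongrightarrow> 0) (at_right 0)"
    unfolding \<Lambda>_def by real_asymp+
  \<comment> \<open>At the critical exponent this tends to a finite constant rather than to 0, so
    the decay needed for the error terms comes from the logarithmic normalisation alone.\<close>
  have abs_lim: "((\<lambda>\<epsilon>. \<epsilon> powr (1/2) * cov_abs_integral H (T / \<epsilon>)) \<longlongrightarrow> T powr (1/2) * (\<bar>H * (2*H - 1)\<bar> / (1/2))) (at_right 0)"
  proof (rule tendsto_powr_rescale[OF T])
    have "((\<lambda>x. \<bar>increment_cov H 1 x * x powr (2 - 2*H)\<bar>) \<longlongrightarrow> \<bar>H * (2*H - 1)\<bar>) at_top"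
      by (rule tendsto_rabs[OF increment_cov_asymptotic[OF H0 H1]])
    moreover have "\<bar>increment_cov H 1 x * x powr (2 - 2*H)\<bar> = \<bar>increment_cov H 1 x\<bar> * x powr (1 - 1/2)" for x
    proof -
      have "x powr (2 - 2*H) = x powr (1 - 1/2)" unfolding H by simp
      then show ?thesis by (simp only: abs_mult abs_of_nonneg[OF powr_ge_zero])
    qed
    ultimately have "((\<lambda>x. \<bar>increment_cov H 1 x\<bar> * x powr (1 - 1/2)) \<longlongrightarrow> \<bar>H * (2*H - 1)\<bar>) at_top" by simp
    then show "((\<lambda>x. cov_abs_integral H x / x powr (1/2)) \<longlongrightarrow> \<bar>H * (2*H - 1)\<bar> / (1/2)) at_top"
      unfolding cov_abs_integral_def
      by (intro integral_over_powr_tendsto continuous_intros continuous_increment_cov H0) auto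
  qed
  have pw: "\<epsilon> powr (2*H) * \<epsilon> = \<epsilon>\<^sup>2 * \<epsilon> powr (1/2)" if "0 < \<epsilon>" for \<epsilon> :: real
  proof -
    have "\<epsilon> powr (2*H) * \<epsilon> powr 1 = \<epsilon> powr 2 * \<epsilon> powr (1/2)" unfolding powr_add[symmetric] H by simp
    then show ?thesis using that by simp
  qed
  have s_eq: "2 * integral {0..T} (\<lambda>x. \<bar>increment_cov H \<epsilon> x\<bar>) = 2 * \<epsilon>\<^sup>2 * (\<epsilon> powr (1/2) * cov_abs_integral H (T / \<epsilon>))" if "0 < \<epsilon>" for \<epsilon>
    unfolding increment_cov_abs_integral[OF that T] mult.assoc[symmetric] pw[OF that, unfolded mult.assoc] using pw[OF that] by simp
  show ?thesis
  proof (rule fbm_product_conv_law[OF T H0 B1 B2 indep, where k=k])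
    show "0 < 9 * T / 32" using T by simp
  next
    fix \<epsilon> :: real and \<omega> assume e: "0 < \<epsilon>" and w: "\<omega> \<in> space M"
    show "G_hat T B1 B2 \<epsilon> \<omega> / sqrt (ln (1/\<epsilon>)) =
      k \<epsilon> * integral {0..T} (\<lambda>u. (B1 (u + \<epsilon>) \<omega> - B1 u \<omega>) * (B2 (u + \<epsilon>) \<omega> - B2 u \<omega>))"
      unfolding G_hat_eq_integral[OF T e B1 B2 w] k_def \<Lambda>_def by simp
  next
    have "((\<lambda>\<epsilon>. 2 * (1 / \<Lambda> \<epsilon>) * (\<epsilon> powr (1/2) * cov_abs_integral H (T / \<epsilon>))) \<longlongrightarrow> 2 * 0 * (T powr (1/2) * (\<bar>H * (2*H - 1)\<bar> / (1/2)))) (at_right 0)"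
      by (intro tendsto_mult[OF tendsto_mult[OF tendsto_const inv(1)] abs_lim])
    moreover have "eventually (\<lambda>\<epsilon>. 2 * (1 / \<Lambda> \<epsilon>) * (\<epsilon> powr (1/2) * cov_abs_integral H (T / \<epsilon>)) =
       (k \<epsilon>)\<^sup>2 * (\<epsilon> powr min (2*H) 1)\<^sup>2 * (2 * integral {0..T} (\<lambda>x. \<bar>increment_cov H \<epsilon> x\<bar>))) (at_right 0)"
      using pos
    proof eventually_elim
      case (elim \<epsilon>)
      then have e: "0 < \<epsilon>" and L: "0 < \<Lambda> \<epsilon>" by (auto simp: \<Lambda>_def ln_div)
      have m: "\<epsilon> powr min (2*H) 1 = \<epsilon>" using e H by simp
      show ?case unfolding s_eq[OF e] m k_def using e L
        by (simp add: power_mult_distrib power_divide) (simp add: power2_eq_square power4_eq_xxxx)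
    qed
    ultimately show "((\<lambda>\<epsilon>. (k \<epsilon>)\<^sup>2 * (\<epsilon> powr min (2*H) 1)\<^sup>2 * (2 * integral {0..T} (\<lambda>x. \<bar>increment_cov H \<epsilon> x\<bar>))) \<longlongrightarrow> 0) (at_right 0)"
      by (auto dest: Lim_transform_eventually)
  next
    have "((\<lambda>\<epsilon>. 2 * (1 / sqrt (\<Lambda> \<epsilon>)) * (\<epsilon> powr (1/2) * cov_abs_integral H (T / \<epsilon>))) \<longlongrightarrow> 2 * 0 * (T powr (1/2) * (\<bar>H * (2*H - 1)\<bar> / (1/2)))) (at_right 0)"
      by (intro tendsto_mult[OF tendsto_mult[OF tendsto_const inv(2)] abs_lim])
    moreover have "eventually (\<lambda>\<epsilon>. 2 * (1 / sqrt (\<Lambda> \<epsilon>)) * (\<epsilon> powr (1/2) * cov_abs_integral H (T / \<epsilon>)) =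
       k \<epsilon> * (2 * integral {0..T} (\<lambda>x. \<bar>increment_cov H \<epsilon> x\<bar>))) (at_right 0)"
      using pos
    proof eventually_elim
      case (elim \<epsilon>)
      then have e: "0 < \<epsilon>" by simp
      show ?case unfolding s_eq[OF e] k_def using e by simp
    qed
    ultimately show "((\<lambda>\<epsilon>. k \<epsilon> * (2 * integral {0..T} (\<lambda>x. \<bar>increment_cov H \<epsilon> x\<bar>))) \<longlongrightarrow> 0) (at_right 0)"
      by (auto dest: Lim_transform_eventually)
  next
    have sq: "((\<lambda>x. (increment_cov H 1 x)\<^sup>2 * x) \<longlongrightarrow> 9/64) at_top"
    proof -
      have "((\<lambda>x. (increment_cov H 1 x)\<^sup>2 * x powr (4 - 4*H)) \<longlongrightarrow> 9/64) at_top"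
      proof -
        have "(H * (2*H - 1))\<^sup>2 = 9/64" unfolding H by (simp add: power2_eq_square)
        then show ?thesis using increment_cov_sq_asymptotic[OF H0 H1] by (simp only:)
      qed
      moreover have "eventually (\<lambda>x. (increment_cov H 1 x)\<^sup>2 * x powr (4 - 4*H) = (increment_cov H 1 x)\<^sup>2 * x) at_top"
        using eventually_gt_at_top[of 0] by eventually_elim (simp add: H)
      ultimately show ?thesis by (rule Lim_transform_eventually)
    qed
    have J: "((\<lambda>x. cov_sq_integral H x / ln x) \<longlongrightarrow> 9/64) at_top"
      unfolding cov_sq_integral_def
      by (rule integral_over_ln_tendsto[OF _ sq]) (intro continuous_intros continuous_increment_cov H0)
    have J1: "((\<lambda>x. cov_sq_moment H x / x) \<longlongrightarrow> 9/64) at_top"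
      by (rule cov_sq_moment_tendsto[OF H0 H1]) (use sq in \<open>simp add: mult.commute\<close>)
    \<comment> \<open>The growth is measured by the logarithm of \<open>T / \<epsilon>\<close> while
      the normalisation uses that of \<open>1 / \<epsilon>\<close>; they differ by the constant
      \<open>ln T\<close>.\<close>
    have lr: "((\<lambda>\<epsilon>. ln (T / \<epsilon>) / \<Lambda> \<epsilon>) \<longlongrightarrow> 1) (at_right 0)"
      unfolding \<Lambda>_def using T by real_asymp
    have "((\<lambda>\<epsilon>. 2 * (T * (cov_sq_integral H (T / \<epsilon>) / ln (T / \<epsilon>)) * (ln (T / \<epsilon>) / \<Lambda> \<epsilon>) - T * (cov_sq_moment H (T / \<epsilon>) / (T / \<epsilon>)) * (1 / \<Lambda> \<epsilon>))) \<longlongrightarrow>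
        2 * (T * (9/64) * 1 - T * (9/64) * 0)) (at_right 0)"
      by (intro tendsto_mult tendsto_diff tendsto_const tendsto_at_right_rescale[OF T J]
          tendsto_at_right_rescale[OF T J1] lr inv(1))
    moreover have "eventually (\<lambda>\<epsilon>. 2 * (T * (cov_sq_integral H (T / \<epsilon>) / ln (T / \<epsilon>)) * (ln (T / \<epsilon>) / \<Lambda> \<epsilon>) - T * (cov_sq_moment H (T / \<epsilon>) / (T / \<epsilon>)) * (1 / \<Lambda> \<epsilon>)) =
       (k \<epsilon>)\<^sup>2 * (2 * integral {0..T} (\<lambda>x. (T - x) * (increment_cov H \<epsilon> x)\<^sup>2))) (at_right 0)"
    proof -
      have "eventually (\<lambda>\<epsilon>. ln (T / \<epsilon>) > 0) (at_right 0)" using T by real_asymp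
      with pos show ?thesis
      proof eventually_elim
        case (elim \<epsilon>)
        then have e: "0 < \<epsilon>" and L: "0 < \<Lambda> \<epsilon>" and lT: "ln (T / \<epsilon>) \<noteq> 0" by (auto simp: \<Lambda>_def ln_div)
        have p4: "\<epsilon> powr (4*H) * \<epsilon> = \<epsilon> ^ 4"
        proof -
          have "\<epsilon> powr (4*H) * \<epsilon> powr 1 = \<epsilon> powr 4" unfolding powr_add[symmetric] H by simp
          then show ?thesis using e by simp
        qed
        have "(k \<epsilon>)\<^sup>2 = 1 / (\<epsilon> ^ 4 * \<Lambda> \<epsilon>)"
          using L by (simp add: k_def power_divide power_mult_distrib power_mult[symmetric])
        then have "(k \<epsilon>)\<^sup>2 * (2 * integral {0..T} (\<lambda>x. (T - x) * (increment_cov H \<epsilon> x)\<^sup>2)) =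
          1 / (\<epsilon> ^ 4 * \<Lambda> \<epsilon>) * (2 * (\<epsilon> ^ 4 * (T * cov_sq_integral H (T / \<epsilon>) - \<epsilon> * cov_sq_moment H (T / \<epsilon>))))"
          unfolding increment_cov_sq_integral[OF e T H0] p4[symmetric] by (simp only: mult.assoc)
        also have "\<dots> = 2 * ((T * cov_sq_integral H (T / \<epsilon>) - \<epsilon> * cov_sq_moment H (T / \<epsilon>)) / \<Lambda> \<epsilon>)"
          using e by simp
        also have "\<dots> = 2 * (T * (cov_sq_integral H (T / \<epsilon>) / ln (T / \<epsilon>)) * (ln (T / \<epsilon>) / \<Lambda> \<epsilon>) - T * (cov_sq_moment H (T / \<epsilon>) / (T / \<epsilon>)) * (1 / \<Lambda> \<epsilon>))"
          using lT T by (simp add: diff_divide_distrib)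
        finally show ?case by simp
      qed
    qed
    ultimately show "((\<lambda>\<epsilon>. (k \<epsilon>)\<^sup>2 * (2 * integral {0..T} (\<lambda>x. (T - x) * (increment_cov H \<epsilon> x)\<^sup>2))) \<longlongrightarrow> 9 * T / 32) (at_right 0)"
      by (auto dest: Lim_transform_eventually)
  qed
qed

theorem theorem6p3:
  fixes M :: "'a measure" and T H :: real and B1 B2 :: "real \<Rightarrow> 'a \<Rightarrow> real"
  assumes "prob_space M"
    and "T > 0" and "0 < H" and "H < 1"
    and "is_fbm M H B1" and "is_fbm M H B2"
    and "prob_space.indep_var M
           (Pi\<^sub>M {0..} (\<lambda>_. borel)) (\<lambda>\<omega>. restrict (\<lambda>t. B1 t \<omega>) {0..})
           (Pi\<^sub>M {0..} (\<lambda>_. borel)) (\<lambda>\<omega>. restrict (\<lambda>t. B2 t \<omega>) {0..})"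
  shows "(H < 3/4 \<longrightarrow>
            conv_law_indep M T (\<lambda>t \<omega>. (B1 t \<omega>, B2 t \<omega>))
              (\<lambda>\<epsilon> \<omega>. \<epsilon> powr (3/2 - 2*H) * G_hat T B1 B2 \<epsilon> \<omega>)
              (normal_law (T * sigma_hat_sq H)))
       \<and> (H = 3/4 \<longrightarrow>
            conv_law_indep M T (\<lambda>t \<omega>. (B1 t \<omega>, B2 t \<omega>))
              (\<lambda>\<epsilon> \<omega>. G_hat T B1 B2 \<epsilon> \<omega> / sqrt (ln (1/\<epsilon>)))
              (normal_law (9 * T / 32)))"
proof -
  interpret prob_space M by fact
  show ?thesis
    using G_hat_conv_law_subcritical[OF assms(2,3) _ assms(5,6,7)]
      G_hat_conv_law_critical[OF assms(2) _ assms(5,6,7)] by blast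
qed

end
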